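(* Let $(P,\pi)$ and $(R,\rho)$ be Lebesgue spaces with continuous probability measures. Any equivalence class in $\mathrm{Gms}(P,R)$ with respect to $$g\sim u\circ g\circ v,\qquad v\in\mathrm{Ams}(P),\ u\in\mathrm{Ams}(R),$$ contains a unique representative of the type $$\mathrm{id}:\mathcal{L}[\nu_1,\nu_2,\dots;\nu_\infty]\to\mathcal{L}_*[\nu_1,\nu_2,\dots;\nu_\infty].$$ That is, for each $g\in \mathrm{Gms}(P,R)$ there is exactly one admissible family $(\nu_1,\nu_2,\dots;\nu_\infty)$ for which there exist measure-preserving bijections (mod $0$) $a:P\to \mathcal{L}[\nu_1,\nu_2,\dots;\nu_\infty]$ and $b:R\to\mathcal{L}_*[\nu_1,\nu_2,\dots;\nu_\infty]$ with $g=b^{-1}\circ\mathrm{id}\circ a$ almost everywhere, and two elements of $\mathrm{Gms}(P,R)$ are equivalent if and only if they have the same family.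
   Context: $\mathbb{R}^\times$ is the set of positive reals, with coordinate $t$. $\mathrm{Gms}(P,R)$ is the space of all (measurable) bijections $g:P\to R$, defined up to almost-everywhere equality, such that images and preimages of sets of zero measure have zero measure. $\mathrm{Ams}(P)$ is the group of invertible measure-preserving transformations of $P$ (up to a.e. equality), similarly $\mathrm{Ams}(R)$. Take countably many copies $\mathbb{R}^\times_1,\mathbb{R}^\times_2,\dots$ of $\mathbb{R}^\times$ and one more copy $\mathbb{R}^\times_\infty$, and put $$\mathcal{L}:=\mathbb{R}^\times_1\sqcup\mathbb{R}^\times_2\sqcup\mathbb{R}^\times_3\sqcup\dots\sqcup(\mathbb{R}^\times_\infty\times[0,1]).$$ A family of (positive) measures $\nu_1,\nu_2,\dots$ and $\nu_\infty$ on $\mathbb{R}^\times$ is called admissible if: (1) $\nu_1,\nu_2,\dots$ are continuous, i.e. have no atoms (but $\nu_\infty$ may have atoms); (2) $\nu_1\ge\nu_2\ge\dots$; (3) the measure $\nu:=\nu_1+\nu_2+\dots+\nu_\infty$ satisfies $\int_{\mathbb{R}^\times}d\nu(t)=1$ and $\int_{\mathbb{R}^\times}t\,d\nu(t)=1$. For an admissible family, $\mathcal{L}[\nu_1,\nu_2,\dots;\nu_\infty]$ is the set $\mathcal{L}$ with the measure equal to $\nu_j$ on $\mathbb{R}^\times_j$ and to $\nu_\infty\times dx$ on $\mathbb{R}^\times_\infty\times[0,1]$, where $dx$ is Lebesgue measure on $[0,1]$; $\mathcal{L}_*[\nu_1,\nu_2,\dots;\nu_\infty]$ is $\mathcal{L}$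 with the same measure multiplied by $t$. $\mathrm{id}$ is the identity map of the set $\mathcal{L}$. *)

theory Defs
  imports "HOL-Probability.Probability"
begin

section \<open>Bijections mod 0\<close>

text \<open>
  A point map defined up to almost-everywhere equality is represented by a total HOL function;
  its values off a conull set carry no information. The witnesses \<open>A\<close> and \<open>B\<close> below are the conull
  sets between which the map is an honest bimeasurable bijection.
\<close>

definition bij_mod0 :: "'a measure \<Rightarrow> 'b measure \<Rightarrow> ('a \<Rightarrow> 'b) \<Rightarrow> 'a set \<Rightarrow> 'b set \<Rightarrow> bool" where
  "bij_mod0 M N g A B \<longleftrightarrow>
     A \<in> sets M \<and> space M - A \<in> null_sets M \<and>
     B \<in> sets N \<and> space N - B \<in> null_sets N \<and>
     bij_betw g A B \<and>
     g \<in> measurable (restrict_space M A) (restrict_space N B) \<and>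
     inv_into A g \<in> measurable (restrict_space N B) (restrict_space M A)"

definition Gms :: "'a measure \<Rightarrow> 'b measure \<Rightarrow> ('a \<Rightarrow> 'b) set" where
  "Gms M N = {g. \<exists>A B. bij_mod0 M N g A B \<and>
                 (\<forall>X\<subseteq>A. X \<in> null_sets M \<longleftrightarrow> g ` X \<in> null_sets N)}"

definition measure_iso :: "'a measure \<Rightarrow> 'b measure \<Rightarrow> ('a \<Rightarrow> 'b) set" where
  "measure_iso M N = {g. \<exists>A B. bij_mod0 M N g A B \<and>
                 (\<forall>X\<in>sets M. X \<subseteq> A \<longrightarrow> emeasure N (g ` X) = emeasure M X)}"

definition Ams :: "'a measure \<Rightarrow> ('a \<Rightarrow> 'a) set" where
  "Ams M = measure_iso M M"

definition inverse_mod0 :: "'a measure \<Rightarrow> 'b measure \<Rightarrow> ('a \<Rightarrow> 'b) \<Rightarrow> ('b \<Rightarrow> 'a) \<Rightarrow> bool" where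
  "inverse_mod0 M N f f' \<longleftrightarrow> (AE x in M. f' (f x) = x) \<and> (AE y in N. f (f' y) = y)"

definition Gms_equiv :: "'a measure \<Rightarrow> 'b measure \<Rightarrow> ('a \<Rightarrow> 'b) \<Rightarrow> ('a \<Rightarrow> 'b) \<Rightarrow> bool" where
  "Gms_equiv P R g h \<longleftrightarrow> (\<exists>v\<in>Ams P. \<exists>u\<in>Ams R. AE x in P. h x = (u \<circ> g \<circ> v) x)"


section \<open>Lebesgue spaces\<close>

text \<open>
  The model spaces are an interval with Lebesgue measure together with at most countably many
  atoms. The interval is \<open>{0..c}\<close>, and the atom of mass \<open>w n\<close> sits at the point \<open>-1 - n\<close>; weights
  may be zero, in which case the point belongs to a null set. The complement of the interval and
  of the atoms is null.
\<close>

definition interval_with_atoms :: "real \<Rightarrow> (nat \<Rightarrow> real) \<Rightarrow> real measure" where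
  "interval_with_atoms c w = completion (measure_of UNIV (sets borel)
     (\<lambda>X. emeasure lborel (X \<inter> {0..c}) + (\<Sum>n. ennreal (w n) * indicator X (- 1 - real n))))"

text \<open>Lebesgue spaces in the sense of Rokhlin are complete; without this assumption the
  isomorphisms with completed measures below would not make sense.\<close>

definition Lebesgue_space :: "'a measure \<Rightarrow> bool" where
  "Lebesgue_space M \<longleftrightarrow> complete_measure M \<and>
     (\<exists>c w. 0 \<le> c \<and> (\<forall>n. 0 \<le> w n) \<and> measure_iso M (interval_with_atoms c w) \<noteq> {})"

definition continuous_measure :: "'a measure \<Rightarrow> bool" where
  "continuous_measure M \<longleftrightarrow> (\<forall>x\<in>space M. {x} \<in> null_sets M)"


section \<open>Admissible families\<close>

abbreviation pos_reals :: "real measure" where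
  "pos_reals \<equiv> restrict_space borel {0<..}"

text \<open>A family \<open>(\<nu>, \<kappa>)\<close> consists of \<open>\<nu> 0 = \<nu>\<^sub>1\<close>, \<open>\<nu> 1 = \<nu>\<^sub>2\<close>, and so on, and
  \<open>\<kappa> = \<nu>\<^sub>\<infinity>\<close>, all of them Borel measures on the positive reals.\<close>

type_synonym family = "(nat \<Rightarrow> real measure) \<times> real measure"

fun total_measure :: "family \<Rightarrow> real measure" where
  "total_measure (\<nu>, \<kappa>) = measure_of {0<..} (sets pos_reals)
     (\<lambda>X. (\<Sum>j. emeasure (\<nu> j) X) + emeasure \<kappa> X)"

fun admissible :: "family \<Rightarrow> bool" where
  "admissible (\<nu>, \<kappa>) \<longleftrightarrow>
     (\<forall>j. sets (\<nu> j) = sets pos_reals) \<and> sets \<kappa> = sets pos_reals \<and>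
     (\<forall>j. continuous_measure (\<nu> j)) \<and>
     (\<forall>j. \<forall>X\<in>sets pos_reals. emeasure (\<nu> (Suc j)) X \<le> emeasure (\<nu> j) X) \<and>
     (\<integral>\<^sup>+t. 1 \<partial>total_measure (\<nu>, \<kappa>)) = 1 \<and>
     (\<integral>\<^sup>+t. ennreal t \<partial>total_measure (\<nu>, \<kappa>)) = 1"


section \<open>The spaces \<open>\<L>\<close> and \<open>\<L>\<^sub>*\<close>\<close>

text \<open>\<open>Copy j t\<close> is the point \<open>t\<close> of the copy of the positive reals carrying \<open>\<nu> j\<close>;
  \<open>Strip t x\<close> is the point \<open>(t, x)\<close> of the product of the last copy with the unit interval.\<close>

datatype point = Copy nat real | Strip real real

fun coord :: "point \<Rightarrow> real" where
  "coord (Copy j t) = t"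
| "coord (Strip t x) = t"

definition L_set :: "point set" where
  "L_set = {Copy j t | j t. 0 < t} \<union> {Strip t x | t x. 0 < t \<and> 0 \<le> x \<and> x \<le> 1}"

definition L_sets :: "point set set" where
  "L_sets = {X. X \<subseteq> L_set \<and>
     (\<forall>j. {t. Copy j t \<in> X} \<in> sets pos_reals) \<and>
     {(t, x). Strip t x \<in> X} \<in> sets (pos_reals \<Otimes>\<^sub>M restrict_space lborel {0..1::real})}"

fun L_space :: "family \<Rightarrow> point measure" where
  "L_space (\<nu>, \<kappa>) = completion (measure_of L_set L_sets
     (\<lambda>X. (\<Sum>j. emeasure (\<nu> j) {t. Copy j t \<in> X})
          + emeasure (\<kappa> \<Otimes>\<^sub>M restrict_space lborel {0..1}) {(t, x). Strip t x \<in> X}))"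

definition L_star :: "family \<Rightarrow> point measure" where
  "L_star F = density (L_space F) (\<lambda>z. ennreal (coord z))"

text \<open>\<open>g = b\<^sup>-\<^sup>1 \<circ> id \<circ> a\<close> almost everywhere, where \<open>c\<close> is the inverse of \<open>b\<close> mod 0 and
  \<open>id\<close> is regarded as a map from \<open>L_space F\<close> to \<open>L_star F\<close>.\<close>

definition represented_by :: "'a measure \<Rightarrow> 'b measure \<Rightarrow> ('a \<Rightarrow> 'b) \<Rightarrow> family \<Rightarrow> bool" where
  "represented_by P R g F \<longleftrightarrow>
     (\<exists>a\<in>measure_iso P (L_space F). \<exists>b\<in>measure_iso R (L_star F). \<exists>c.
        inverse_mod0 R (L_star F) b c \<and> (AE x in P. g x = (c \<circ> id \<circ> a) x))"


section \<open>Evaluation of the measures\<close>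

text \<open>\<open>measure_of\<close> returns the zero measure when its argument is not countably additive; the
  following shows that this does not happen in the definitions above.\<close>

lemma suminf_swap_ennreal:
  fixes f :: "nat \<Rightarrow> nat \<Rightarrow> ennreal"
  shows "(\<Sum>i. \<Sum>j. f i j) = (\<Sum>j. \<Sum>i. f i j)"
proof -
  have "(\<Sum>i. \<Sum>j. f i j) = (\<Sum>i. \<integral>\<^sup>+j. f i j \<partial>count_space UNIV)"
    by (simp add: nn_integral_count_space_nat)
  also have "\<dots> = (\<integral>\<^sup>+j. (\<Sum>i. f i j) \<partial>count_space UNIV)"
    by (rule nn_integral_suminf[symmetric]) auto
  finally show ?thesis by (simp add: nn_integral_count_space_nat)
qed

lemma countably_additive_suminf_plus:
  assumes "\<And>j::nat. countably_additive S (m j)" "countably_additive S k"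
  shows "countably_additive S (\<lambda>X. (\<Sum>j. m j X) + (k X :: ennreal))"
  unfolding countably_additive_def
proof (intro allI impI)
  fix A :: "nat \<Rightarrow> _" assume A: "range A \<subseteq> S" "disjoint_family A" "\<Union>(range A) \<in> S"
  have "(\<Sum>i. (\<Sum>j. m j (A i)) + k (A i)) = (\<Sum>i. \<Sum>j. m j (A i)) + (\<Sum>i. k (A i))"
    by (rule suminf_add[symmetric]) auto
  also have "(\<Sum>i. \<Sum>j. m j (A i)) = (\<Sum>j. \<Sum>i. m j (A i))" by (rule suminf_swap_ennreal)
  also have "\<dots> = (\<Sum>j. m j (\<Union>(range A)))"
    using assms(1) A by (simp add: countably_additive_def)
  also have "(\<Sum>i. k (A i)) = k (\<Union>(range A))"
    using assms(2) A by (simp add: countably_additive_def)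
  finally show "(\<Sum>i. (\<Sum>j. m j (A i)) + k (A i)) = (\<Sum>j. m j (\<Union> (range A))) + k (\<Union> (range A))" .
qed

lemma countably_additive_emeasure: "S \<subseteq> sets M \<Longrightarrow> countably_additive S (emeasure M)"
  unfolding countably_additive_def by (auto intro!: suminf_emeasure)

lemma countably_additive_vimage_emeasure: assumes "\<And>X. X \<in> S \<Longrightarrow> f X \<in> sets M" "\<And>A::nat \<Rightarrow> _. f (\<Union>(range A)) = (\<Union>i. f (A i))"
   "\<And>A B. A \<inter> B = {} \<Longrightarrow> f A \<inter> f B = {}" shows "countably_additive S (\<lambda>X. emeasure M (f X))"
  unfolding countably_additive_def
proof (intro allI impI)
  fix A :: "nat \<Rightarrow> _" assume A: "range A \<subseteq> S" "disjoint_family A" "\<Union>(range A) \<in> S"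
  show "(\<Sum>i. emeasure M (f (A i))) = emeasure M (f (\<Union> (range A)))"
    unfolding assms(2) using A assms(1,3)
    by (intro suminf_emeasure) (auto simp: disjoint_family_on_def image_subset_iff)
qed

lemma emeasure_total_measure:
  assumes "\<And>j. sets (\<nu> j) = sets pos_reals" "sets \<kappa> = sets pos_reals" "X \<in> sets pos_reals"
  shows "emeasure (total_measure (\<nu>, \<kappa>)) X = (\<Sum>j. emeasure (\<nu> j) X) + emeasure \<kappa> X"
  unfolding total_measure.simps
proof (rule emeasure_measure_of[OF refl])
  show "sets pos_reals \<subseteq> Pow {0<..}" using sets.sets_into_space[of _ pos_reals] by auto
  have e: "sets (measure_of {0<..} (sets pos_reals) \<mu>) = sets pos_reals" for \<mu>
    using sets.sigma_sets_eq[of pos_reals] sets.sets_into_space[of _ pos_reals]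
    by (subst sets_measure_of) auto
  show "positive (sets (measure_of {0<..} (sets pos_reals) (\<lambda>X. (\<Sum>j. emeasure (\<nu> j) X) + emeasure \<kappa> X))) 
     (\<lambda>X. (\<Sum>j. emeasure (\<nu> j) X) + emeasure \<kappa> X)" by (simp add: positive_def)
  show "countably_additive (sets (measure_of {0<..} (sets pos_reals) (\<lambda>X. (\<Sum>j. emeasure (\<nu> j) X) + emeasure \<kappa> X))) 
     (\<lambda>X. (\<Sum>j. emeasure (\<nu> j) X) + emeasure \<kappa> X)"
    unfolding e by (intro countably_additive_suminf_plus countably_additive_emeasure) (use assms in auto)
  show "X \<in> sets (measure_of {0<..} (sets pos_reals) (\<lambda>X. (\<Sum>j. emeasure (\<nu> j) X) + emeasure \<kappa> X))"
    unfolding e by fact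
qed

lemma sigma_algebra_L_sets: "sigma_algebra L_set L_sets"
  unfolding sigma_algebra_iff2
proof (intro conjI ballI allI impI)
  show "L_sets \<subseteq> Pow L_set" by (auto simp: L_sets_def)
  show "{} \<in> L_sets" by (auto simp: L_sets_def)
next
  fix s assume s: "s \<in> L_sets"
  have 1: "{t. Copy j t \<in> L_set - s} = space pos_reals - {t. Copy j t \<in> s}" for j
    by (auto simp: L_set_def space_restrict_space)
  have 2: "{(t,x). Strip t x \<in> L_set - s} = space (pos_reals \<Otimes>\<^sub>M restrict_space lborel {0..1::real}) - {(t,x). Strip t x \<in> s}"
    by (auto simp: L_set_def space_restrict_space space_pair_measure)
  show "L_set - s \<in> L_sets" using s unfolding L_sets_def mem_Collect_eq 1 2
    by (intro conjI allI) (blast | (rule sets.compl_sets; blast))+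
next
  fix A :: "nat \<Rightarrow> _" assume s: "range A \<subseteq> L_sets"
  have 1: "{t. Copy j t \<in> \<Union>(range A)} = (\<Union>i. {t. Copy j t \<in> A i})" for j by auto
  have 2: "{(t,x). Strip t x \<in> \<Union>(range A)} = (\<Union>i. {(t,x). Strip t x \<in> A i})" by auto
  show "\<Union>(range A) \<in> L_sets" using s unfolding L_sets_def mem_Collect_eq 1 2
    by (intro conjI allI) (blast | (rule sets.countable_UN; blast))+
qed

lemma emeasure_L_space:
  assumes "\<And>j. sets (\<nu> j) = sets pos_reals" "sets \<kappa> = sets pos_reals" "X \<in> L_sets"
  shows "emeasure (L_space (\<nu>, \<kappa>)) X = (\<Sum>j. emeasure (\<nu> j) {t. Copy j t \<in> X})
          + emeasure (\<kappa> \<Otimes>\<^sub>M restrict_space lborel {0..1}) {(t, x). Strip t x \<in> X}" (is "_ = ?m X")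
proof -
  have e: "sets (measure_of L_set L_sets \<mu>) = L_sets" for \<mu>
    using sigma_algebra.sigma_sets_eq[OF sigma_algebra_L_sets] by (subst sets_measure_of) (auto simp: L_sets_def)
  have p: "sets (\<kappa> \<Otimes>\<^sub>M restrict_space lborel {0..1::real}) = sets (pos_reals \<Otimes>\<^sub>M restrict_space lborel {0..1::real})"
    by (rule sets_pair_measure_cong) (use assms in auto)
  have "emeasure (measure_of L_set L_sets ?m) X = ?m X"
  proof (rule emeasure_measure_of[OF refl])
    show "L_sets \<subseteq> Pow L_set" by (auto simp: L_sets_def)
    show "positive (sets (measure_of L_set L_sets ?m)) ?m" by (simp add: positive_def)
    show "countably_additive (sets (measure_of L_set L_sets ?m)) ?m"
      unfolding e by (intro countably_additive_suminf_plus countably_additive_vimage_emeasure) (use assms p in \<open>auto simp: L_sets_def\<close>)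
  qed (simp add: e assms)
  then show ?thesis using e assms(3) by (simp add: emeasure_completion)
qed

lemma emeasure_interval_with_atoms:
  assumes X: "X \<in> sets borel"
  shows "emeasure (interval_with_atoms c w) X =
     emeasure lborel (X \<inter> {0..c}) + (\<Sum>n. ennreal (w n) * indicator X (- 1 - real n))" (is "_ = ?m X")
proof -
  have e: "sets (measure_of UNIV (sets borel) \<mu>) = sets borel" for \<mu> :: "real set \<Rightarrow> ennreal"
    using sets.sigma_sets_eq[of "borel :: real measure"] by (subst sets_measure_of) auto
  have at: "countably_additive (sets borel) (\<lambda>X. ennreal (w n) * indicator X (- 1 - real n))" for n
    unfolding countably_additive_def by (auto simp: suminf_indicator)
  have eq: "?m = (\<lambda>X. (\<Sum>n. ennreal (w n) * indicator X (- 1 - real n)) + emeasure lborel (X \<inter> {0..c}))"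
    by (simp add: add.commute)
  have "emeasure (measure_of UNIV (sets borel) ?m) X = ?m X"
  proof (rule emeasure_measure_of[OF refl])
    show "positive (sets (measure_of UNIV (sets borel) ?m)) ?m" by (simp add: positive_def)
    show "countably_additive (sets (measure_of UNIV (sets borel) ?m)) ?m"
      unfolding e unfolding eq by (intro countably_additive_suminf_plus countably_additive_vimage_emeasure at) auto
  qed (use e X in auto)
  then show ?thesis unfolding interval_with_atoms_def using e X by (simp add: emeasure_completion)
qed

lemma measurable_coord: "coord \<in> borel_measurable (L_space (\<nu>,\<kappa>))"
proof -
  have e: "sets (measure_of L_set L_sets \<mu>) = L_sets" for \<mu>
    using sigma_algebra.sigma_sets_eq[OF sigma_algebra_L_sets] by (subst sets_measure_of) (auto simp: L_sets_def)
  have sp: "space (measure_of L_set L_sets \<mu>) = L_set" for \<mu>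
    by (rule space_measure_of) (auto simp: L_sets_def)
  have "coord \<in> borel_measurable (measure_of L_set L_sets \<mu>)" for \<mu>
  proof (rule measurableI)
    fix B :: "real set" assume B: "B \<in> sets borel"
    have 1: "{t. Copy j t \<in> coord -` B \<inter> L_set} = B \<inter> {0<..}" for j by (auto simp: L_set_def)
    have 2: "{(t,x). Strip t x \<in> coord -` B \<inter> L_set} = (B \<inter> {0<..}) \<times> {0..1}" by (auto simp: L_set_def)
    have b: "B \<inter> {0<..} \<in> sets pos_reals" using B by (auto simp: sets_restrict_space)
    have u: "{0..1::real} \<in> sets (restrict_space lborel {0..1})" by (auto simp: sets_restrict_space)
    have "coord -` B \<inter> L_set \<in> L_sets"
      unfolding L_sets_def mem_Collect_eq 1 2 using b u by (auto intro: pair_measureI)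
    then show "coord -` B \<inter> space (measure_of L_set L_sets \<mu>) \<in> sets (measure_of L_set L_sets \<mu>)"
      unfolding sp e .
  qed auto
  then show ?thesis unfolding L_space.simps by (rule measurable_completion)
qed
end

theory Submission
  imports Defs
begin

text \<open>Let \<open>f\<close> be the density with respect to \<open>P\<close> of the measure \<open>R\<close> pulled back along a nonsingular
  bijection \<open>g\<close>. Then \<open>g\<close> carries \<open>f P\<close> to \<open>R\<close> and preserves measure, so up to measure preserving changes
  of \<open>P\<close> and \<open>R\<close> the only information in \<open>g\<close> is the function \<open>f\<close> on the probability space \<open>P\<close>.
  In \<open>id : \<L> \<rightarrow> \<L>\<^sub>*\<close> this function is the coordinate \<open>t\<close>. If \<open>a : P \<rightarrow> \<L>\<close> is measure preserving and
  \<open>t \<circ> a = f\<close>, then \<open>b = a \<circ> g\<inverse>\<close> is a measure preserving map \<open>R \<rightarrow> \<L>\<^sub>*\<close>, and conversely \<open>b \<circ> g = a\<close>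
  forces \<open>t \<circ> a = f\<close> (\<open>derivative_L_star_iso\<close>, \<open>coord_eq_derivative\<close>). Thus representing \<open>g\<close> by a
  family means identifying \<open>(P, f)\<close> with \<open>(\<L>, t)\<close>, and what has to be proved is Rokhlin's
  classification of measurable functions on a Lebesgue space.

  Existence (\<open>positive_function_model\<close>). On the line, send \<open>x\<close> to \<open>(f x, x)\<close> and disintegrate the image
  measure over the distribution \<open>\<mu>\<close> of \<open>f\<close> (\<open>disintegration\<close>). The conditional measure \<open>K t\<close>
  on the line has countably many atoms. Number them by decreasing mass, equal masses from left to right;
  the atom of rank \<open>i\<close> goes to the point \<open>t\<close> of the \<open>i\<close>-th copy, and the atomless rest of \<open>K t\<close>, straightened by
  its distribution function, goes to the segment over \<open>t\<close> in the strip. So \<open>\<nu>\<^sub>i\<close> is \<open>\<mu>\<close> weighted with the mass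
  of the \<open>i\<close>-th atom and \<open>\<nu>\<^sub>\<infinity>\<close> is \<open>\<mu>\<close> weighted with the atomless mass. The numbering gives
  \<open>\<nu>\<^sub>1 \<ge> \<nu>\<^sub>2 \<ge> \<dots>\<close>, and since a point of a copy corresponds to at most one point of \<open>P\<close> up to null sets
  and the points of \<open>P\<close> are null, the \<open>\<nu>\<^sub>i\<close> have no atoms.

  Uniqueness (\<open>family_unique\<close>). The sum \<open>\<nu>\<^sub>1 X + \<dots> + \<nu>\<^sub>n X\<close> is the largest measure of a union
  of \<open>n\<close> disjoint sets that lie over \<open>X\<close> and on each of which the coordinate is injective
  (\<open>emeasure_sections_le\<close>). This description is invariant under isomorphisms that preserve the
  coordinate, so all \<open>\<nu>\<^sub>i\<close> are determined, and then \<open>\<nu>\<^sub>\<infinity>\<close> is what is missing to the distribution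
  of the coordinate.

  The statement about equivalence follows by composing isomorphisms.\<close>

section \<open>Isomorphisms mod 0\<close>

text \<open>A bijection mod 0 is handled through a pair of everywhere defined measurable maps that are
  inverse to each other almost everywhere. Such pairs are composed and inverted without keeping track of conull
  domains, and statements holding almost everywhere are transported by \<open>null_iso_AE\<close>. Preservation
  of measure is the separate condition \<open>distr M N u = N\<close>.\<close>

definition null_iso :: "'a measure \<Rightarrow> 'b measure \<Rightarrow> ('a \<Rightarrow> 'b) \<Rightarrow> ('b \<Rightarrow> 'a) \<Rightarrow> bool" where
  "null_iso M N u u' \<longleftrightarrow> u \<in> measurable M N \<and> u' \<in> measurable N M \<and>
     (AE x in M. u' (u x) = x) \<and> (AE y in N. u (u' y) = y) \<and>
     (\<forall>X\<in>null_sets N. u -` X \<inter> space M \<in> null_sets M) \<and>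
     (\<forall>X\<in>null_sets M. u' -` X \<inter> space N \<in> null_sets N)"

lemma null_iso_sym: "null_iso M N u u' \<Longrightarrow> null_iso N M u' u"
  by (auto simp: null_iso_def)

lemma AE_pullback:
  assumes u: "u \<in> measurable M N" and null: "\<And>X. X \<in> null_sets N \<Longrightarrow> u -` X \<inter> space M \<in> null_sets M"
    and ae: "AE y in N. Q y"
  shows "AE x in M. Q (u x)"
proof -
  obtain X where X: "X \<in> null_sets N" "{y\<in>space N. \<not> Q y} \<subseteq> X"
    using ae by (auto simp: eventually_ae_filter)
  then have "{x\<in>space M. \<not> Q (u x)} \<subseteq> u -` X \<inter> space M"
    using measurable_space[OF u] by auto
  then show ?thesis using null[OF X(1)] unfolding eventually_ae_filter by blast
qed

lemma null_iso_AE: "null_iso M N u u' \<Longrightarrow> AE y in N. Q y \<Longrightarrow> AE x in M. Q (u x)"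
  by (rule AE_pullback) (auto simp: null_iso_def)

lemma null_iso_trans:
  assumes u: "null_iso M N u u'" and v: "null_iso N L v v'"
  shows "null_iso M L (v \<circ> u) (u' \<circ> v')"
  unfolding null_iso_def
proof (intro conjI ballI)
  show "v \<circ> u \<in> measurable M L" "u' \<circ> v' \<in> measurable L M"
    using u v by (auto simp: null_iso_def)
  have "AE x in M. v' (v (u x)) = u x" "AE x in M. u' (u x) = x"
    using v by (auto intro!: null_iso_AE[OF u] simp: null_iso_def) (use u in \<open>auto simp: null_iso_def\<close>)
  then show "AE x in M. (u' \<circ> v') ((v \<circ> u) x) = x" by eventually_elim simp
  have "AE x in L. u (u' (v' x)) = v' x" "AE x in L. v (v' x) = x"
    using u by (auto intro!: null_iso_AE[OF null_iso_sym[OF v]] simp: null_iso_def)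
      (use v in \<open>auto simp: null_iso_def\<close>)
  then show "AE x in L. (v \<circ> u) ((u' \<circ> v') x) = x" by eventually_elim simp
  show "(v \<circ> u) -` X \<inter> space M \<in> null_sets M" if "X \<in> null_sets L" for X
  proof -
    have "(v \<circ> u) -` X \<inter> space M = u -` (v -` X \<inter> space N) \<inter> space M"
      using u by (auto simp: null_iso_def dest: measurable_space)
    moreover have "v -` X \<inter> space N \<in> null_sets N" using v that by (auto simp: null_iso_def)
    ultimately show ?thesis using u unfolding null_iso_def by metis
  qed
  show "(u' \<circ> v') -` X \<inter> space L \<in> null_sets L" if "X \<in> null_sets M" for X
  proof -
    have "(u' \<circ> v') -` X \<inter> space L = v' -` (u' -` X \<inter> space N) \<inter> space L"
      using v by (auto simp: null_iso_def dest: measurable_space)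
    moreover have "u' -` X \<inter> space N \<in> null_sets N" using u that by (auto simp: null_iso_def)
    ultimately show ?thesis using v unfolding null_iso_def by metis
  qed
qed

lemma null_sets_of_space_diff:
  assumes "A \<in> sets M" "AE x in M. x \<in> A" shows "space M - A \<in> null_sets M"
  using assms AE_iff_null_sets[of "space M - A" M] by auto

lemma (in complete_measure) AE_imp_sets:
  assumes "AE x in M. Q x" shows "{x\<in>space M. Q x} \<in> sets M"
proof -
  obtain X where X: "X \<in> null_sets M" "{x\<in>space M. \<not> Q x} \<subseteq> X"
    using assms by (auto simp: eventually_ae_filter)
  have "{x\<in>space M. \<not> Q x} \<in> sets M" using complete2[OF X(2,1)] by auto
  then have "space M - {x\<in>space M. \<not> Q x} \<in> sets M" by auto
  also have "space M - {x\<in>space M. \<not> Q x} = {x\<in>space M. Q x}" by auto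
  finally show ?thesis .
qed

text \<open>The values off the conull sets are arbitrary, even outside of the target space; replacing them by a
  constant point makes the map and its inverse measurable.\<close>

lemma bij_mod0_measurable_pair:
  assumes g: "bij_mod0 M N g A B" and x0: "x0 \<in> space M" and y0: "y0 \<in> space N"
    and u_def: "u = (\<lambda>x. if x \<in> A then g x else y0)"
    and u'_def: "u' = (\<lambda>y. if y \<in> B then inv_into A g y else x0)"
  shows "u \<in> measurable M N" "u' \<in> measurable N M" "AE x in M. g x = u x"
    "AE x in M. u' (u x) = x" "AE y in N. u (u' y) = y"
proof -
  note d = g[unfolded bij_mod0_def]
  have AE: "AE x in M. x \<in> A" "AE y in N. y \<in> B"
    using d by (auto simp: AE_iff_null_sets intro!: AE_I'[of "space M - A"] AE_I'[of "space N - B"])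
  have A: "A \<in> sets M" "A \<subseteq> space M" "B \<in> sets N" "B \<subseteq> space N" using d sets.sets_into_space by auto
  have 1: "g \<in> measurable (restrict_space M A) N"
    using d by (auto simp: measurable_restrict_space2_iff)
  have 2: "inv_into A g \<in> measurable (restrict_space N B) M"
    using d by (auto simp: measurable_restrict_space2_iff)
  show "u \<in> measurable M N" unfolding u_def
    using A y0 1 by (intro measurable_If_restrict_space_iff[THEN iffD2]) (auto intro!: measurable_const simp: space_restrict_space)
  show "u' \<in> measurable N M" unfolding u'_def
    using A x0 2 by (intro measurable_If_restrict_space_iff[THEN iffD2]) (auto intro!: measurable_const simp: space_restrict_space)
  have bij: "bij_betw g A B" using d by auto
  show "AE x in M. g x = u x" using AE(1) by eventually_elim (simp add: u_def)
  show "AE x in M. u' (u x) = x" using AE(1)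
    by eventually_elim (use bij in \<open>auto simp: u_def u'_def bij_betw_def\<close>)
  show "AE y in N. u (u' y) = y" using AE(2)
    by eventually_elim (use bij in \<open>auto simp: u_def u'_def bij_betw_def f_inv_into_f inv_into_into\<close>)
qed

lemma Gms_null_iso:
  assumes g: "g \<in> Gms M N" and ne: "space M \<noteq> {}" "space N \<noteq> {}"
  obtains u u' where "null_iso M N u u'" "AE x in M. g x = u x"
proof -
  obtain A B where b: "bij_mod0 M N g A B" and null: "\<And>X. X \<subseteq> A \<Longrightarrow> X \<in> null_sets M \<longleftrightarrow> g ` X \<in> null_sets N"
    using g unfolding Gms_def by auto
  obtain x0 y0 where 0: "x0 \<in> space M" "y0 \<in> space N" using ne by auto
  define u where "u = (\<lambda>x. if x \<in> A then g x else y0)"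
  define u' where "u' = (\<lambda>y. if y \<in> B then inv_into A g y else x0)"
  note p = bij_mod0_measurable_pair[OF b 0 u_def u'_def]
  note d = b[unfolded bij_mod0_def]
  have bij: "bij_betw g A B" using d by auto
  have "null_iso M N u u'" unfolding null_iso_def
  proof (intro conjI ballI p)
    fix X assume X: "X \<in> null_sets N"
    have "g ` (A \<inter> (u -` X \<inter> space M)) = B \<inter> X"
      using bij d sets.sets_into_space[of A M] by (auto simp: u_def bij_betw_def image_iff)
    moreover have "B \<inter> X \<in> null_sets N" using X d by (simp add: null_set_Int1 Int_commute)
    ultimately have "A \<inter> (u -` X \<inter> space M) \<in> null_sets M" using null[of "A \<inter> (u -` X \<inter> space M)"] by auto
    moreover have "space M - A \<in> null_sets M" using d by auto
    ultimately have "A \<inter> (u -` X \<inter> space M) \<union> (space M - A) \<in> null_sets M" by auto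
    moreover have "u -` X \<inter> space M \<in> sets M" using p(1) X by (auto simp: null_sets_def)
    ultimately show "u -` X \<inter> space M \<in> null_sets M" by (rule null_sets_subset) auto
  next
    fix X assume X: "X \<in> null_sets M"
    have "A \<inter> X \<in> null_sets M" using X d by (simp add: null_set_Int1 Int_commute)
    then have 1: "g ` (A \<inter> X) \<in> null_sets N" using null[of "A \<inter> X"] by auto
    have "B \<inter> (u' -` X \<inter> space N) \<subseteq> g ` (A \<inter> X)"
    proof safe
      fix y assume y: "y \<in> B" "u' y \<in> X"
      then have "y = g (inv_into A g y)" "inv_into A g y \<in> A \<inter> X"
        using bij by (auto simp: u'_def bij_betw_def inv_into_into f_inv_into_f)
      then show "y \<in> g ` (A \<inter> X)" by (rule image_eqI)
    qed
    then have sub: "u' -` X \<inter> space N \<subseteq> g ` (A \<inter> X) \<union> (space N - B)" by auto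
    have "space N - B \<in> null_sets N" using d by auto
    with 1 have "g ` (A \<inter> X) \<union> (space N - B) \<in> null_sets N" by auto
    moreover have "u' -` X \<inter> space N \<in> sets N" using p(2) X by (auto simp: null_sets_def)
    ultimately show "u' -` X \<inter> space N \<in> null_sets N" using sub by (rule null_sets_subset)
  qed
  then show ?thesis using p(3) that by blast
qed

text \<open>In complete spaces the set where the two maps are inverse to each other and agree with \<open>g\<close> is
  measurable, as is its counterpart in \<open>N\<close>; these two sets are the domains of the honest bijection.\<close>

lemma null_iso_bij_mod0:
  assumes M: "complete_measure M" and N: "complete_measure N"
    and u: "null_iso M N u u'" and g: "AE x in M. g x = u x"
  obtains A B where "bij_mod0 M N g A B" "\<And>x. x \<in> A \<Longrightarrow> g x = u x" "\<And>x. x \<in> A \<Longrightarrow> u' (u x) = x"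
    "\<And>y. y \<in> B \<Longrightarrow> u' y \<in> A" "\<And>y. y \<in> B \<Longrightarrow> u (u' y) = y" "\<And>x. x \<in> A \<Longrightarrow> u x \<in> B"
proof -
  define A where "A = {x\<in>space M. g x = u x \<and> u' (u x) = x}"
  define B where "B = {y\<in>space N. u (u' y) = y \<and> u' y \<in> A}"
  note d = u[unfolded null_iso_def]
  have A: "AE x in M. g x = u x \<and> u' (u x) = x" using d g by auto
  then have AEA: "AE x in M. x \<in> A" by (auto simp: A_def elim: eventually_mono)
  have "AE y in N. u' y \<in> A" using null_iso_AE[OF null_iso_sym[OF u] AEA] .
  then have B: "AE y in N. u (u' y) = y \<and> u' y \<in> A" using d by auto
  then have AEB: "AE y in N. y \<in> B" by (auto simp: B_def elim: eventually_mono)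
  have sA: "A \<in> sets M" using complete_measure.AE_imp_sets[OF M A] unfolding A_def .
  have sB: "B \<in> sets N" using complete_measure.AE_imp_sets[OF N B] unfolding B_def .
  have 1: "g x = u x" "u' (u x) = x" "u x \<in> B" if "x \<in> A" for x
    using that d by (auto simp: A_def B_def dest: measurable_space)
  have 2: "u' y \<in> A" "u (u' y) = y" if "y \<in> B" for y using that by (auto simp: B_def)
  have bij: "bij_betw g A B"
    by (rule bij_betwI[where g=u']) (use 1 2 in auto)
  have inv: "inv_into A g y = u' y" if "y \<in> B" for y
    using that 1 2 by (intro inv_into_f_eq bij_betw_imp_inj_on[OF bij]) auto
  have "g \<in> measurable (restrict_space M A) (restrict_space N B)"
  proof (subst measurable_cong[where g=u])
    show "u \<in> measurable (restrict_space M A) (restrict_space N B)"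
      using d 1 by (intro measurable_restrict_space3) auto
  qed (use 1 in \<open>auto simp: space_restrict_space\<close>)
  moreover have "inv_into A g \<in> measurable (restrict_space N B) (restrict_space M A)"
  proof (subst measurable_cong[where g=u'])
    show "u' \<in> measurable (restrict_space N B) (restrict_space M A)"
      using d 2 by (intro measurable_restrict_space3) auto
  qed (use inv in \<open>auto simp: space_restrict_space\<close>)
  ultimately have "bij_mod0 M N g A B" unfolding bij_mod0_def
    using sA sB bij AEA AEB by (auto intro!: null_sets_of_space_diff)
  then show ?thesis using 1 2 that by blast
qed

lemma null_iso_image:
  assumes b: "bij_mod0 M N g A B" and u: "u \<in> measurable M N" "u' \<in> measurable N M"
    and eq: "\<And>x. x \<in> A \<Longrightarrow> g x = u x" "\<And>x. x \<in> A \<Longrightarrow> u' (u x) = x"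
     "\<And>y. y \<in> B \<Longrightarrow> u' y \<in> A" "\<And>y. y \<in> B \<Longrightarrow> u (u' y) = y" "\<And>x. x \<in> A \<Longrightarrow> u x \<in> B"
    and X: "X \<subseteq> A"
  shows "g ` X = B \<inter> (u' -` X \<inter> space N)" "X = A \<inter> (u -` (g ` X) \<inter> space M)"
proof -
  have B: "B \<subseteq> space N" "A \<subseteq> space M" using b sets.sets_into_space unfolding bij_mod0_def by blast+
  show "g ` X = B \<inter> (u' -` X \<inter> space N)"
  proof (intro equalityI subsetI)
    fix y assume "y \<in> g ` X"
    then obtain x where x: "x \<in> X" "x \<in> A" "y = g x" using X by auto
    then show "y \<in> B \<inter> (u' -` X \<inter> space N)" using eq(1,2,5)[of x] B by auto
  next
    fix y assume y: "y \<in> B \<inter> (u' -` X \<inter> space N)"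
    then have "y = g (u' y)" using eq(1)[of "u' y"] eq(3,4)[of y] by simp
    then show "y \<in> g ` X" using y by blast
  qed
  show "X = A \<inter> (u -` (g ` X) \<inter> space M)"
  proof (intro equalityI subsetI)
    fix x assume "x \<in> A \<inter> (u -` (g ` X) \<inter> space M)"
    then obtain z where "z \<in> X" "u x = g z" "x \<in> A" by auto
    then have "z = x" using eq(2)[of x] eq(1,2)[of z] X by auto
    then show "x \<in> X" using \<open>z \<in> X\<close> by simp
  next
    fix x assume "x \<in> X"
    then show "x \<in> A \<inter> (u -` (g ` X) \<inter> space M)" using eq(1)[of x] X B by force
  qed
qed

lemma distr_left_inverse:
  assumes u: "u \<in> measurable M N" "u' \<in> measurable N M" and inv: "AE x in M. u' (u x) = x" and eq: "distr M N u = N"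
  shows "distr N M u' = M"
proof -
  have "distr N M u' = distr (distr M N u) M u'" by (simp add: eq)
  also have "\<dots> = distr M M (u' \<circ> u)" by (rule distr_distr) (use u in auto)
  also have "\<dots> = distr M M (\<lambda>x. x)" by (rule distr_cong_AE) (use u inv in auto)
  finally show ?thesis by (simp add: distr_id2)
qed

text \<open>This reduces everything about \<open>measure_iso\<close> to measurable pairs and image measures.\<close>

lemma measure_iso_iff:
  assumes M: "complete_measure M" and N: "complete_measure N" and ne: "space M \<noteq> {}" "space N \<noteq> {}"
  shows "g \<in> measure_iso M N \<longleftrightarrow> (\<exists>u u'. null_iso M N u u' \<and> (AE x in M. g x = u x) \<and> distr M N u = N)"
proof (rule iffI)
  assume g: "g \<in> measure_iso M N"
  then obtain A B where b: "bij_mod0 M N g A B"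
    and mp: "\<And>X. X \<in> sets M \<Longrightarrow> X \<subseteq> A \<Longrightarrow> emeasure N (g ` X) = emeasure M X"
    unfolding measure_iso_def by auto
  obtain x0 y0 where 0: "x0 \<in> space M" "y0 \<in> space N" using ne by auto
  define u where "u = (\<lambda>x. if x \<in> A then g x else y0)"
  define u' where "u' = (\<lambda>y. if y \<in> B then inv_into A g y else x0)"
  note p = bij_mod0_measurable_pair[OF b 0 u_def u'_def]
  note d = b[unfolded bij_mod0_def]
  have bij: "bij_betw g A B" using d by auto
  have AE: "AE x in M. x \<in> A" "AE y in N. y \<in> B"
    using d by (auto intro!: AE_I'[of "space M - A"] AE_I'[of "space N - B"])
  have eq: "distr M N u = N"
  proof (rule measure_eqI)
    fix X assume X: "X \<in> sets (distr M N u)"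
    then have uX: "u -` X \<inter> space M \<in> sets M" using p(1) by auto
    have "emeasure (distr M N u) X = emeasure M (u -` X \<inter> space M)"
      using X p(1) by (simp add: emeasure_distr)
    also have "\<dots> = emeasure M (A \<inter> (u -` X \<inter> space M))"
      using AE(1) uX d by (intro emeasure_eq_AE) auto
    also have "\<dots> = emeasure N (g ` (A \<inter> (u -` X \<inter> space M)))"
      using uX d by (intro mp[symmetric]) auto
    also have "g ` (A \<inter> (u -` X \<inter> space M)) = B \<inter> X"
      using bij d sets.sets_into_space[of A M] by (auto simp: u_def bij_betw_def image_iff)
    also have "emeasure N (B \<inter> X) = emeasure N X"
      using AE(2) X d by (intro emeasure_eq_AE) auto
    finally show "emeasure (distr M N u) X = emeasure N X" .
  qed simp
  have "null_iso M N u u'" unfolding null_iso_def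
  proof (intro conjI ballI p)
    fix X assume X: "X \<in> null_sets N"
    then show "u -` X \<inter> space M \<in> null_sets M"
      using p(1) by (intro null_setsI) (auto simp: emeasure_distr[symmetric] eq null_sets_def)
  next
    fix X assume X: "X \<in> null_sets M"
    have "u' -` X \<inter> space N \<in> sets N" using X p(2) by (auto simp: null_sets_def)
    have eq': "distr N M u' = M" by (rule distr_left_inverse[OF p(1,2,4) eq])
    from X show "u' -` X \<inter> space N \<in> null_sets N"
      using p(2) by (intro null_setsI) (auto simp: emeasure_distr[symmetric] eq' null_sets_def)
  qed
  then show "\<exists>u u'. null_iso M N u u' \<and> (AE x in M. g x = u x) \<and> distr M N u = N" using eq p(3) by blast
next
  assume "\<exists>u u'. null_iso M N u u' \<and> (AE x in M. g x = u x) \<and> distr M N u = N"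
  then obtain u u' where u: "null_iso M N u u'" and g: "AE x in M. g x = u x" and eq: "distr M N u = N" by blast
  obtain A B where b: "bij_mod0 M N g A B" and e: "\<And>x. x \<in> A \<Longrightarrow> g x = u x" "\<And>x. x \<in> A \<Longrightarrow> u' (u x) = x"
    "\<And>y. y \<in> B \<Longrightarrow> u' y \<in> A" "\<And>y. y \<in> B \<Longrightarrow> u (u' y) = y" "\<And>x. x \<in> A \<Longrightarrow> u x \<in> B"
    by (rule null_iso_bij_mod0[OF M N u g]) blast
  note d = u[unfolded null_iso_def] b[unfolded bij_mod0_def]
  have AE: "AE x in M. x \<in> A" using d by (auto intro!: AE_I'[of "space M - A"])
  have "emeasure N (g ` X) = emeasure M X" if X: "X \<in> sets M" "X \<subseteq> A" for X
  proof -
    have i1: "g ` X = B \<inter> (u' -` X \<inter> space N)" and i2: "X = A \<inter> (u -` (g ` X) \<inter> space M)"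
      using null_iso_image[OF b _ _ e X(2)] d by blast+
    have "B \<inter> (u' -` X \<inter> space N) \<in> sets N"
      using d X by (intro sets.Int measurable_sets[of u' N M]) auto
    then have gX: "g ` X \<in> sets N" unfolding i1[symmetric] .
    have m: "u -` (g ` X) \<inter> space M \<in> sets M" using d gX by (intro measurable_sets[of u M N]) auto
    have "emeasure (distr M N u) (g ` X) = emeasure M (u -` (g ` X) \<inter> space M)"
      using d gX by (intro emeasure_distr) auto
    also have "emeasure M (u -` (g ` X) \<inter> space M) = emeasure M (A \<inter> (u -` (g ` X) \<inter> space M))"
      using AE d m by (intro emeasure_eq_AE) auto
    also have "\<dots> = emeasure M X" unfolding i2[symmetric] ..
    finally show ?thesis by (simp add: eq)
  qed
  then show "g \<in> measure_iso M N" using b unfolding measure_iso_def by blast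
qed

lemma null_iso_distr_inverse:
  "null_iso M N u u' \<Longrightarrow> distr M N u = N \<Longrightarrow> distr N M u' = M"
  unfolding null_iso_def by (intro distr_left_inverse[of u M N u']) auto

lemma null_iso_distr_trans:
  assumes "null_iso M N u u'" "null_iso N L v v'" "distr M N u = N" "distr N L v = L"
  shows "distr M L (v \<circ> u) = L"
proof -
  have "distr M L (v \<circ> u) = distr (distr M N u) L v"
    using assms(1,2) unfolding null_iso_def by (intro distr_distr[symmetric]) auto
  then show ?thesis by (simp only: assms(3,4))
qed

text \<open>A Borel map with a one-sided Borel inverse is an isomorphism of the completed
  spaces: the set of \<open>y\<close> with \<open>u (u' y) = y\<close> contains almost every value of \<open>u\<close>, so it is conull in the
  image \<open>N\<close>.\<close>

lemma null_iso_completion: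
  assumes u: "u \<in> measurable M N" "u' \<in> measurable N M" and eq: "distr M N u = N"
    and inv: "AE x in M. u' (u x) = x" and sep: "{y\<in>space N. u (u' y) = y} \<in> sets N"
  shows "null_iso (completion M) (completion N) u u'" "distr (completion M) (completion N) u = completion N"
proof -
  have inv2: "AE y in N. u (u' y) = y"
  proof -
    have "AE y in distr M N u. u (u' y) = y"
      using inv u sep by (subst AE_distr_iff) (auto elim: eventually_mono)
    then show ?thesis unfolding eq .
  qed
  have eq': "distr N M u' = M" by (rule distr_left_inverse[OF u inv eq])
  have c: "distr (completion M) N u = N" "distr (completion N) M u' = M"
    using distr_completion[OF u(1)] distr_completion[OF u(2)] eq eq' by auto
  have m: "u \<in> measurable (completion M) N" "u' \<in> measurable (completion N) M"
    using u by (auto intro: measurable_completion)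
  have m2: "u \<in> measurable (completion M) (completion N)" "u' \<in> measurable (completion N) (completion M)"
    using m c by (auto intro!: completion.measurable_completion2)
  show d: "distr (completion M) (completion N) u = completion N"
    using completion.completion_distr_eq[OF m(1)] c by simp
  have d': "distr (completion N) (completion M) u' = completion M"
    using completion.completion_distr_eq[OF m(2)] c by simp
  show "null_iso (completion M) (completion N) u u'"
    unfolding null_iso_def
  proof (intro conjI ballI m2)
    show "AE x in completion M. u' (u x) = x" "AE x in completion N. u (u' x) = x"
      using inv inv2 by (auto intro: AE_completion)
    show "u -` X \<inter> space (completion M) \<in> null_sets (completion M)" if "X \<in> null_sets (completion N)" for X
      using that m2(1) null_sets_distr_iff[OF m2(1), of X] d by simp
    show "u' -` X \<inter> space (completion N) \<in> null_sets (completion N)" if "X \<in> null_sets (completion M)" for X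
      using that m2(2) null_sets_distr_iff[OF m2(2), of X] d' by simp
  qed
qed

section \<open>Disintegration along a projection\<close>

text \<open>Both functions have the same integral over each subset of \<open>{g < f}\<close>, hence coincide there
  almost everywhere.\<close>

lemma (in finite_measure) AE_le_if_nn_integral_le:
  assumes f[measurable]: "f \<in> borel_measurable M" and g[measurable]: "g \<in> borel_measurable M"
    and le: "\<And>A. A \<in> sets M \<Longrightarrow> (\<integral>\<^sup>+x. f x * indicator A x \<partial>M) \<le> (\<integral>\<^sup>+x. g x * indicator A x \<partial>M)"
  shows "AE x in M. f x \<le> (g x :: ennreal)"
proof -
  define D where "D = {x\<in>space M. g x < f x}"
  have D[measurable]: "D \<in> sets M" unfolding D_def by measurable
  have "AE x in M. f x * indicator D x = g x * indicator D x"
  proof (rule density_unique_finite_measure)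
    fix A assume A[measurable]: "A \<in> sets M"
    have "(\<integral>\<^sup>+x. f x * indicator D x * indicator A x \<partial>M) = (\<integral>\<^sup>+x. f x * indicator (D \<inter> A) x \<partial>M)"
      by (intro nn_integral_cong) (auto simp: indicator_def)
    moreover have "(\<integral>\<^sup>+x. g x * indicator D x * indicator A x \<partial>M) = (\<integral>\<^sup>+x. g x * indicator (D \<inter> A) x \<partial>M)"
      by (intro nn_integral_cong) (auto simp: indicator_def)
    moreover have "(\<integral>\<^sup>+x. g x * indicator (D \<inter> A) x \<partial>M) \<le> (\<integral>\<^sup>+x. f x * indicator (D \<inter> A) x \<partial>M)"
      by (intro nn_integral_mono) (auto simp: indicator_def D_def)
    ultimately show "(\<integral>\<^sup>+x. f x * indicator D x * indicator A x \<partial>M) = (\<integral>\<^sup>+x. g x * indicator D x * indicator A x \<partial>M)"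
      using le[of "D \<inter> A"] by simp
  qed auto
  then show ?thesis using AE_space
  proof eventually_elim
    case (elim x)
    show "f x \<le> g x"
    proof (rule ccontr)
      assume "\<not> f x \<le> g x"
      then have "x \<in> D" using elim by (simp add: D_def)
      then have "f x = g x" using elim by simp
      with \<open>\<not> f x \<le> g x\<close> show False by simp
    qed
  qed
qed

text \<open>Monotonicity in \<open>x\<close> holds off a null set that depends on the pair of arguments, so only rational arguments
  can be used for almost every \<open>t\<close> at once. The infimum over the rationals to the right of \<open>x\<close>
  restores right continuity; on the exceptional null set the distribution function of the point
  mass at \<open>0\<close> is used instead.\<close>

lemma kernel_of_distribution_functions:
  fixes \<phi> :: "real \<Rightarrow> 't \<Rightarrow> ennreal"
  assumes [measurable]: "\<And>x. \<phi> x \<in> borel_measurable \<mu>"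
    and mono: "\<And>x y. x \<le> y \<Longrightarrow> AE t in \<mu>. \<phi> x t \<le> \<phi> y t"
    and top: "AE t in \<mu>. (SUP n::nat. \<phi> (real n) t) = 1"
    and bot: "AE t in \<mu>. (INF n::nat. \<phi> (- real n) t) = 0"
  obtains K where "K \<in> measurable \<mu> (prob_algebra borel)"
    "\<And>x. AE t in \<mu>. emeasure (K t) {..x} = (INF q\<in>{q\<in>\<rat>. x < q}. \<phi> q t)"
proof -
  define good where "good t \<longleftrightarrow> (\<forall>q\<in>\<rat>. \<forall>r\<in>\<rat>. q \<le> r \<longrightarrow> \<phi> q t \<le> \<phi> r t) \<and>
    (SUP n::nat. \<phi> (real n) t) = 1 \<and> (INF n::nat. \<phi> (- real n) t) = 0" for t
  have c[simp]: "countable (\<rat> :: real set)" by (rule countable_rat)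
  have good[measurable]: "Measurable.pred \<mu> good"
    unfolding good_def by (intro pred_intros_logic pred_intros_countable_bounded c) measurable
  have AE_good: "AE t in \<mu>. good t"
    unfolding good_def using mono top bot
    by (intro AE_conjI AE_ball_countable[THEN iffD2] ballI c) auto
  define F where "F t x = (if good t then enn2real (INF q\<in>{q\<in>\<rat>. x < q}. \<phi> q t) else indicator {0..} x)" for t x
  have rat_gt: "\<exists>q\<in>\<rat>. x < q \<and> q < y" if "x < y" for x y :: real using Rats_dense_in_real[OF that] by blast
  have le1: "\<phi> q t \<le> 1" if "good t" "q \<in> \<rat>" for q t
  proof -
    obtain n :: nat where "q \<le> real n" using real_arch_simple by blast
    then have "\<phi> q t \<le> \<phi> (real n) t" using that by (auto simp: good_def)
    also have "\<dots> \<le> (SUP n::nat. \<phi> (real n) t)" by (rule SUP_upper) simp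
    finally show ?thesis using that by (simp add: good_def)
  qed
  have inf_le1: "(INF q\<in>{q\<in>\<rat>. x < q}. \<phi> q t) \<le> 1" if "good t" for x t
  proof -
    obtain q where "q \<in> \<rat>" "x < q" using rat_gt[of x "x+1"] by auto
    then show ?thesis using le1[OF that, of q] by (auto intro: INF_lower2)
  qed
  have Feq: "ennreal (F t x) = (INF q\<in>{q\<in>\<rat>. x < q}. \<phi> q t)" if "good t" for t x
    using that inf_le1[OF that, of x] by (auto simp: F_def top_unique intro!: ennreal_enn2real) 
      (metis ennreal_one_less_top le_less_trans)
  have F0: "0 \<le> F t x" for t x by (auto simp: F_def)
  have F1: "F t x \<le> 1" for t x
  proof (cases "good t")
    case True
    then have "ennreal (F t x) \<le> ennreal 1" using Feq inf_le1 by simp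
    then show ?thesis by (simp add: ennreal_le_iff)
  qed (auto simp: F_def indicator_def)
  have Fmono: "F t x \<le> F t y" if "x \<le> y" for t x y
  proof (cases "good t")
    case True
    have "ennreal (F t x) \<le> ennreal (F t y)" unfolding Feq[OF True] by (rule INF_superset_mono) (use that in auto)
    then show ?thesis using F0 by (simp add: ennreal_le_iff)
  qed (use that in \<open>auto simp: F_def indicator_def\<close>)
  have Fcont: "continuous (at_right a) (F t)" for t a
  proof (cases "good t")
    case True
    show ?thesis unfolding continuous_within
    proof (rule order_tendstoI)
      fix e assume "e < F t a"
      then show "\<forall>\<^sub>F x in at_right a. e < F t x"
        using Fmono by (auto simp: eventually_at_filter intro!: always_eventually) (meson less_imp_le less_le_trans)
    next
      fix e assume e: "F t a < e"
      then have "(INF q\<in>{q\<in>\<rat>. a < q}. \<phi> q t) < ennreal e"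
        unfolding Feq[OF True, symmetric] using F0 by (simp add: ennreal_less_iff)
      then obtain q where q: "q \<in> \<rat>" "a < q" "\<phi> q t < ennreal e" by (auto simp: INF_less_iff)
      have "F t x < e" if "a < x" "x < q" for x
      proof -
        have "ennreal (F t x) \<le> \<phi> q t" unfolding Feq[OF True] by (rule INF_lower) (use q that in auto)
        also have "\<dots> < ennreal e" by fact
        finally show ?thesis using F0 by (simp add: ennreal_less_iff)
      qed
      then show "\<forall>\<^sub>F x in at_right a. F t x < e" using q(2) eventually_at_right_field by blast
    qed
  next
    case False
    have "\<forall>\<^sub>F x in at_right a. indicator {0..} x = (indicator {0..} a :: real)"
    proof (cases "a < 0")
      case True
      then have "\<forall>\<^sub>F x in at_right a. x < 0" by (auto simp: eventually_at_right_field intro!: exI[of _ 0])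
      then show ?thesis by eventually_elim (use True in auto)
    next
      case False
      have "\<forall>\<^sub>F x in at_right a. a < x" by (simp add: eventually_at_right_less)
      then show ?thesis by eventually_elim (use False in auto)
    qed
    then show ?thesis unfolding continuous_within using False by (auto simp: F_def intro: tendsto_eventually)
  qed
  have Ftop: "(F t \<longlongrightarrow> 1) at_top" for t
  proof (rule order_tendstoI)
    fix e :: real assume e: "e < 1"
    have "\<exists>a. e < F t a"
    proof (cases "good t")
      case True
      have "ennreal e < (SUP n::nat. \<phi> (real n) t)" using True e by (cases "0 \<le> e") (auto simp: good_def ennreal_neg)
      then obtain n :: nat where n: "ennreal e < \<phi> (real n) t" by (auto simp: less_SUP_iff)
      have "\<phi> (real n) t \<le> ennreal (F t (real n))" unfolding Feq[OF True]
        by (rule INF_greatest) (use True in \<open>auto simp: good_def\<close>)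
      with n have "ennreal e < ennreal (F t (real n))" by simp
      then have "e < F t (real n)" using F0[of t "real n"]
        by (cases "0 \<le> e") (auto simp: ennreal_less_iff)
      then show ?thesis by blast
    qed (use e in \<open>auto simp: F_def intro!: exI[of _ 0]\<close>)
    then obtain a where "e < F t a" by blast
    then show "\<forall>\<^sub>F x in at_top. e < F t x" unfolding eventually_at_top_linorder
      using Fmono by (meson less_le_trans)
  next
    fix e :: real assume "1 < e" then show "\<forall>\<^sub>F x in at_top. F t x < e"
      using F1 by (auto intro!: always_eventually) (meson le_less_trans)
  qed
  have Fbot: "(F t \<longlongrightarrow> 0) at_bot" for t
  proof (rule order_tendstoI)
    fix e :: real assume e: "0 < e"
    have "\<exists>a. F t a < e"
    proof (cases "good t")
      case True
      have "(INF n::nat. \<phi> (- real n) t) < ennreal e" using True e by (auto simp: good_def)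
      then obtain n :: nat where n: "\<phi> (- real n) t < ennreal e" by (auto simp: INF_less_iff)
      have "ennreal (F t (- real n - 1)) \<le> \<phi> (- real n) t" unfolding Feq[OF True]
        by (rule INF_lower) auto
      also note n
      finally have "F t (- real n - 1) < e" using F0 by (simp add: ennreal_less_iff)
      then show ?thesis by blast
    qed (use e in \<open>auto simp: F_def intro!: exI[of _ "-1"]\<close>)
    then obtain a where "F t a < e" by blast
    then show "\<forall>\<^sub>F x in at_bot. F t x < e" unfolding eventually_at_bot_linorder
      using Fmono by (meson le_less_trans)
  next
    fix e :: real assume "e < 0" then show "\<forall>\<^sub>F x in at_bot. e < F t x"
      using F0 by (auto intro!: always_eventually) (meson less_le_trans)
  qed
  define K where "K t = interval_measure (F t)" for t
  have K: "real_distribution (K t)" for t unfolding K_def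
    by (rule real_distribution_interval_measure) (use Fmono Fcont Fbot Ftop in auto)
  have K_Iic: "emeasure (K t) {..x} = ennreal (F t x)" for t x unfolding K_def
    by (rule emeasure_interval_measure_Iic) (use Fmono Fcont Fbot in auto)
  have Fm: "(\<lambda>t. F t x) \<in> borel_measurable \<mu>" for x
  proof -
    have "countable {q\<in>\<rat>. x < q}" by (rule countable_subset[OF _ c]) auto
    then have [measurable]: "(\<lambda>t. INF q\<in>{q\<in>\<rat>. x < q}. \<phi> q t) \<in> borel_measurable \<mu>" by measurable
    show ?thesis unfolding F_def by measurable
  qed
  show ?thesis
  proof
    show "K \<in> measurable \<mu> (prob_algebra borel)"
    proof (rule measurable_prob_algebra_generated[where \<Omega>=UNIV and G="range atMost"])
      show "sets borel = sigma_sets UNIV (range (atMost :: real \<Rightarrow> _))"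
        unfolding borel_eq_atMost by simp
      show "Int_stable (range (atMost :: real \<Rightarrow> _))"
        by (auto simp: Int_stable_def min_def intro!: image_eqI[where x="min _ _"])
      show "prob_space (K t)" "sets (K t) = sets borel" for t
        using K[of t] unfolding real_distribution_def real_distribution_axioms_def by auto
      show "A \<in> range atMost \<Longrightarrow> (\<lambda>t. emeasure (K t) A) \<in> borel_measurable \<mu>" for A
        using Fm by (auto simp: K_Iic)
    qed auto
    show "AE t in \<mu>. emeasure (K t) {..x} = (INF q\<in>{q\<in>\<rat>. x < q}. \<phi> q t)" for x
      using AE_good by eventually_elim (simp add: K_Iic Feq)
  qed
qed

text \<open>The conditional distribution functions are the Radon-Nikodym derivatives \<open>\<phi> x\<close> of
  \<open>A \<mapsto> m (A \<times> {..x})\<close> with respect to the marginal \<open>\<mu>\<close>. The kernel obtained from them has the right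
  integrals over the sets \<open>A \<times> {..x}\<close>, which generate the product \<open>\<sigma>\<close>-algebra and are stable under intersection.\<close>

theorem disintegration:
  fixes m :: "('t \<times> real) measure"
  assumes "prob_space m" and sm: "sets m = sets (T \<Otimes>\<^sub>M borel)"
  defines "\<mu> \<equiv> distr m T fst"
  obtains K where "K \<in> measurable T (prob_algebra borel)"
    "\<And>X. X \<in> sets m \<Longrightarrow> emeasure m X = (\<integral>\<^sup>+t. emeasure (K t) (Pair t -` X) \<partial>\<mu>)"
proof -
  interpret m: prob_space m by fact
  have [measurable]: "fst \<in> measurable m T" "snd \<in> measurable m borel"
    using measurable_fst[of T borel] measurable_snd[of T borel] measurable_cong_sets[OF sm refl] by auto
  have spm: "space m = space T \<times> UNIV" using sets_eq_imp_space_eq[OF sm] by (simp add: space_pair_measure)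
  interpret \<mu>: prob_space \<mu> unfolding \<mu>_def by (rule m.prob_space_distr) measurable
  have s\<mu>[measurable_cong, simp]: "sets \<mu> = sets T" by (simp add: \<mu>_def)
  have sp\<mu>: "space \<mu> = space T" by (simp add: \<mu>_def)
  have rect: "A \<times> B \<in> sets m" if "A \<in> sets T" "B \<in> sets borel" for A B using that by (simp add: sm)
  define mx where "mx x = distr (density m (indicator (UNIV \<times> {..x}))) T fst" for x :: real
  have smx[simp]: "sets (mx x) = sets T" for x by (simp add: mx_def)
  have meas_ind[measurable]: "(indicator (UNIV \<times> {..x}) :: _ \<Rightarrow> ennreal) \<in> borel_measurable m" for x :: real
  proof -
    have "(\<lambda>z. indicator {..x} (snd z) :: ennreal) \<in> borel_measurable m" by measurable
    also have "(\<lambda>z. indicator {..x} (snd z) :: ennreal) = indicator (UNIV \<times> {..x})" by (auto simp: indicator_def fun_eq_iff)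
    finally show ?thesis .
  qed
  have emx: "emeasure (mx x) A = emeasure m (A \<times> {..x})" if A[measurable]: "A \<in> sets T" for A x
  proof -
    have "emeasure (mx x) A = (\<integral>\<^sup>+z. indicator (UNIV \<times> {..x}) z * indicator (fst -` A \<inter> space m) z \<partial>m)"
      unfolding mx_def by (subst emeasure_distr) (auto simp: emeasure_density)
    also have "\<dots> = (\<integral>\<^sup>+z. indicator (A \<times> {..x}) z \<partial>m)"
      by (intro nn_integral_cong) (auto simp: indicator_def spm)
    finally show ?thesis using rect[OF A, of "{..x}"] by simp
  qed
  have e\<mu>: "emeasure \<mu> A = emeasure m (A \<times> UNIV)" if A[measurable]: "A \<in> sets T" for A
  proof -
    have "fst -` A \<inter> space m = A \<times> UNIV" using sets.sets_into_space[OF A] by (auto simp: spm)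
    then show ?thesis by (simp add: \<mu>_def emeasure_distr)
  qed
  have ac: "absolutely_continuous \<mu> (mx x)" for x
    unfolding absolutely_continuous_def
  proof safe
    fix A assume A: "A \<in> null_sets \<mu>"
    then have AT: "A \<in> sets T" by (auto simp: null_sets_def)
    have "emeasure m (A \<times> {..x}) \<le> emeasure m (A \<times> UNIV)" using rect[OF AT] by (intro emeasure_mono) auto
    also have "\<dots> = 0" using A AT by (simp add: e\<mu>[symmetric] null_sets_def)
    finally show "A \<in> null_sets (mx x)" using AT by (auto simp: null_sets_def emx)
  qed
  define \<phi> where "\<phi> x = RN_deriv \<mu> (mx x)" for x
  have \<phi>[measurable]: "\<phi> x \<in> borel_measurable T" for x
    using borel_measurable_RN_deriv[of \<mu> "mx x"] by (simp add: \<phi>_def measurable_cong_sets[OF s\<mu> refl])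
  have int\<phi>: "(\<integral>\<^sup>+t. \<phi> x t * indicator A t \<partial>\<mu>) = emeasure m (A \<times> {..x})" if A: "A \<in> sets T" for A x
  proof -
    have "emeasure (density \<mu> (\<phi> x)) A = (\<integral>\<^sup>+t. \<phi> x t * indicator A t \<partial>\<mu>)"
      using A by (intro emeasure_density) auto
    then show ?thesis unfolding \<phi>_def by (simp add: \<mu>.density_RN_deriv[OF ac] emx A)
  qed
  have mono: "AE t in \<mu>. \<phi> x t \<le> \<phi> y t" if "x \<le> y" for x y
  proof (rule \<mu>.AE_le_if_nn_integral_le)
    fix A assume "A \<in> sets \<mu>"
    then show "(\<integral>\<^sup>+t. \<phi> x t * indicator A t \<partial>\<mu>) \<le> (\<integral>\<^sup>+t. \<phi> y t * indicator A t \<partial>\<mu>)"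
      using that by (simp add: int\<phi>) (intro emeasure_mono, auto intro: rect)
  qed auto
  have top: "AE t in \<mu>. (SUP n::nat. \<phi> (real n) t) = 1"
  proof (rule \<mu>.density_unique_finite_measure)
    fix A assume "A \<in> sets \<mu>"
    then have A[measurable]: "A \<in> sets T" by simp
    have "(\<integral>\<^sup>+t. (SUP n::nat. \<phi> (real n) t) * indicator A t \<partial>\<mu>) = (\<integral>\<^sup>+t. (SUP n::nat. \<phi> (real n) t * indicator A t) \<partial>\<mu>)"
      by (simp add: SUP_mult_right_ennreal)
    also have "\<dots> = (SUP n::nat. \<integral>\<^sup>+t. \<phi> (real n) t * indicator A t \<partial>\<mu>)"
    proof (rule nn_integral_monotone_convergence_SUP_AE)
      fix n show "AE t in \<mu>. \<phi> (real n) t * indicator A t \<le> \<phi> (real (Suc n)) t * indicator A t"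
        using mono[of "real n" "real (Suc n)"] by (auto intro: mult_right_mono elim!: eventually_mono)
    qed auto
    also have "\<dots> = (SUP n::nat. emeasure m (A \<times> {..real n}))" by (simp add: int\<phi>)
    also have "\<dots> = emeasure m (\<Union>n::nat. A \<times> {..real n})"
      by (rule SUP_emeasure_incseq) (auto simp: incseq_def intro: rect)
    also have "(\<Union>n::nat. A \<times> {..real n}) = A \<times> UNIV" using real_arch_simple by auto
    finally show "(\<integral>\<^sup>+t. (SUP n::nat. \<phi> (real n) t) * indicator A t \<partial>\<mu>) = (\<integral>\<^sup>+t. 1 * indicator A t \<partial>\<mu>)"
      by (simp add: e\<mu>)
  qed auto
  have bot: "AE t in \<mu>. (INF n::nat. \<phi> (- real n) t) = 0"
  proof -
    have le: "(\<integral>\<^sup>+t. (INF n::nat. \<phi> (- real n) t) \<partial>\<mu>) \<le> emeasure m (space T \<times> {..- real n})" for n :: nat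
    proof -
      have "(\<integral>\<^sup>+t. (INF n::nat. \<phi> (- real n) t) \<partial>\<mu>) \<le> (\<integral>\<^sup>+t. \<phi> (- real n) t * indicator (space T) t \<partial>\<mu>)"
        by (intro nn_integral_mono) (auto simp: sp\<mu> intro!: INF_lower)
      then show ?thesis by (simp add: int\<phi>)
    qed
    have "(\<lambda>n. emeasure m (space T \<times> {..- real n})) \<longlonglongrightarrow> emeasure m (\<Inter>n. space T \<times> {..- real n})"
      by (rule Lim_emeasure_decseq) (auto simp: decseq_def intro: rect)
    moreover have "(\<Inter>n. space T \<times> {..- real n}) = {}"
    proof -
      have "\<exists>n::nat. \<not> b \<le> - real n" for b :: real
        using reals_Archimedean2[of "- b"] by (auto simp: not_le) (metis minus_less_iff)
      then show ?thesis by blast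
    qed
    ultimately have "(\<lambda>n. emeasure m (space T \<times> {..- real n})) \<longlonglongrightarrow> 0" by simp
    then have "(\<integral>\<^sup>+t. (INF n::nat. \<phi> (- real n) t) \<partial>\<mu>) \<le> 0"
      by (rule LIMSEQ_le_const) (use le in auto)
    then show ?thesis by (subst (asm) le_zero_eq, subst (asm) nn_integral_0_iff_AE) auto
  qed
  obtain K where K: "K \<in> measurable \<mu> (prob_algebra borel)"
    and K_Iic: "\<And>x. AE t in \<mu>. emeasure (K t) {..x} = (INF q\<in>{q\<in>\<rat>. x < q}. \<phi> q t)"
    by (rule kernel_of_distribution_functions[of \<phi> \<mu>]) (use mono top bot in auto)
  have KT: "K \<in> measurable T (prob_algebra borel)" using K by (simp add: measurable_cong_sets[OF s\<mu> refl])
  have sK: "sets (K t) = sets borel" "prob_space (K t)" if "t \<in> space T" for t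
    using measurable_space[OF KT that] by (auto simp: space_prob_algebra)
  note [measurable] = measurable_prob_algebraD[OF KT]
  have Iic: "(\<integral>\<^sup>+t. emeasure (K t) {..x} * indicator A t \<partial>\<mu>) = emeasure m (A \<times> {..x})" if A[measurable]: "A \<in> sets T" for A x
  proof -
    let ?I = "\<lambda>t. (INF q\<in>{q\<in>\<rat>. x < q}. \<phi> q t)"
    have cq: "countable {q\<in>\<rat>. x < q}" by (rule countable_subset[OF _ countable_rat]) auto
    have eq: "(\<integral>\<^sup>+t. emeasure (K t) {..x} * indicator A t \<partial>\<mu>) = (\<integral>\<^sup>+t. ?I t * indicator A t \<partial>\<mu>)"
      using K_Iic[of x] by (intro nn_integral_cong_AE) (auto elim!: eventually_mono)
    \<comment> \<open>lower bound: the derivative at \<open>x\<close> itself lies below all those at larger rationals\<close>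
    have "AE t in \<mu>. \<forall>q\<in>{q\<in>\<rat>. x < q}. \<phi> x t \<le> \<phi> q t"
      using cq mono by (subst AE_ball_countable) auto
    then have "(\<integral>\<^sup>+t. \<phi> x t * indicator A t \<partial>\<mu>) \<le> (\<integral>\<^sup>+t. ?I t * indicator A t \<partial>\<mu>)"
      by (intro nn_integral_mono_AE) (auto elim!: eventually_mono intro!: mult_right_mono INF_greatest)
    then have 1: "emeasure m (A \<times> {..x}) \<le> (\<integral>\<^sup>+t. ?I t * indicator A t \<partial>\<mu>)" by (simp add: int\<phi>)
    \<comment> \<open>upper bound: continuity of \<open>m\<close> from above along \<open>x + 1 / (n + 1)\<close>\<close>
    have up: "(\<integral>\<^sup>+t. ?I t * indicator A t \<partial>\<mu>) \<le> emeasure m (A \<times> {..x + 1 / real (Suc n)})" for n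
    proof -
      obtain q where q: "q \<in> \<rat>" "x < q" "q < x + 1 / real (Suc n)"
        using Rats_dense_in_real[of x "x + 1 / real (Suc n)"] by auto
      have "(\<integral>\<^sup>+t. ?I t * indicator A t \<partial>\<mu>) \<le> (\<integral>\<^sup>+t. \<phi> q t * indicator A t \<partial>\<mu>)"
        using q by (intro nn_integral_mono mult_right_mono INF_lower) auto
      also have "\<dots> = emeasure m (A \<times> {..q})" by (simp add: int\<phi>)
      also have "\<dots> \<le> emeasure m (A \<times> {..x + 1 / real (Suc n)})"
        using q by (intro emeasure_mono rect) auto
      finally show ?thesis .
    qed
    have "(\<lambda>n. emeasure m (A \<times> {..x + 1 / real (Suc n)})) \<longlonglongrightarrow> emeasure m (\<Inter>n. A \<times> {..x + 1 / real (Suc n)})"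
    proof (rule Lim_emeasure_decseq)
      show "decseq (\<lambda>n. A \<times> {..x + 1 / real (Suc n)})"
        unfolding decseq_def
      proof (intro allI impI subsetI)
        fix k n :: nat and z assume "k \<le> n" "z \<in> A \<times> {..x + 1 / real (Suc n)}"
        moreover have "1 / real (Suc n) \<le> 1 / real (Suc k)" using \<open>k \<le> n\<close> by (intro divide_left_mono) auto
        ultimately show "z \<in> A \<times> {..x + 1 / real (Suc k)}" by auto
      qed
    qed (auto intro: rect)
    moreover have "(\<Inter>n. A \<times> {..x + 1 / real (Suc n)}) = A \<times> {..x}"
    proof (intro equalityI subsetI)
      fix z assume z: "z \<in> (\<Inter>n. A \<times> {..x + 1 / real (Suc n)})"
      have "snd z \<le> x"
      proof (rule field_le_epsilon)
        fix e :: real assume "0 < e"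
        then obtain n where "1 / real (Suc n) < e" using nat_approx_posE by blast
        moreover have "snd z \<le> x + 1 / real (Suc n)" using z by auto
        ultimately show "snd z \<le> x + e" by simp
      qed
      then show "z \<in> A \<times> {..x}" using z by (cases z) auto
    qed (auto simp: add_increasing2)
    ultimately have "(\<integral>\<^sup>+t. ?I t * indicator A t \<partial>\<mu>) \<le> emeasure m (A \<times> {..x})"
      using up by (intro LIMSEQ_le_const[of "\<lambda>n. emeasure m (A \<times> {..x + 1 / real (Suc n)})"]) auto
    with 1 eq show ?thesis by simp
  qed
  define J where "J t = distr (K t) (T \<Otimes>\<^sub>M borel) (Pair t)" for t
  have Jm: "J \<in> measurable T (subprob_algebra (T \<Otimes>\<^sub>M borel))"
    unfolding J_def by (rule measurable_distr2[where M=borel]) measurable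
  have J\<mu>: "J \<in> measurable \<mu> (subprob_algebra (T \<Otimes>\<^sub>M borel))" using Jm by (simp add: measurable_cong_sets[OF s\<mu> refl])
  have ne: "space \<mu> \<noteq> {}" by (rule \<mu>.not_empty)
  have J: "emeasure (J t) X = emeasure (K t) (Pair t -` X)" if "t \<in> space T" "X \<in> sets (T \<Otimes>\<^sub>M borel)" for t X
  proof -
    have [measurable]: "Pair t \<in> measurable (K t) (T \<Otimes>\<^sub>M borel)"
      using that(1) by (subst measurable_cong_sets[OF sK(1)[OF that(1)] refl]) (rule measurable_Pair1')
    have "space (K t) = UNIV" using sets_eq_imp_space_eq[OF sK(1)[OF that(1)]] by simp
    then show ?thesis using that(2) by (simp add: J_def emeasure_distr)
  qed
  have eb: "emeasure (\<mu> \<bind> J) X = (\<integral>\<^sup>+t. emeasure (K t) (Pair t -` X) \<partial>\<mu>)" if X: "X \<in> sets (T \<Otimes>\<^sub>M borel)" for X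
    using emeasure_bind[OF ne J\<mu> X] J X by (auto intro!: nn_integral_cong simp: sp\<mu>)
  have sb: "sets (\<mu> \<bind> J) = sets (T \<Otimes>\<^sub>M borel)" by (rule sets_bind[OF _ ne]) (simp add: J_def)
  have "m = \<mu> \<bind> J"
  proof (rule measure_eqI_generator_eq[where E="{A \<times> {..x} | A x. A \<in> sets T}" and \<Omega>="space T \<times> UNIV" and A="\<lambda>n. space T \<times> {..real n}"])
    show "Int_stable {A \<times> {..x :: real} | A x. A \<in> sets T}"
    proof (rule Int_stableI)
      fix a b assume "a \<in> {A \<times> {..x :: real} | A x. A \<in> sets T}" "b \<in> {A \<times> {..x :: real} | A x. A \<in> sets T}"
      then obtain A x B y where *: "a = A \<times> {..x}" "b = B \<times> {..y}" "A \<in> sets T" "B \<in> sets T" by blast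
      then have "a \<inter> b = (A \<inter> B) \<times> {..min x y}" "A \<inter> B \<in> sets T" by auto
      then show "a \<inter> b \<in> {A \<times> {..x :: real} | A x. A \<in> sets T}" by blast
    qed
    show "{A \<times> {..x} | A x. A \<in> sets T} \<subseteq> Pow (space T \<times> UNIV)"
      using sets.sets_into_space by fastforce
    have gen: "sets (T \<Otimes>\<^sub>M borel) = sigma_sets (space T \<times> UNIV) {A \<times> {..x :: real} | A x. A \<in> sets T}"
    proof -
      have "sets (T \<Otimes>\<^sub>M (borel :: real measure)) = sets (sigma (space T \<times> space borel) {a \<times> b | a b. a \<in> sets T \<and> b \<in> range atMost})"
      proof (rule sets_pair_eq[where Ca="{space T}" and Cb="range (\<lambda>n::nat. {..real n})"])
        show "sets T \<subseteq> Pow (space T)" by (rule sets.space_closed)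
        show "sets T = sigma_sets (space T) (sets T)" by (rule sets.sigma_sets_eq[symmetric])
        show "sets borel = sigma_sets (space borel) (range (atMost :: real \<Rightarrow> _))" unfolding borel_eq_atMost by simp
        show "\<Union> (range (\<lambda>n::nat. {..real n})) = space borel" using real_arch_simple by auto
      qed auto
      also have "{a \<times> b | a b. a \<in> sets T \<and> b \<in> range (atMost :: real \<Rightarrow> _)} = {A \<times> {..x :: real} | A x. A \<in> sets T}" by auto
      finally show ?thesis
        using sets.sets_into_space by (subst (asm) sets_measure_of) fastforce+
    qed
    show "sets m = sigma_sets (space T \<times> UNIV) {A \<times> {..x} | A x. A \<in> sets T}" using gen sm by simp
    show "sets (\<mu> \<bind> J) = sigma_sets (space T \<times> UNIV) {A \<times> {..x} | A x. A \<in> sets T}" using gen sb by simp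
    show "range (\<lambda>n. space T \<times> {..real n}) \<subseteq> {A \<times> {..x} | A x. A \<in> sets T}" by auto
    show "(\<Union>n. space T \<times> {..real n}) = space T \<times> UNIV" using real_arch_simple by auto
    show "emeasure m (space T \<times> {..real n}) \<noteq> \<infinity>" for n by simp
    fix X assume "X \<in> {A \<times> {..x :: real} | A x. A \<in> sets T}"
    then obtain A x where X: "X = A \<times> {..x}" and A: "A \<in> sets T" by auto
    have "emeasure (\<mu> \<bind> J) X = (\<integral>\<^sup>+t. emeasure (K t) (Pair t -` X) \<partial>\<mu>)" using A X by (intro eb) auto
    also have "\<dots> = (\<integral>\<^sup>+t. emeasure (K t) {..x} * indicator A t \<partial>\<mu>)"
      by (intro nn_integral_cong) (auto simp: X indicator_def vimage_def atMost_def)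
    finally show "emeasure m X = emeasure (\<mu> \<bind> J) X" using Iic[OF A] X by simp
  qed
  then show ?thesis using KT eb sm that by metis
qed

section \<open>Atoms of a distribution on the line\<close>

text \<open>A strict order of the atoms by decreasing mass; ties are broken by position, so that it is total and
  the rank of an atom in it is well defined.\<close>

definition heavier :: "real measure \<Rightarrow> real \<Rightarrow> real \<Rightarrow> bool" where
  "heavier \<eta> y x \<longleftrightarrow> 0 < measure \<eta> {y} \<and>
     (measure \<eta> {x} < measure \<eta> {y} \<or> measure \<eta> {x} = measure \<eta> {y} \<and> y < x)"

definition atom_rank :: "real measure \<Rightarrow> real \<Rightarrow> nat" where
  "atom_rank \<eta> x = card {y. heavier \<eta> y x}"

definition atoms_of_rank :: "real measure \<Rightarrow> nat \<Rightarrow> real set" where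
  "atoms_of_rank \<eta> i = {x. 0 < measure \<eta> {x} \<and> atom_rank \<eta> x = i}"

definition nonatoms :: "real measure \<Rightarrow> real set" where
  "nonatoms \<eta> = {x. measure \<eta> {x} = 0}"

lemma heavier_trans: "heavier \<eta> x y \<Longrightarrow> heavier \<eta> y z \<Longrightarrow> heavier \<eta> x z"
  and heavier_irrefl: "\<not> heavier \<eta> x x"
  and heavier_total: "0 < measure \<eta> {x} \<Longrightarrow> 0 < measure \<eta> {y} \<Longrightarrow> x \<noteq> y \<Longrightarrow> heavier \<eta> x y \<or> heavier \<eta> y x"
  by (auto simp: heavier_def)

context real_distribution
begin

text \<open>The atoms of mass at least \<open>e\<close> are disjoint pieces of a space of total mass \<open>1\<close>, so there are at most \<open>1 / e\<close>.
  Hence each atom has only finitely many predecessors.\<close>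

lemma finite_heavy_atoms:
  assumes "0 < e" shows "finite {y. e \<le> measure M {y}}"
proof (rule finite_if_finite_subsets_card_bdd[THEN conjunct1])
  fix S assume S: "S \<subseteq> {y. e \<le> measure M {y}}" "finite S"
  have "e * card S = (\<Sum>y\<in>S. e)" by simp
  also have "\<dots> \<le> (\<Sum>y\<in>S. measure M {y})" using S by (intro sum_mono) auto
  also have "\<dots> = measure M (\<Union>y\<in>S. {y})"
    using S by (intro finite_measure_finite_Union[symmetric]) (auto simp: disjoint_family_on_def)
  also have "\<dots> \<le> 1" by (rule prob_le_1)
  finally have "card S \<le> 1 / e" using assms by (simp add: field_simps)
  then show "card S \<le> nat \<lfloor>1 / e\<rfloor>" by (simp add: le_nat_floor)
qed

lemma finite_heavier: "0 < measure M {x} \<Longrightarrow> finite {y. heavier M y x}"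
  by (rule finite_subset[OF _ finite_heavy_atoms[of "measure M {x}"]]) (auto simp: heavier_def)

lemma atom_rank_less:
  assumes "0 < measure M {y}" "heavier M x y" shows "atom_rank M x < atom_rank M y"
  using assms unfolding atom_rank_def
proof (intro psubset_card_mono finite_heavier psubsetI)
  show "{y. heavier M y x} \<subseteq> {z. heavier M z y}" using heavier_trans[OF _ assms(2)] by blast
  have "x \<in> {z. heavier M z y}" using assms(2) by simp
  moreover have "x \<notin> {y. heavier M y x}" by (simp add: heavier_irrefl)
  ultimately show "{y. heavier M y x} \<noteq> {z. heavier M z y}" by blast
qed

lemma atoms_of_rank_unique: "x \<in> atoms_of_rank M i \<Longrightarrow> y \<in> atoms_of_rank M i \<Longrightarrow> x = y"
proof (rule ccontr)
  assume *: "x \<in> atoms_of_rank M i" "y \<in> atoms_of_rank M i" "x \<noteq> y"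
  then have "heavier M x y \<or> heavier M y x" by (intro heavier_total) (simp_all add: atoms_of_rank_def)
  then have "atom_rank M x < atom_rank M y \<or> atom_rank M y < atom_rank M x"
    using * atom_rank_less unfolding atoms_of_rank_def mem_Collect_eq by blast
  then show False using * by (simp add: atoms_of_rank_def)
qed

lemma atoms_of_rank_cases: "atoms_of_rank M i = {} \<or> (\<exists>x. atoms_of_rank M i = {x})"
  using atoms_of_rank_unique by blast

lemma sets_atoms_of_rank[measurable, simp]: "atoms_of_rank M i \<in> sets borel"
  using atoms_of_rank_cases[of i] by auto

text \<open>The ranks form an initial segment of \<open>\<nat>\<close>: an atom of rank \<open>i + 1\<close> has an
  immediate predecessor, which has rank \<open>i\<close> and is at least as heavy.\<close>

lemma emeasure_atoms_of_rank_Suc_le: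
  "emeasure M (atoms_of_rank M (Suc i)) \<le> emeasure M (atoms_of_rank M i)"
proof (cases "atoms_of_rank M (Suc i) = {}")
  case False
  then obtain x where x: "atoms_of_rank M (Suc i) = {x}" using atoms_of_rank_cases by blast
  then have px: "0 < measure M {x}" and rx: "card {y. heavier M y x} = Suc i"
    by (auto simp: atoms_of_rank_def atom_rank_def)
  let ?S = "{y. heavier M y x}"
  have fS: "finite ?S" using px by (rule finite_heavier)
  \<comment> \<open>the immediate predecessor of \<open>x\<close>\<close>
  have "\<exists>z\<in>?S. \<forall>y\<in>?S. \<not> heavier M z y"
  proof -
    have "?S \<noteq> {}"
    proof
      assume "?S = {}" then have "card ?S = 0" by (simp only: card.empty)
      then show False using rx by linarith
    qed
    then obtain z where z: "z \<in> ?S" "\<And>y. y \<in> ?S \<Longrightarrow> atom_rank M y \<le> atom_rank M z"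
    proof -
      have "Max (atom_rank M ` ?S) \<in> atom_rank M ` ?S" using fS \<open>?S \<noteq> {}\<close> by (intro Max_in) auto
      then obtain z where "z \<in> ?S" "atom_rank M z = Max (atom_rank M ` ?S)" by force
      moreover have "atom_rank M y \<le> Max (atom_rank M ` ?S)" if "y \<in> ?S" for y
        using fS that by (intro Max_ge) auto
      ultimately show thesis using that by simp
    qed
    have "\<not> heavier M z y" if "y \<in> ?S" for y
    proof
      assume "heavier M z y"
      moreover have "0 < measure M {y}" using that by (simp add: heavier_def)
      ultimately have "atom_rank M z < atom_rank M y" by (intro atom_rank_less)
      then show False using z(2)[OF that] by simp
    qed
    then show ?thesis using z(1) by blast
  qed
  then obtain z where z: "heavier M z x" "\<And>y. heavier M y x \<Longrightarrow> \<not> heavier M z y" by auto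
  then have pz: "0 < measure M {z}" by (simp add: heavier_def)
  have "{y. heavier M y z} = ?S - {z}"
  proof (intro equalityI subsetI)
    fix y assume "y \<in> {y. heavier M y z}"
    then have "heavier M y z" by simp
    moreover from this have "heavier M y x" using z(1) by (rule heavier_trans)
    ultimately show "y \<in> ?S - {z}" by (auto simp: heavier_irrefl)
  next
    fix y assume y: "y \<in> ?S - {z}"
    then have "0 < measure M {y}" by (simp add: heavier_def)
    then have "heavier M y z \<or> heavier M z y" using y by (intro heavier_total[OF _ pz]) auto
    then show "y \<in> {y. heavier M y z}" using z(2)[of y] y by simp
  qed
  then have "z \<in> atoms_of_rank M i" using z(1) pz rx fS by (simp add: atoms_of_rank_def atom_rank_def)
  then have "emeasure M {z} \<le> emeasure M (atoms_of_rank M i)" by (intro emeasure_mono) auto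
  moreover have "measure M {x} \<le> measure M {z}" using z(1) by (auto simp: heavier_def)
  ultimately show ?thesis unfolding x by (simp add: emeasure_eq_measure)
qed simp

lemma sets_nonatoms[measurable, simp]: "nonatoms M \<in> sets borel"
proof -
  have "countable (- nonatoms M)"
    by (rule countable_subset[OF _ countable_support]) (auto simp: nonatoms_def)
  then have "- nonatoms M \<in> sets borel" by (rule sets.countable[rotated]) auto
  then have "- (- nonatoms M) \<in> sets borel" by (rule borel_comp)
  then show ?thesis by simp
qed

lemma emeasure_split_atoms:
  assumes X: "X \<in> sets borel"
  shows "emeasure M X = (\<Sum>i. emeasure M (X \<inter> atoms_of_rank M i)) + emeasure M (X \<inter> nonatoms M)"
proof -
  have "emeasure M X = emeasure M ((\<Union>i. X \<inter> atoms_of_rank M i) \<union> (X \<inter> nonatoms M))"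
    by (rule arg_cong[where f="emeasure M"]) (auto simp: atoms_of_rank_def nonatoms_def less_le)
  also have "\<dots> = emeasure M (\<Union>i. X \<inter> atoms_of_rank M i) + emeasure M (X \<inter> nonatoms M)"
  proof (intro plus_emeasure[symmetric])
    show "(\<Union>i. X \<inter> atoms_of_rank M i) \<in> events" "X \<inter> nonatoms M \<in> events"
      using X by auto
  qed (auto simp: atoms_of_rank_def nonatoms_def)
  also have "emeasure M (\<Union>i. X \<inter> atoms_of_rank M i) = (\<Sum>i. emeasure M (X \<inter> atoms_of_rank M i))"
  proof (intro suminf_emeasure[symmetric])
    show "range (\<lambda>i. X \<inter> atoms_of_rank M i) \<subseteq> events" using X by auto
  qed (auto simp: disjoint_family_on_def atoms_of_rank_def)
  finally show ?thesis .
qed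

text \<open>Integrating with the weight \<open>1 / measure M {y}\<close> turns counting and evaluation at atoms into integrals
  against \<open>M\<close>. For a measurable kernel such integrals depend measurably on the parameter, which
  is how measurability of the rank and of the position of the atoms is obtained below.\<close>

lemma nn_integral_atom:
  assumes "measure M {x} > 0"
  shows "(\<integral>\<^sup>+y. f y * ennreal (1 / measure M {y}) * indicator {x} y \<partial>M) = f x"
proof -
  have "(\<integral>\<^sup>+y. f y * ennreal (1 / measure M {y}) * indicator {x} y \<partial>M)
      = (\<integral>\<^sup>+y. (f x * ennreal (1 / measure M {x})) * indicator {x} y \<partial>M)"
    by (intro nn_integral_cong) (auto simp: indicator_def)
  also have "\<dots> = f x * ennreal (1 / measure M {x}) * emeasure M {x}" by (subst nn_integral_cmult_indicator) auto
  also have "\<dots> = f x" using assms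
    by (simp add: emeasure_eq_measure mult.assoc ennreal_mult[symmetric])
  finally show ?thesis .
qed

lemma atom_rank_eq_nn_integral:
  assumes x: "0 < measure M {x}"
  shows "of_nat (atom_rank M x) = (\<integral>\<^sup>+y. ennreal (1 / measure M {y}) * indicator {y. heavier M y x} y \<partial>M)"
proof -
  let ?S = "{y. heavier M y x}"
  have fS: "finite ?S" by (rule finite_heavier[OF x])
  have "(\<integral>\<^sup>+y. ennreal (1 / measure M {y}) * indicator ?S y \<partial>M)
     = (\<Sum>z\<in>?S. ennreal (1 / measure M {z}) * emeasure M {z})"
    using fS by (intro nn_integral_indicator_finite) auto
  also have "\<dots> = (\<Sum>z\<in>?S. 1)"
    by (intro sum.cong) (auto simp: emeasure_eq_measure ennreal_mult[symmetric] heavier_def)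
  finally show ?thesis by (simp add: atom_rank_def)
qed

text \<open>The atomless part of \<open>M\<close>, normalised to a probability measure, has a continuous distribution function \<open>C\<close>.
  Its quantile function \<open>q\<close> carries Lebesgue measure on the unit interval to this
  probability measure, and continuity makes \<open>C\<close> an exact left inverse of \<open>q\<close>.\<close>

lemma nonatomic_quantile:
  assumes pos: "0 < measure M (nonatoms M)"
  defines "C \<equiv> \<lambda>x. measure M ({..x} \<inter> nonatoms M) / measure M (nonatoms M)"
  defines "q \<equiv> \<lambda>u. Inf {x. u \<le> C x}"
  shows "\<And>u x. 0 < u \<Longrightarrow> u < 1 \<Longrightarrow> q u \<le> x \<longleftrightarrow> u \<le> C x"
    "\<And>u. 0 < u \<Longrightarrow> u < 1 \<Longrightarrow> C (q u) = u"
    "\<And>X. X \<in> sets borel \<Longrightarrow> measure M (nonatoms M) * emeasure lborel {u\<in>{0<..<1}. q u \<in> X} = emeasure M (X \<inter> nonatoms M)"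
proof -
  let ?N = "uniform_measure M (nonatoms M)"
  have e: "emeasure M (nonatoms M) = measure M (nonatoms M)" by (rule emeasure_eq_measure)
  interpret N: prob_space ?N
    by (rule prob_space_uniform_measure) (use pos in \<open>auto simp: e\<close>)
  interpret N: cdf_distribution ?N
    unfolding cdf_distribution_def by unfold_locales (simp add: M_is_borel)
  have mN: "measure ?N X = measure M (X \<inter> nonatoms M) / measure M (nonatoms M)" if "X \<in> sets borel" for X
    using that by (subst measure_uniform_measure) (use pos in \<open>auto simp: e Int_commute\<close>)
  have C: "C = cdf ?N" by (auto simp: C_def cdf_def mN)
  have 1: "q u \<le> x \<longleftrightarrow> u \<le> C x" if "0 < u" "u < 1" for u x
    unfolding q_def C by (rule N.pseudoinverse[OF that, symmetric])
  then show "\<And>u x. 0 < u \<Longrightarrow> u < 1 \<Longrightarrow> q u \<le> x \<longleftrightarrow> u \<le> C x" by blast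
  have cont: "isCont C x" for x
  proof -
    have "measure M ({x} \<inter> nonatoms M) = 0"
      by (cases "x \<in> nonatoms M") (auto simp: nonatoms_def)
    then show ?thesis unfolding C by (simp add: N.isCont_cdf mN)
  qed
  show "C (q u) = u" if u: "0 < u" "u < 1" for u
  proof (rule antisym)
    show "u \<le> C (q u)" using 1[OF u, of "q u"] by simp
    show "C (q u) \<le> u"
    proof (rule ccontr)
      assume "\<not> C (q u) \<le> u"
      then have lt: "u < C (q u)" by simp
      have "(C \<longlongrightarrow> C (q u)) (at_left (q u))" using cont[of "q u"] by (simp add: isCont_def filterlim_at_split)
      then have "\<forall>\<^sub>F x in at_left (q u). u < C x" using lt by (rule order_tendstoD)
      moreover have "\<forall>\<^sub>F x in at_left (q u). x < q u" by (simp add: eventually_at_filter)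
      ultimately have "\<forall>\<^sub>F x in at_left (q u). False"
      proof eventually_elim
        case (elim x) then show False using 1[OF u, of x] by linarith
      qed
      then show False by simp
    qed
  qed
  fix X :: "real set" assume X: "X \<in> sets borel"
  have "emeasure ?N X = emeasure (distr (restrict_space lborel {0<..<1::real}) borel q) X"
    using N.distr_I_eq_M unfolding q_def C by simp
  also have "\<dots> = emeasure lborel {u\<in>{0<..<1}. q u \<in> X}"
  proof -
    have qm: "q \<in> borel_measurable (restrict_space lborel {0<..<1})"
      using N.measurable_CI unfolding q_def C by (simp cong: measurable_cong_sets)
    then have "emeasure (distr (restrict_space lborel {0<..<1::real}) borel q) X =
        emeasure (restrict_space lborel {0<..<1}) (q -` X \<inter> {0<..<1})"
      using X by (subst emeasure_distr) (auto simp: space_restrict_space)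
    also have "\<dots> = emeasure lborel (q -` X \<inter> {0<..<1})" by (subst emeasure_restrict_space) auto
    also have "q -` X \<inter> {0<..<1} = {u\<in>{0<..<1}. q u \<in> X}" by auto
    finally show ?thesis .
  qed
  finally have *: "emeasure lborel {u\<in>{0<..<1}. q u \<in> X} = emeasure ?N X" ..
  have "emeasure ?N X = ennreal (measure M (X \<inter> nonatoms M) / measure M (nonatoms M))"
    by (simp add: N.emeasure_eq_measure mN[OF X])
  then show "measure M (nonatoms M) * emeasure lborel {u\<in>{0<..<1}. q u \<in> X} = emeasure M (X \<inter> nonatoms M)"
    unfolding * using pos by (simp add: emeasure_eq_measure ennreal_mult[symmetric])
qed

end

section \<open>Atoms and quantiles of a kernel\<close>

context
  fixes T :: "'t measure" and K :: "'t \<Rightarrow> real measure"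
  assumes K: "K \<in> measurable T (prob_algebra borel)"
begin

lemma kernel_real_distribution: "t \<in> space T \<Longrightarrow> real_distribution (K t)"
  using measurable_space[OF K] unfolding real_distribution_def real_distribution_axioms_def
  by (auto simp: space_prob_algebra)

lemma K_subprob[measurable]: "K \<in> measurable T (subprob_algebra borel)"
  by (rule measurable_prob_algebraD[OF K])

lemma measurable_point_mass[measurable]:
  "(\<lambda>z. measure (K (fst z)) {snd z}) \<in> borel_measurable (T \<Otimes>\<^sub>M borel)"
proof (rule measure_measurable_subprob_algebra2)
  have "{z \<in> space ((T \<Otimes>\<^sub>M borel) \<Otimes>\<^sub>M borel). snd z = snd (fst z)} \<in> sets ((T \<Otimes>\<^sub>M borel) \<Otimes>\<^sub>M (borel :: real measure))"
    by measurable
  also have "{z \<in> space ((T \<Otimes>\<^sub>M borel) \<Otimes>\<^sub>M borel). snd z = snd (fst z)} = (SIGMA z:space (T \<Otimes>\<^sub>M borel). {snd z :: real})"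
    by (auto simp: space_pair_measure)
  finally show "(SIGMA z:space (T \<Otimes>\<^sub>M borel). {snd z :: real}) \<in> sets ((T \<Otimes>\<^sub>M borel) \<Otimes>\<^sub>M borel)" .
  show "(\<lambda>z. K (fst z)) \<in> measurable (T \<Otimes>\<^sub>M borel) (subprob_algebra borel)" by measurable
qed

lemma measurable_point_mass2[measurable (raw)]:
  assumes [measurable]: "f \<in> measurable N T" "g \<in> measurable N borel"
  shows "(\<lambda>z. measure (K (f z)) {g z}) \<in> borel_measurable N"
  using measurable_compose[OF measurable_Pair[OF assms] measurable_point_mass] by simp

lemma measurable_atom_rank:
  "{z \<in> space (T \<Otimes>\<^sub>M borel). snd z \<in> atoms_of_rank (K (fst z)) i} \<in> sets (T \<Otimes>\<^sub>M borel)"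
proof -
  let ?r = "\<lambda>z. \<integral>\<^sup>+y. ennreal (1 / measure (K (fst z)) {y}) * indicator {y. heavier (K (fst z)) y (snd z)} y \<partial>K (fst z)"
  have [measurable]: "?r \<in> borel_measurable (T \<Otimes>\<^sub>M borel)"
    unfolding heavier_def
    by (rule nn_integral_measurable_subprob_algebra2[where N=borel]) measurable
  have "{z \<in> space (T \<Otimes>\<^sub>M borel). snd z \<in> atoms_of_rank (K (fst z)) i}
    = {z \<in> space (T \<Otimes>\<^sub>M borel). 0 < measure (K (fst z)) {snd z} \<and> ?r z = of_nat i}"
  proof (intro Collect_cong conj_cong refl)
    fix z assume "z \<in> space (T \<Otimes>\<^sub>M (borel :: real measure))"
    then have "fst z \<in> space T" by (auto simp: space_pair_measure)
    then interpret real_distribution "K (fst z)" by (rule kernel_real_distribution)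
    show "snd z \<in> atoms_of_rank (K (fst z)) i \<longleftrightarrow> 0 < measure (K (fst z)) {snd z} \<and> ?r z = of_nat i"
      by (cases "0 < measure (K (fst z)) {snd z}")
        (simp_all add: atoms_of_rank_def atom_rank_eq_nn_integral[symmetric])
  qed
  also have "\<dots> \<in> sets (T \<Otimes>\<^sub>M borel)" by measurable
  finally show ?thesis .
qed

lemma measurable_nonatoms:
  "{z \<in> space (T \<Otimes>\<^sub>M borel). snd z \<in> nonatoms (K (fst z))} \<in> sets (T \<Otimes>\<^sub>M borel)"
  unfolding nonatoms_def mem_Collect_eq by measurable

lemma Sigma_Collect: "(SIGMA t:space T. {y. Q t y}) = {z \<in> space (T \<Otimes>\<^sub>M (borel :: real measure)). Q (fst z) (snd z)}"
  by (auto simp: space_pair_measure)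

lemma measurable_atom_weight[measurable]:
  "(\<lambda>t. emeasure (K t) (atoms_of_rank (K t) i)) \<in> borel_measurable T"
  using measurable_atom_rank[of i] Sigma_Collect[of "\<lambda>t y. y \<in> atoms_of_rank (K t) i"]
  by (intro emeasure_measurable_subprob_algebra2[OF _ K_subprob]) simp

lemma measurable_nonatomic_mass[measurable]:
  "(\<lambda>t. measure (K t) (nonatoms (K t))) \<in> borel_measurable T"
  using measurable_nonatoms Sigma_Collect[of "\<lambda>t y. y \<in> nonatoms (K t)"]
  by (intro measure_measurable_subprob_algebra2[OF _ K_subprob]) simp

lemma measurable_nonatomic_cdf[measurable]:
  "(\<lambda>z. measure (K (fst z)) ({..snd z} \<inter> nonatoms (K (fst z)))) \<in> borel_measurable (T \<Otimes>\<^sub>M borel)"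
proof (rule measure_measurable_subprob_algebra2)
  have "(SIGMA z:space (T \<Otimes>\<^sub>M borel). {..snd z} \<inter> nonatoms (K (fst z)))
     = {z \<in> space ((T \<Otimes>\<^sub>M borel) \<Otimes>\<^sub>M borel). snd z \<le> snd (fst z) \<and> measure (K (fst (fst z))) {snd z} = 0}"
    by (auto simp: space_pair_measure nonatoms_def)
  also have "\<dots> \<in> sets ((T \<Otimes>\<^sub>M borel) \<Otimes>\<^sub>M (borel :: real measure))" by measurable
  finally show "(SIGMA z:space (T \<Otimes>\<^sub>M borel). {..snd z} \<inter> nonatoms (K (fst z))) \<in> sets ((T \<Otimes>\<^sub>M borel) \<Otimes>\<^sub>M borel)" .
  show "(\<lambda>z. K (fst z)) \<in> measurable (T \<Otimes>\<^sub>M (borel :: real measure)) (subprob_algebra borel)" by measurable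
qed

text \<open>The single atom \<open>x\<close> of rank \<open>i\<close>, if there is one. The nonnegative integral yields \<open>exp x\<close>, and the
  logarithm recovers \<open>x\<close> whatever its sign.\<close>

definition atom_position :: "nat \<Rightarrow> 't \<Rightarrow> real" where
  "atom_position i t = ln (enn2real (\<integral>\<^sup>+y. ennreal (exp y) * ennreal (1 / measure (K t) {y})
      * indicator (atoms_of_rank (K t) i) y \<partial>K t))"

lemma measurable_atom_position[measurable]: "atom_position i \<in> borel_measurable T"
proof -
  have [measurable]: "{z \<in> space (T \<Otimes>\<^sub>M borel). snd z \<in> atoms_of_rank (K (fst z)) i} \<in> sets (T \<Otimes>\<^sub>M borel)"
    by (rule measurable_atom_rank)
  have "(\<lambda>z. ennreal (exp (snd z)) * ennreal (1 / measure (K (fst z)) {snd z})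
      * indicator {z \<in> space (T \<Otimes>\<^sub>M borel). snd z \<in> atoms_of_rank (K (fst z)) i} z) \<in> borel_measurable (T \<Otimes>\<^sub>M borel)"
    by measurable
  then have "(\<lambda>(t, y). ennreal (exp y) * ennreal (1 / measure (K t) {y})
      * indicator (atoms_of_rank (K t) i) y) \<in> borel_measurable (T \<Otimes>\<^sub>M borel)"
    by (rule measurable_cong[THEN iffD1, rotated]) (auto simp: indicator_def)
  then have "(\<lambda>t. \<integral>\<^sup>+y. ennreal (exp y) * ennreal (1 / measure (K t) {y})
      * indicator (atoms_of_rank (K t) i) y \<partial>K t) \<in> borel_measurable T"
    by (rule nn_integral_measurable_subprob_algebra2[OF _ K_subprob])
  then show ?thesis unfolding atom_position_def by measurable
qed

lemma atom_position_eq: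
  assumes t: "t \<in> space T" and x: "x \<in> atoms_of_rank (K t) i" shows "atom_position i t = x"
proof -
  interpret real_distribution "K t" by (rule kernel_real_distribution[OF t])
  have "atoms_of_rank (K t) i = {x}" using atoms_of_rank_unique x by blast
  moreover have "0 < measure (K t) {x}" using x by (simp add: atoms_of_rank_def)
  ultimately show ?thesis unfolding atom_position_def by (simp only: nn_integral_atom) simp
qed

definition nonatomic_cdf :: "'t \<Rightarrow> real \<Rightarrow> real" where
  "nonatomic_cdf t x = measure (K t) ({..x} \<inter> nonatoms (K t)) / measure (K t) (nonatoms (K t))"

text \<open>The value \<open>0\<close> is a dummy, taken only where the atomless part vanishes and at the
  end points or outside of the unit interval.\<close>

definition nonatomic_quantile :: "'t \<Rightarrow> real \<Rightarrow> real" where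
  "nonatomic_quantile t u =
    (if 0 < measure (K t) (nonatoms (K t)) \<and> 0 < u \<and> u < 1 then Inf {x. u \<le> nonatomic_cdf t x} else 0)"

lemma measurable_nonatomic_cdf2[measurable]:
  "(\<lambda>z. nonatomic_cdf (fst z) (snd z)) \<in> borel_measurable (T \<Otimes>\<^sub>M borel)"
  unfolding nonatomic_cdf_def by measurable

lemma nonatomic_cdf_bounds:
  assumes "t \<in> space T" shows "0 \<le> nonatomic_cdf t x" "nonatomic_cdf t x \<le> 1"
proof -
  interpret real_distribution "K t" by (rule kernel_real_distribution[OF assms])
  have "measure (K t) ({..x} \<inter> nonatoms (K t)) \<le> measure (K t) (nonatoms (K t))"
    by (intro finite_measure_mono) auto
  then show "0 \<le> nonatomic_cdf t x" "nonatomic_cdf t x \<le> 1"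
    by (auto simp: nonatomic_cdf_def divide_le_eq_1 less_le)
qed

lemma nonatomic_quantile_le_iff:
  assumes "t \<in> space T" "0 < measure (K t) (nonatoms (K t))" "0 < u" "u < 1"
  shows "nonatomic_quantile t u \<le> x \<longleftrightarrow> u \<le> nonatomic_cdf t x"
    "nonatomic_cdf t (nonatomic_quantile t u) = u"
proof -
  interpret real_distribution "K t" by (rule kernel_real_distribution[OF assms(1)])
  show "nonatomic_quantile t u \<le> x \<longleftrightarrow> u \<le> nonatomic_cdf t x"
    using nonatomic_quantile(1)[OF assms(2-)] assms(2-) unfolding nonatomic_quantile_def nonatomic_cdf_def by simp
  show "nonatomic_cdf t (nonatomic_quantile t u) = u"
    using nonatomic_quantile(2)[OF assms(2-)] assms(2-) unfolding nonatomic_quantile_def nonatomic_cdf_def by simp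
qed

text \<open>A quantile lies below \<open>x\<close> exactly if its level lies below the distribution function at \<open>x\<close>, and
  that function is measurable in the parameter.\<close>

lemma measurable_nonatomic_quantile[measurable]:
  "(\<lambda>z. nonatomic_quantile (fst z) (snd z)) \<in> borel_measurable (T \<Otimes>\<^sub>M borel)"
proof (rule borel_measurableI_le)
  fix x :: real
  let ?P = "\<lambda>z. 0 < measure (K (fst z)) (nonatoms (K (fst z))) \<and> 0 < snd z \<and> snd z < (1::real)"
  have "{z\<in>space (T \<Otimes>\<^sub>M borel). nonatomic_quantile (fst z) (snd z) \<le> x}
    = {z\<in>space (T \<Otimes>\<^sub>M borel). (?P z \<longrightarrow> snd z \<le> nonatomic_cdf (fst z) x) \<and> (\<not> ?P z \<longrightarrow> 0 \<le> x)}"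
  proof (intro Collect_cong conj_cong refl)
    fix z assume "z \<in> space (T \<Otimes>\<^sub>M (borel :: real measure))"
    then have "fst z \<in> space T" by (auto simp: space_pair_measure)
    then show "nonatomic_quantile (fst z) (snd z) \<le> x \<longleftrightarrow>
       (?P z \<longrightarrow> snd z \<le> nonatomic_cdf (fst z) x) \<and> (\<not> ?P z \<longrightarrow> 0 \<le> x)"
      using nonatomic_quantile_le_iff(1)[of "fst z" "snd z" x]
      by (cases "?P z") (auto simp: nonatomic_quantile_def)
  qed
  also have "\<dots> \<in> sets (T \<Otimes>\<^sub>M borel)"
  proof -
    have [measurable]: "(\<lambda>z. nonatomic_cdf (fst z) x) \<in> borel_measurable (T \<Otimes>\<^sub>M (borel :: real measure))"
    proof -
      have "(\<lambda>z. (fst z, x)) \<in> measurable (T \<Otimes>\<^sub>M (borel :: real measure)) (T \<Otimes>\<^sub>M borel)" by measurable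
      from measurable_compose[OF this measurable_nonatomic_cdf2] show ?thesis by simp
    qed
    show ?thesis by measurable
  qed
  finally show "{z\<in>space (T \<Otimes>\<^sub>M borel). nonatomic_quantile (fst z) (snd z) \<le> x} \<in> sets (T \<Otimes>\<^sub>M borel)" .
qed

lemma nonatomic_quantile_distr:
  assumes t: "t \<in> space T" and X: "X \<in> sets borel"
  shows "emeasure (K t) (nonatoms (K t)) * emeasure lborel {u\<in>{0..1}. nonatomic_quantile t u \<in> X}
    = emeasure (K t) (X \<inter> nonatoms (K t))"
proof -
  interpret real_distribution "K t" by (rule kernel_real_distribution[OF t])
  show ?thesis
  proof (cases "0 < measure (K t) (nonatoms (K t))")
    case True
    let ?q = "\<lambda>u. Inf {x. u \<le> measure (K t) ({..x} \<inter> nonatoms (K t)) / measure (K t) (nonatoms (K t))}"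
    have [measurable]: "nonatomic_quantile t \<in> borel_measurable borel"
      using measurable_compose[OF measurable_Pair1'[OF t] measurable_nonatomic_quantile] by simp
    have "{u\<in>{0<..<1}. ?q u \<in> X} = {u\<in>{0<..<1}. nonatomic_quantile t u \<in> X}"
      using True by (auto simp: nonatomic_quantile_def nonatomic_cdf_def)
    moreover have "emeasure lborel {u\<in>{0..1}. nonatomic_quantile t u \<in> X}
        = emeasure lborel {u\<in>{0<..<1}. nonatomic_quantile t u \<in> X}"
    proof (rule emeasure_eq_AE)
      show "AE u in lborel. u \<in> {u\<in>{0..1}. nonatomic_quantile t u \<in> X} \<longleftrightarrow>
          u \<in> {u\<in>{0<..<1}. nonatomic_quantile t u \<in> X}"
        using AE_lborel_singleton[of 0] AE_lborel_singleton[of 1] by eventually_elim auto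
    qed (use X in measurable)
    ultimately have "emeasure lborel {u\<in>{0..1}. nonatomic_quantile t u \<in> X} = emeasure lborel {u\<in>{0<..<1}. ?q u \<in> X}"
      by simp
    then show ?thesis using nonatomic_quantile(3)[OF True X] by (simp add: emeasure_eq_measure)
  next
    case False
    then have "measure (K t) (nonatoms (K t)) = 0" using measure_nonneg[of "K t" "nonatoms (K t)"] by linarith
    then have 0: "emeasure (K t) (nonatoms (K t)) = 0" by (simp add: emeasure_eq_measure)
    have "emeasure (K t) (X \<inter> nonatoms (K t)) \<le> emeasure (K t) (nonatoms (K t))"
      by (intro emeasure_mono) auto
    with 0 show ?thesis by simp
  qed
qed

end

section \<open>The space of the model\<close>

abbreviation unit_interval :: "real measure" where
  "unit_interval \<equiv> restrict_space lborel {0..1}"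

lemma prob_space_unit_interval: "prob_space unit_interval"
  by (rule prob_spaceI) (simp add: space_restrict_space emeasure_restrict_space)

text \<open>The Borel measure with completion \<open>L_space\<close>; measurability is checked here, on the copies and the strip separately.\<close>

definition L_base :: "family \<Rightarrow> point measure" where
  "L_base F = measure_of L_set L_sets
     (\<lambda>X. (\<Sum>j. emeasure (fst F j) {t. Copy j t \<in> X})
          + emeasure (snd F \<Otimes>\<^sub>M unit_interval) {(t, x). Strip t x \<in> X})"

lemma L_space_completion: "L_space F = completion (L_base F)"
  by (cases F) (simp add: L_base_def)

lemma sets_L_base[simp]: "sets (L_base F) = L_sets"
  unfolding L_base_def using sigma_algebra.sigma_sets_eq[OF sigma_algebra_L_sets]
  by (subst sets_measure_of) (auto simp: L_sets_def)

lemma space_L_base[simp]: "space (L_base F) = L_set"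
  unfolding L_base_def by (rule space_measure_of) (auto simp: L_sets_def)

lemma emeasure_L_base:
  assumes "\<And>j. sets (\<nu> j) = sets pos_reals" "sets \<kappa> = sets pos_reals" "X \<in> L_sets"
  shows "emeasure (L_base (\<nu>, \<kappa>)) X = (\<Sum>j. emeasure (\<nu> j) {t. Copy j t \<in> X})
          + emeasure (\<kappa> \<Otimes>\<^sub>M unit_interval) {(t, x). Strip t x \<in> X}"
  using emeasure_L_space[OF assms] assms(3) by (simp add: L_space_completion)

lemma measurable_from_L_base:
  assumes copy: "\<And>j. (\<lambda>t. f (Copy j t)) \<in> measurable pos_reals S"
    and strip: "(\<lambda>z. f (Strip (fst z) (snd z))) \<in> measurable (pos_reals \<Otimes>\<^sub>M unit_interval) S"
  shows "f \<in> measurable (L_base F) S"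
proof (rule measurableI)
  fix z assume "z \<in> space (L_base F)"
  then show "f z \<in> space S"
    using measurable_space[OF copy] measurable_space[OF strip, of "(t, x)" for t x]
    by (cases z) (auto simp: L_set_def space_restrict_space space_pair_measure)
next
  fix A assume A: "A \<in> sets S"
  have "{t. Copy j t \<in> f -` A \<inter> L_set} = (\<lambda>t. f (Copy j t)) -` A \<inter> space pos_reals" for j
    by (auto simp: L_set_def space_restrict_space)
  moreover have "{(t, x). Strip t x \<in> f -` A \<inter> L_set}
     = (\<lambda>z. f (Strip (fst z) (snd z))) -` A \<inter> space (pos_reals \<Otimes>\<^sub>M unit_interval)"
    by (auto simp: L_set_def space_restrict_space space_pair_measure)
  ultimately have "f -` A \<inter> L_set \<in> L_sets" unfolding L_sets_def mem_Collect_eq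
    using measurable_sets[OF copy A] measurable_sets[OF strip A] by simp
  then show "f -` A \<inter> space (L_base F) \<in> sets (L_base F)" by simp
qed

lemma AE_L_base:
  assumes s: "\<And>j. sets (\<nu> j) = sets pos_reals" "sets \<kappa> = sets pos_reals"
    and copy: "\<And>j. AE t in \<nu> j. Q (Copy j t)"
    and strip: "AE z in \<kappa> \<Otimes>\<^sub>M unit_interval. Q (Strip (fst z) (snd z))"
  shows "AE z in L_base (\<nu>, \<kappa>). Q z"
proof -
  have sp: "space (\<nu> j) = {0<..}" "space \<kappa> = {0<..}" for j
    using sets_eq_imp_space_eq[OF s(1), of j] sets_eq_imp_space_eq[OF s(2)] by (auto simp: space_restrict_space)
  have "\<forall>j. \<exists>N\<in>null_sets (\<nu> j). {t\<in>space (\<nu> j). \<not> Q (Copy j t)} \<subseteq> N"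
    using copy by (auto simp: eventually_ae_filter)
  then obtain N where N: "\<And>j. N j \<in> null_sets (\<nu> j)" "\<And>j. {t\<in>space (\<nu> j). \<not> Q (Copy j t)} \<subseteq> N j" by metis
  obtain N' where N': "N' \<in> null_sets (\<kappa> \<Otimes>\<^sub>M unit_interval)"
    "{z\<in>space (\<kappa> \<Otimes>\<^sub>M unit_interval). \<not> Q (Strip (fst z) (snd z))} \<subseteq> N'"
    using strip by (auto simp: eventually_ae_filter)
  have Nsub: "N j \<subseteq> {0<..}" for j using N(1)[of j] sets.sets_into_space[of "N j" "\<nu> j"] sp by (auto simp: null_sets_def)
  have N'sub: "N' \<subseteq> {0<..} \<times> {0..1}"
    using N'(1) sets.sets_into_space[of N' "\<kappa> \<Otimes>\<^sub>M unit_interval"] sp by (auto simp: null_sets_def space_pair_measure space_restrict_space)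
  have sN': "N' \<in> sets (pos_reals \<Otimes>\<^sub>M unit_interval)"
    using N'(1) sets_pair_measure_cong[OF s(2) refl, of unit_interval] by (auto simp: null_sets_def)
  define Z where "Z = {z. case z of Copy j t \<Rightarrow> t \<in> N j | Strip t x \<Rightarrow> (t, x) \<in> N'}"
  have 1: "{t. Copy j t \<in> Z} = N j" for j by (auto simp: Z_def)
  have 2: "{(t, x). Strip t x \<in> Z} = N'" by (auto simp: Z_def)
  have "z \<in> L_set" if "z \<in> Z" for z
    using that Nsub N'sub by (cases z) (auto simp: Z_def L_set_def subset_iff)
  then have ZL: "Z \<in> L_sets" unfolding L_sets_def mem_Collect_eq 1 2 using N(1) sN' s(1) by (auto simp: null_sets_def)
  have "emeasure (L_base (\<nu>, \<kappa>)) Z = 0"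
    unfolding emeasure_L_base[OF s ZL] 1 2 using N(1) N'(1) by (simp add: null_sets_def)
  then have "Z \<in> null_sets (L_base (\<nu>, \<kappa>))" using ZL by (simp add: null_sets_def)
  moreover have "{z\<in>space (L_base (\<nu>, \<kappa>)). \<not> Q z} \<subseteq> Z"
  proof
    fix z assume "z \<in> {z\<in>space (L_base (\<nu>, \<kappa>)). \<not> Q z}"
    then show "z \<in> Z" using N(2) N'(2) sp
      by (cases z) (auto simp: L_set_def Z_def space_pair_measure space_restrict_space)
  qed
  ultimately show ?thesis unfolding eventually_ae_filter by blast
qed

lemma measurable_coord_base: "coord \<in> measurable (L_base F) pos_reals"
  by (rule measurable_from_L_base) auto

text \<open>Each fibre of the strip has mass \<open>1\<close>, so the strip contributes \<open>\<nu>\<^sub>\<infinity>\<close> itself to the distribution of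
  the coordinate.\<close>

lemma distr_L_base_coord:
  assumes s: "\<And>j. sets (\<nu> j) = sets pos_reals" "sets \<kappa> = sets pos_reals"
  shows "distr (L_base (\<nu>, \<kappa>)) pos_reals coord = total_measure (\<nu>, \<kappa>)"
proof (rule measure_eqI)
  have e: "sets (measure_of {0<..} (sets pos_reals) \<mu>) = sets pos_reals" for \<mu>
    using sets.sigma_sets_eq[of pos_reals] sets.sets_into_space[of _ pos_reals]
    by (subst sets_measure_of) auto
  show "sets (distr (L_base (\<nu>, \<kappa>)) pos_reals coord) = sets (total_measure (\<nu>, \<kappa>))" by (simp add: e)
  fix X assume "X \<in> sets (distr (L_base (\<nu>, \<kappa>)) pos_reals coord)"
  then have X: "X \<in> sets pos_reals" by simp
  have Xp: "X \<subseteq> {0<..}" using sets.sets_into_space[OF X] by (simp add: space_restrict_space)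
  have 1: "{t. Copy j t \<in> coord -` X \<inter> L_set} = X" for j using Xp by (auto simp: L_set_def)
  have 2: "{(t, x). Strip t x \<in> coord -` X \<inter> L_set} = X \<times> {0..1}" using Xp by (auto simp: L_set_def)
  have sm: "coord -` X \<inter> L_set \<in> L_sets" using measurable_sets[OF measurable_coord_base X] by simp
  interpret prob_space unit_interval by (rule prob_space_unit_interval)
  have "emeasure (\<kappa> \<Otimes>\<^sub>M unit_interval) (X \<times> {0..1}) = emeasure \<kappa> X * emeasure unit_interval {0..1}"
    using X s(2) by (intro emeasure_pair_measure_Times) (auto simp: sets_restrict_space)
  also have "emeasure unit_interval {0..1} = 1" using emeasure_space_1 by (simp add: space_restrict_space)
  finally have "emeasure (\<kappa> \<Otimes>\<^sub>M unit_interval) (X \<times> {0..1}) = emeasure \<kappa> X" by simp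
  then show "emeasure (distr (L_base (\<nu>, \<kappa>)) pos_reals coord) X = emeasure (total_measure (\<nu>, \<kappa>)) X"
    using emeasure_L_base[of \<nu> \<kappa>, OF s sm] emeasure_total_measure[of \<nu> \<kappa>, OF s X]
    unfolding 1 2 emeasure_distr[OF measurable_coord_base X] space_L_base by metis
qed

section \<open>A positive function is a coordinate\<close>

text \<open>Throughout, \<open>m\<close> is a measure on pairs \<open>(t, x)\<close> that is disintegrated into the measure \<open>\<mu>\<close> for \<open>t\<close>
  and the conditional distributions \<open>K t\<close> for \<open>x\<close>. The densities of the two kinds of marginals are the masses of the
  atoms of given rank and of the atomless part of \<open>K t\<close>.\<close>

context
  fixes m :: "(real \<times> real) measure" and K :: "real \<Rightarrow> real measure" and \<mu> :: "real measure"
  assumes sm: "sets m = sets (pos_reals \<Otimes>\<^sub>M borel)"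
    and K: "K \<in> measurable pos_reals (prob_algebra borel)" and s\<mu>: "sets \<mu> = sets pos_reals"
    and mK: "\<And>X. X \<in> sets m \<Longrightarrow> emeasure m X = (\<integral>\<^sup>+t. emeasure (K t) (Pair t -` X) \<partial>\<mu>)"
begin

definition rank_marginal :: "nat \<Rightarrow> real measure" where
  "rank_marginal i = density \<mu> (\<lambda>t. emeasure (K t) (atoms_of_rank (K t) i))"

definition nonatomic_marginal :: "real measure" where
  "nonatomic_marginal = density \<mu> (\<lambda>t. emeasure (K t) (nonatoms (K t)))"

definition from_model :: "point \<Rightarrow> real \<times> real" where
  "from_model z = (case z of Copy i t \<Rightarrow> (t, atom_position K i t) | Strip t u \<Rightarrow> (t, nonatomic_quantile K t u))"

definition to_model :: "real \<times> real \<Rightarrow> point" where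
  "to_model z = (if snd z \<in> nonatoms (K (fst z)) then Strip (fst z) (nonatomic_cdf K (fst z) (snd z))
     else Copy (atom_rank (K (fst z)) (snd z)) (fst z))"

lemma sets_marginals: "sets (rank_marginal i) = sets pos_reals" "sets nonatomic_marginal = sets pos_reals"
  by (auto simp: rank_marginal_def nonatomic_marginal_def s\<mu>)

lemma space_\<mu>: "space \<mu> = {0<..}" using sets_eq_imp_space_eq[OF s\<mu>] by (simp add: space_restrict_space)

lemma space_m: "space m = {0<..} \<times> UNIV"
  using sets_eq_imp_space_eq[OF sm] by (simp add: space_pair_measure space_restrict_space)

lemma real_distribution_at: "0 < t \<Longrightarrow> real_distribution (K t)"
  by (rule kernel_real_distribution[OF K]) (simp add: space_restrict_space)

lemma weight_measurable: "(\<lambda>t. emeasure (K t) (atoms_of_rank (K t) i)) \<in> borel_measurable \<mu>"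
  using measurable_atom_weight[OF K] by (simp add: measurable_cong_sets[OF s\<mu> refl])

lemma nonatomic_mass_measurable: "(\<lambda>t. emeasure (K t) (nonatoms (K t))) \<in> borel_measurable \<mu>"
proof -
  have "(\<lambda>t. ennreal (measure (K t) (nonatoms (K t)))) \<in> borel_measurable \<mu>"
    using measurable_nonatomic_mass[OF K] by (simp add: measurable_cong_sets[OF s\<mu> refl])
  moreover have "ennreal (measure (K t) (nonatoms (K t))) = emeasure (K t) (nonatoms (K t))" if "t \<in> space \<mu>" for t
  proof -
    interpret real_distribution "K t" using that real_distribution_at by (simp add: space_\<mu>)
    show ?thesis by (simp add: emeasure_eq_measure)
  qed
  ultimately show ?thesis by (simp cong: measurable_cong)
qed

lemma rank_marginal_mono:
  assumes "X \<in> sets pos_reals" shows "emeasure (rank_marginal (Suc i)) X \<le> emeasure (rank_marginal i) X"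
  unfolding rank_marginal_def using assms weight_measurable
  by (subst (1 2) emeasure_density)
    (auto simp: s\<mu> space_\<mu> intro!: nn_integral_mono mult_right_mono real_distribution.emeasure_atoms_of_rank_Suc_le real_distribution_at)

lemma from_model_measurable: "from_model \<in> measurable (L_base F) m"
  unfolding measurable_cong_sets[OF refl sm]
proof (rule measurable_from_L_base)
  note [measurable] = measurable_atom_position[OF K] measurable_nonatomic_quantile[OF K]
  show "(\<lambda>t. from_model (Copy j t)) \<in> measurable pos_reals (pos_reals \<Otimes>\<^sub>M borel)" for j
    unfolding from_model_def by simp
  have "(\<lambda>z. z) \<in> measurable (pos_reals \<Otimes>\<^sub>M unit_interval) (pos_reals \<Otimes>\<^sub>M borel)"
    by (subst measurable_pair_iff) (auto intro!: measurable_compose[OF measurable_snd measurable_restrict_space1] simp: o_def)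
  from measurable_compose[OF this measurable_nonatomic_quantile[OF K]]
  show "(\<lambda>z. from_model (Strip (fst z) (snd z))) \<in> measurable (pos_reals \<Otimes>\<^sub>M unit_interval) (pos_reals \<Otimes>\<^sub>M borel)"
    unfolding from_model_def by simp
qed

lemma to_model_measurable: "to_model \<in> measurable m (L_base F)"
proof (rule measurableI)
  fix z assume "z \<in> space m"
  then show "to_model z \<in> space (L_base F)"
    using nonatomic_cdf_bounds[OF K, of "fst z" "snd z"]
    by (auto simp: space_m to_model_def L_set_def space_restrict_space)
next
  fix X assume "X \<in> sets (L_base F)"
  then have X: "X \<in> L_sets" by simp
  then have X1: "{t. Copy j t \<in> X} \<in> sets pos_reals" and X2: "{(t, x). Strip t x \<in> X} \<in> sets (pos_reals \<Otimes>\<^sub>M unit_interval)" for j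
    by (auto simp: L_sets_def)
  have spp: "space (pos_reals \<Otimes>\<^sub>M (borel :: real measure)) = {0<..} \<times> UNIV" by (simp add: space_pair_measure space_restrict_space)
  note [measurable] = measurable_atom_rank[OF K] measurable_nonatoms[OF K] measurable_nonatomic_cdf2[OF K]
  have eq: "to_model -` X \<inter> space m
    = (\<Union>i. {z\<in>space (pos_reals \<Otimes>\<^sub>M borel). snd z \<in> atoms_of_rank (K (fst z)) i} \<inter> (fst -` {t. Copy i t \<in> X} \<inter> space (pos_reals \<Otimes>\<^sub>M borel)))
    \<union> ({z\<in>space (pos_reals \<Otimes>\<^sub>M borel). snd z \<in> nonatoms (K (fst z))}
        \<inter> ((\<lambda>z. (fst z, nonatomic_cdf K (fst z) (snd z))) -` {(t, x). Strip t x \<in> X} \<inter> space (pos_reals \<Otimes>\<^sub>M borel)))"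
    (is "_ = ?R")
  proof (intro equalityI subsetI)
    fix z assume "z \<in> to_model -` X \<inter> space m"
    then show "z \<in> ?R"
      by (cases "snd z \<in> nonatoms (K (fst z))")
        (auto simp: to_model_def space_m spp atoms_of_rank_def, auto simp: nonatoms_def less_le)
  next
    fix z assume "z \<in> ?R"
    then show "z \<in> to_model -` X \<inter> space m"
      by (auto simp: to_model_def space_m spp atoms_of_rank_def nonatoms_def)
  qed
  have m1: "fst -` {t. Copy i t \<in> X} \<inter> space (pos_reals \<Otimes>\<^sub>M borel) \<in> sets (pos_reals \<Otimes>\<^sub>M (borel :: real measure))" for i
    by (rule measurable_sets[OF measurable_fst X1])
  have "(\<lambda>z. (fst z, nonatomic_cdf K (fst z) (snd z))) \<in> measurable (pos_reals \<Otimes>\<^sub>M borel) (pos_reals \<Otimes>\<^sub>M unit_interval)"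
  proof (rule measurable_Pair)
    show "(\<lambda>z. nonatomic_cdf K (fst z) (snd z)) \<in> measurable (pos_reals \<Otimes>\<^sub>M borel) unit_interval"
      using nonatomic_cdf_bounds[OF K]
      by (intro measurable_restrict_space2) (auto simp: space_pair_measure)
  qed simp
  from measurable_sets[OF this X2]
  have m2: "(\<lambda>z. (fst z, nonatomic_cdf K (fst z) (snd z))) -` {(t, x). Strip t x \<in> X} \<inter> space (pos_reals \<Otimes>\<^sub>M borel) \<in> sets (pos_reals \<Otimes>\<^sub>M borel)" .
  show "to_model -` X \<inter> space m \<in> sets m"
    unfolding eq sm
    by (intro sets.Un sets.countable_UN image_subsetI sets.Int[OF measurable_atom_rank[OF K] m1]
        sets.Int[OF measurable_nonatoms[OF K] m2])
qed

lemma fst_from_model_to_model: "fst (from_model (to_model z)) = fst z"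
  by (auto simp: from_model_def to_model_def)

lemma coord_to_model: "coord (to_model z) = fst z" by (simp add: to_model_def)

text \<open>On the copies this is exact wherever \<open>K t\<close> has an atom of the given rank, that is, almost everywhere
  for \<open>\<nu>\<^sub>i\<close>. On the strip the quantile may hit the position of an atom, but only for a null set of levels, since
  the quantiles are distributed according to the atomless part.\<close>

lemma AE_to_model_from_model:
  "AE z in L_base (rank_marginal, nonatomic_marginal). to_model (from_model z) = z"
proof (rule AE_L_base)
  fix j
  have "AE t in \<mu>. 0 < emeasure (K t) (atoms_of_rank (K t) j) \<longrightarrow> to_model (from_model (Copy j t)) = Copy j t"
  proof (intro AE_I2 impI)
    fix t assume t: "t \<in> space \<mu>" and pos: "0 < emeasure (K t) (atoms_of_rank (K t) j)"
    then obtain x where x: "x \<in> atoms_of_rank (K t) j" by fastforce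
    then have "atom_position K j t = x"
      using t by (intro atom_position_eq[OF K]) (auto simp: space_\<mu> space_restrict_space)
    then show "to_model (from_model (Copy j t)) = Copy j t"
      using x by (auto simp: from_model_def to_model_def atoms_of_rank_def nonatoms_def)
  qed
  then show "AE t in rank_marginal j. to_model (from_model (Copy j t)) = Copy j t"
    unfolding rank_marginal_def by (subst AE_density[OF weight_measurable])
next
  interpret U: prob_space unit_interval by (rule prob_space_unit_interval)
  have sp: "sets (nonatomic_marginal \<Otimes>\<^sub>M unit_interval) = sets (pos_reals \<Otimes>\<^sub>M unit_interval)"
    by (rule sets_pair_measure_cong[OF sets_marginals(2) refl])
  let ?G = "{z\<in>space (nonatomic_marginal \<Otimes>\<^sub>M unit_interval).
     0 < measure (K (fst z)) (nonatoms (K (fst z))) \<and> 0 < snd z \<and> snd z < 1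
     \<and> measure (K (fst z)) {nonatomic_quantile K (fst z) (snd z)} = 0}"
  have id: "(\<lambda>z. z) \<in> measurable (pos_reals \<Otimes>\<^sub>M unit_interval) (pos_reals \<Otimes>\<^sub>M borel)"
    by (subst measurable_pair_iff) (auto intro!: measurable_compose[OF measurable_snd measurable_restrict_space1] simp: o_def)
  note [measurable] = measurable_point_mass[OF K] measurable_nonatomic_quantile[OF K] measurable_nonatomic_mass[OF K]
  have "{z\<in>space (pos_reals \<Otimes>\<^sub>M borel). 0 < measure (K (fst z)) (nonatoms (K (fst z))) \<and> 0 < snd z \<and> snd z < 1
     \<and> measure (K (fst z)) {nonatomic_quantile K (fst z) (snd z)} = 0} \<in> sets (pos_reals \<Otimes>\<^sub>M borel)"
    using measurable_point_mass2[OF K measurable_fst measurable_nonatomic_quantile[OF K]] by measurable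
  from measurable_sets[OF id this]
  have G: "?G \<in> sets (nonatomic_marginal \<Otimes>\<^sub>M unit_interval)"
    unfolding sp by (rule back_subst[of "\<lambda>X. X \<in> sets (pos_reals \<Otimes>\<^sub>M unit_interval)"])
      (auto simp: space_pair_measure space_restrict_space sets_eq_imp_space_eq[OF sets_marginals(2)])
  have AEG: "AE t in nonatomic_marginal. AE u in unit_interval. (t, u) \<in> ?G"
  proof -
    have "AE t in \<mu>. 0 < emeasure (K t) (nonatoms (K t)) \<longrightarrow> (AE u in unit_interval. (t, u) \<in> ?G)"
    proof (rule AE_I2, rule impI)
      fix t assume t: "t \<in> space \<mu>" and pos: "0 < emeasure (K t) (nonatoms (K t))"
      then have tT: "t \<in> space pos_reals" and t0: "0 < t" by (auto simp: space_\<mu> space_restrict_space)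
      interpret real_distribution "K t" using t real_distribution_at by (simp add: space_\<mu>)
      have pos': "0 < measure (K t) (nonatoms (K t))" using pos by (simp add: emeasure_eq_measure)
      have cn: "- nonatoms (K t) \<in> sets borel" by (intro borel_comp) simp
      have qm[measurable]: "nonatomic_quantile K t \<in> borel_measurable borel"
        using measurable_compose[OF measurable_Pair1'[OF tT] measurable_nonatomic_quantile[OF K]] by simp
      have "emeasure (K t) (nonatoms (K t)) * emeasure lborel {u\<in>{0..1}. nonatomic_quantile K t u \<in> - nonatoms (K t)} = 0"
        using nonatomic_quantile_distr[OF K tT cn] by simp
      then have z: "emeasure lborel {u\<in>{0..1}. nonatomic_quantile K t u \<in> - nonatoms (K t)} = 0"
        using pos by auto
      moreover have "{u\<in>{0..1}. nonatomic_quantile K t u \<in> - nonatoms (K t)} \<in> sets lborel"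
        using cn by measurable
      ultimately have "AE u in lborel. \<not> (u \<in> {0..1} \<and> nonatomic_quantile K t u \<in> - nonatoms (K t))"
        by (intro AE_I'[of "{u\<in>{0..1}. nonatomic_quantile K t u \<in> - nonatoms (K t)}"]) (auto simp: null_sets_def)
      moreover have "AE u in lborel. u \<noteq> (0::real)" "AE u in lborel. u \<noteq> (1::real)"
        by (rule AE_lborel_singleton)+
      ultimately have "AE u in lborel. u \<in> {0..1} \<longrightarrow> (t, u) \<in> ?G"
        by eventually_elim
          (use t0 pos' in \<open>auto simp: space_pair_measure space_restrict_space sets_eq_imp_space_eq[OF sets_marginals(2)] nonatoms_def\<close>)
      then show "AE u in unit_interval. (t, u) \<in> ?G" by (subst AE_restrict_space_iff) auto
    qed
    then show ?thesis unfolding nonatomic_marginal_def by (subst AE_density[OF nonatomic_mass_measurable]) 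
  qed
  have D: "space (nonatomic_marginal \<Otimes>\<^sub>M unit_interval) - ?G \<in> sets (nonatomic_marginal \<Otimes>\<^sub>M unit_interval)"
    using G by (rule sets.compl_sets)
  from AEG have ae: "AE t in nonatomic_marginal. emeasure unit_interval (Pair t -` (space (nonatomic_marginal \<Otimes>\<^sub>M unit_interval) - ?G)) = 0"
  proof eventually_elim
    case (elim t)
    let ?S = "Pair t -` (space (nonatomic_marginal \<Otimes>\<^sub>M unit_interval) - ?G)"
    have "AE u in unit_interval. u \<notin> ?S" using elim by (rule eventually_mono) auto
    then have "?S \<in> null_sets unit_interval" using sets_Pair1[OF D, of t] by (subst AE_iff_null_sets) auto
    then show ?case by (simp add: null_sets_def)
  qed
  have "emeasure (nonatomic_marginal \<Otimes>\<^sub>M unit_interval) (space (nonatomic_marginal \<Otimes>\<^sub>M unit_interval) - ?G)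
     = (\<integral>\<^sup>+t. 0 \<partial>nonatomic_marginal)"
    unfolding U.emeasure_pair_measure_alt[OF D] using ae by (rule nn_integral_cong_AE)
  then have "space (nonatomic_marginal \<Otimes>\<^sub>M unit_interval) - ?G \<in> null_sets (nonatomic_marginal \<Otimes>\<^sub>M unit_interval)"
    using D by (simp add: null_sets_def)
  then have "AE z in nonatomic_marginal \<Otimes>\<^sub>M unit_interval. z \<in> ?G"
    by (rule AE_I') auto
  then show "AE z in nonatomic_marginal \<Otimes>\<^sub>M unit_interval. to_model (from_model (Strip (fst z) (snd z))) = Strip (fst z) (snd z)"
  proof eventually_elim
    case (elim z)
    then have "fst z \<in> space pos_reals"
      by (auto simp: space_pair_measure sets_eq_imp_space_eq[OF sets_marginals(2)])
    then show ?case using elim nonatomic_quantile_le_iff(2)[OF K, of "fst z" "snd z"]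
      by (auto simp: to_model_def from_model_def nonatoms_def)
  qed
qed (rule sets_marginals)+

text \<open>Fibrewise this is the decomposition \<open>emeasure_split_atoms\<close> of \<open>K t\<close> into its atoms, one for each rank, and its atomless
  part, the latter being the image of Lebesgue measure under the quantile function.\<close>

lemma distr_from_model: "distr (L_base (rank_marginal, nonatomic_marginal)) m from_model = m"
proof (rule measure_eqI)
  fix X assume "X \<in> sets (distr (L_base (rank_marginal, nonatomic_marginal)) m from_model)"
  then have X: "X \<in> sets m" by simp
  then have X': "X \<in> sets (pos_reals \<Otimes>\<^sub>M borel)" by (simp add: sm)
  interpret U: prob_space unit_interval by (rule prob_space_unit_interval)
  have Xt: "Pair t -` X \<in> sets borel" for t using X' by (rule sets_Pair1)
  have X0: "0 < t" if "(t, x) \<in> X" for t x using that sets.sets_into_space[OF X] by (auto simp: space_m)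
  let ?Y = "from_model -` X \<inter> L_set"
  have Y: "?Y \<in> L_sets" using measurable_sets[OF from_model_measurable X, of "(rank_marginal, nonatomic_marginal)"] by simp
  have Y1: "{t. Copy i t \<in> ?Y} = {t. (t, atom_position K i t) \<in> X}" for i
    using X0 by (auto simp: from_model_def L_set_def)
  have Y2: "{(t, u). Strip t u \<in> ?Y} = {(t, u). (t, nonatomic_quantile K t u) \<in> X \<and> u \<in> {0..1}}"
    using X0 by (auto simp: from_model_def L_set_def)
  have "emeasure (rank_marginal i) {t. Copy i t \<in> ?Y} = (\<integral>\<^sup>+t. emeasure (K t) (Pair t -` X \<inter> atoms_of_rank (K t) i) \<partial>\<mu>)" for i
  proof -
    have "{t. Copy i t \<in> ?Y} \<in> sets \<mu>" using Y by (simp add: L_sets_def s\<mu>)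
    then have "emeasure (rank_marginal i) {t. Copy i t \<in> ?Y}
      = (\<integral>\<^sup>+t. emeasure (K t) (atoms_of_rank (K t) i) * indicator {t. Copy i t \<in> ?Y} t \<partial>\<mu>)"
      unfolding rank_marginal_def by (rule emeasure_density[OF weight_measurable])
    also have "\<dots> = (\<integral>\<^sup>+t. emeasure (K t) (Pair t -` X \<inter> atoms_of_rank (K t) i) \<partial>\<mu>)"
    proof (rule nn_integral_cong)
      fix t assume t: "t \<in> space \<mu>"
      interpret real_distribution "K t" using t real_distribution_at by (simp add: space_\<mu>)
      show "emeasure (K t) (atoms_of_rank (K t) i) * indicator {t. Copy i t \<in> ?Y} t = emeasure (K t) (Pair t -` X \<inter> atoms_of_rank (K t) i)"
      proof (cases "atoms_of_rank (K t) i = {}")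
        case False
        then obtain x where x: "atoms_of_rank (K t) i = {x}" using atoms_of_rank_cases by blast
        then have "atom_position K i t = x"
          using t by (intro atom_position_eq[OF K]) (auto simp: space_\<mu> space_restrict_space)
        then show ?thesis unfolding Y1 x by (auto simp: indicator_def)
      qed simp
    qed
    finally show ?thesis .
  qed
  moreover have "emeasure (nonatomic_marginal \<Otimes>\<^sub>M unit_interval) {(t, u). Strip t u \<in> ?Y}
    = (\<integral>\<^sup>+t. emeasure (K t) (Pair t -` X \<inter> nonatoms (K t)) \<partial>\<mu>)"
  proof -
    have Ym: "{(t, u). Strip t u \<in> ?Y} \<in> sets (nonatomic_marginal \<Otimes>\<^sub>M unit_interval)"
      using Y sets_pair_measure_cong[OF sets_marginals(2) refl, of unit_interval] by (simp add: L_sets_def)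
    have Ym': "{(t, u). Strip t u \<in> ?Y} \<in> sets (\<mu> \<Otimes>\<^sub>M unit_interval)"
      using Y sets_pair_measure_cong[OF s\<mu> refl, of unit_interval] by (simp add: L_sets_def)
    have "emeasure (nonatomic_marginal \<Otimes>\<^sub>M unit_interval) {(t, u). Strip t u \<in> ?Y}
      = (\<integral>\<^sup>+t. emeasure unit_interval (Pair t -` {(t, u). Strip t u \<in> ?Y}) \<partial>nonatomic_marginal)"
      by (rule U.emeasure_pair_measure_alt[OF Ym])
    also have "\<dots> = (\<integral>\<^sup>+t. emeasure (K t) (nonatoms (K t)) * emeasure unit_interval (Pair t -` {(t, u). Strip t u \<in> ?Y}) \<partial>\<mu>)"
      unfolding nonatomic_marginal_def
      by (rule nn_integral_density[OF nonatomic_mass_measurable]) (rule U.measurable_emeasure_Pair[OF Ym'])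
    also have "\<dots> = (\<integral>\<^sup>+t. emeasure (K t) (Pair t -` X \<inter> nonatoms (K t)) \<partial>\<mu>)"
    proof (rule nn_integral_cong)
      fix t assume "t \<in> space \<mu>"
      then have tT: "t \<in> space pos_reals" by (simp add: space_\<mu> space_restrict_space)
      have "Pair t -` {(t, u). Strip t u \<in> ?Y} = {u\<in>{0..1}. nonatomic_quantile K t u \<in> Pair t -` X}"
        unfolding Y2 by auto
      then have "emeasure unit_interval (Pair t -` {(t, u). Strip t u \<in> ?Y}) = emeasure lborel {u\<in>{0..1}. nonatomic_quantile K t u \<in> Pair t -` X}"
        by (simp add: emeasure_restrict_space subset_eq)
      then show "emeasure (K t) (nonatoms (K t)) * emeasure unit_interval (Pair t -` {(t, u). Strip t u \<in> ?Y})
         = emeasure (K t) (Pair t -` X \<inter> nonatoms (K t))"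
        using nonatomic_quantile_distr[OF K tT Xt] by simp
    qed
    finally show ?thesis .
  qed
  ultimately have "emeasure (L_base (rank_marginal, nonatomic_marginal)) ?Y =
     (\<Sum>i. \<integral>\<^sup>+t. emeasure (K t) (Pair t -` X \<inter> atoms_of_rank (K t) i) \<partial>\<mu>) + (\<integral>\<^sup>+t. emeasure (K t) (Pair t -` X \<inter> nonatoms (K t)) \<partial>\<mu>)"
    by (simp add: emeasure_L_base[OF sets_marginals Y])
  also have "\<dots> = (\<integral>\<^sup>+t. (\<Sum>i. emeasure (K t) (Pair t -` X \<inter> atoms_of_rank (K t) i)) + emeasure (K t) (Pair t -` X \<inter> nonatoms (K t)) \<partial>\<mu>)"
  proof -
    have Xm: "{z\<in>space (pos_reals \<Otimes>\<^sub>M (borel::real measure)). z \<in> X} \<in> sets (pos_reals \<Otimes>\<^sub>M borel)"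
      using X' by (simp add: Collect_conj_eq)
    have 1: "(\<lambda>t. emeasure (K t) (Pair t -` X \<inter> atoms_of_rank (K t) i)) \<in> borel_measurable \<mu>" for i
      unfolding measurable_cong_sets[OF s\<mu> refl]
    proof (rule emeasure_measurable_subprob_algebra2[OF _ K_subprob[OF K]])
      have "(SIGMA t:space pos_reals. Pair t -` X \<inter> atoms_of_rank (K t) i) = X \<inter> {z\<in>space (pos_reals \<Otimes>\<^sub>M borel). snd z \<in> atoms_of_rank (K (fst z)) i}"
        using X0 by (auto simp: space_pair_measure space_restrict_space)
      then show "(SIGMA t:space pos_reals. Pair t -` X \<inter> atoms_of_rank (K t) i) \<in> sets (pos_reals \<Otimes>\<^sub>M borel)"
        using X' measurable_atom_rank[OF K, of i] by simp
    qed
    have 2: "(\<lambda>t. emeasure (K t) (Pair t -` X \<inter> nonatoms (K t))) \<in> borel_measurable \<mu>"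
      unfolding measurable_cong_sets[OF s\<mu> refl]
    proof (rule emeasure_measurable_subprob_algebra2[OF _ K_subprob[OF K]])
      have "(SIGMA t:space pos_reals. Pair t -` X \<inter> nonatoms (K t)) = X \<inter> {z\<in>space (pos_reals \<Otimes>\<^sub>M borel). snd z \<in> nonatoms (K (fst z))}"
        using X0 by (auto simp: space_pair_measure space_restrict_space)
      then show "(SIGMA t:space pos_reals. Pair t -` X \<inter> nonatoms (K t)) \<in> sets (pos_reals \<Otimes>\<^sub>M borel)"
        using X' measurable_nonatoms[OF K] by simp
    qed
    show ?thesis using 1 2 by (subst nn_integral_add) (auto simp: nn_integral_suminf)
  qed
  also have "\<dots> = (\<integral>\<^sup>+t. emeasure (K t) (Pair t -` X) \<partial>\<mu>)"
  proof (rule nn_integral_cong)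
    fix t assume t: "t \<in> space \<mu>"
    interpret real_distribution "K t" using t real_distribution_at by (simp add: space_\<mu>)
    show "(\<Sum>i. emeasure (K t) (Pair t -` X \<inter> atoms_of_rank (K t) i)) + emeasure (K t) (Pair t -` X \<inter> nonatoms (K t))
      = emeasure (K t) (Pair t -` X)" by (rule emeasure_split_atoms[OF Xt, symmetric])
  qed
  also have "\<dots> = emeasure m X" by (rule mK[OF X, symmetric])
  finally show "emeasure (distr (L_base (rank_marginal, nonatomic_marginal)) m from_model) X = emeasure m X"
    using X by (simp add: emeasure_distr[OF from_model_measurable])
qed simp

lemma null_iso_from_model:
  "null_iso (completion (L_base (rank_marginal, nonatomic_marginal))) (completion m) from_model to_model"
  "distr (completion (L_base (rank_marginal, nonatomic_marginal))) (completion m) from_model = completion m"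
proof -
  have [measurable]: "snd \<in> measurable m borel" using measurable_snd[of pos_reals borel] by (simp add: measurable_cong_sets[OF sm refl])
  have [measurable]: "(\<lambda>y. from_model (to_model y)) \<in> measurable m m"
    using measurable_comp[OF to_model_measurable from_model_measurable] by (simp add: o_def)
  have "{y\<in>space m. from_model (to_model y) = y} = {y\<in>space m. snd (from_model (to_model y)) = snd y}"
    using fst_from_model_to_model by (auto simp: prod_eq_iff)
  also have "\<dots> \<in> sets m" by measurable
  finally have sep: "{y\<in>space m. from_model (to_model y) = y} \<in> sets m" .
  show "null_iso (completion (L_base (rank_marginal, nonatomic_marginal))) (completion m) from_model to_model"
    "distr (completion (L_base (rank_marginal, nonatomic_marginal))) (completion m) from_model = completion m"
    using null_iso_completion[OF from_model_measurable to_model_measurable distr_from_model AE_to_model_from_model sep] by auto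
qed

end

text \<open>The graph map \<open>x \<mapsto> (f x, x)\<close> has the inverse \<open>snd\<close>, so \<open>U\<close> is isomorphic to the image measure \<open>m\<close> on pairs, and
  \<open>f\<close> becomes the first component.\<close>

theorem positive_function_model:
  fixes U :: "real measure" and f :: "real \<Rightarrow> real"
  assumes U: "prob_space U" "sets U = sets borel" and f: "f \<in> measurable U pos_reals"
  obtains \<nu> \<kappa> a a' where "\<And>j. sets (\<nu> j) = sets pos_reals" "sets \<kappa> = sets pos_reals"
    "\<And>j X. X \<in> sets pos_reals \<Longrightarrow> emeasure (\<nu> (Suc j)) X \<le> emeasure (\<nu> j) X"
    "null_iso (completion U) (L_space (\<nu>, \<kappa>)) a a'"
    "distr (completion U) (L_space (\<nu>, \<kappa>)) a = L_space (\<nu>, \<kappa>)"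
    "\<And>x. coord (a x) = f x"
proof -
  define m where "m = distr U (pos_reals \<Otimes>\<^sub>M borel) (\<lambda>x. (f x, x))"
  have idU: "(\<lambda>x. x) \<in> measurable U borel" by (simp add: measurable_cong_sets[OF U(2) refl])
  have g: "(\<lambda>x. (f x, x)) \<in> measurable U (pos_reals \<Otimes>\<^sub>M borel)" by (intro measurable_Pair f idU)
  have sm: "sets m = sets (pos_reals \<Otimes>\<^sub>M borel)" by (simp add: m_def)
  have pm: "prob_space m" unfolding m_def by (rule prob_space.prob_space_distr[OF U(1) g])
  define \<mu> where "\<mu> = distr m pos_reals fst"
  obtain K where K: "K \<in> measurable pos_reals (prob_algebra borel)"
    and mK: "\<And>X. X \<in> sets m \<Longrightarrow> emeasure m X = (\<integral>\<^sup>+t. emeasure (K t) (Pair t -` X) \<partial>\<mu>)"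
    unfolding \<mu>_def by (rule disintegration[OF pm sm]) blast
  have s\<mu>: "sets \<mu> = sets pos_reals" by (simp add: \<mu>_def)
  note A = sm K s\<mu> mK
  let ?\<nu> = "rank_marginal K \<mu>" and ?\<kappa> = "nonatomic_marginal K \<mu>"
  have gm: "(\<lambda>x. (f x, x)) \<in> measurable U m" using g by (simp add: measurable_cong_sets[OF refl sm])
  have sU: "snd \<in> measurable m U"
    using measurable_snd[of pos_reals borel] by (simp add: measurable_cong_sets[OF sm U(2)])
  have fm: "(\<lambda>y. f (snd y)) \<in> measurable m pos_reals" by (rule measurable_compose[OF sU f])
  have [measurable]: "fst \<in> borel_measurable m"
    using measurable_fst[of pos_reals "borel :: real measure"]
    by (simp add: measurable_cong_sets[OF sm refl] measurable_restrict_space2_iff)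
  have [measurable]: "(\<lambda>y. f (snd y)) \<in> borel_measurable m" using fm by (simp add: measurable_restrict_space2_iff)
  have "{y\<in>space m. (\<lambda>x. (f x, x)) (snd y) = y} = {y\<in>space m. f (snd y) = fst y}" by (auto simp: prod_eq_iff)
  also have "\<dots> \<in> sets m" by measurable
  finally have sep: "{y\<in>space m. (\<lambda>x. (f x, x)) (snd y) = y} \<in> sets m" .
  have d: "distr U m (\<lambda>x. (f x, x)) = m" unfolding m_def by (rule distr_cong) auto
  have "AE x in U. snd (f x, x) = x" by simp
  note i1 = null_iso_completion[OF gm sU d this sep]
  note i2 = null_iso_from_model[OF A]
  note i3 = null_iso_sym[OF i2(1)] null_iso_distr_inverse[OF i2]
  show ?thesis
  proof (rule that)
    show "sets (?\<nu> j) = sets pos_reals" "sets ?\<kappa> = sets pos_reals" for j using sets_marginals[OF A] by auto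
    show "emeasure (?\<nu> (Suc j)) X \<le> emeasure (?\<nu> j) X" if "X \<in> sets pos_reals" for j X
      using rank_marginal_mono[OF A that] .
    show "null_iso (completion U) (L_space (?\<nu>, ?\<kappa>)) (to_model K \<circ> (\<lambda>x. (f x, x))) (snd \<circ> from_model K)"
      unfolding L_space_completion by (rule null_iso_trans[OF i1(1) i3(1)])
    show "distr (completion U) (L_space (?\<nu>, ?\<kappa>)) (to_model K \<circ> (\<lambda>x. (f x, x))) = L_space (?\<nu>, ?\<kappa>)"
      unfolding L_space_completion
      by (rule null_iso_distr_trans[OF i1(1) i3(1) i1(2) i3(2)])
    show "coord ((to_model K \<circ> (\<lambda>x. (f x, x))) x) = f x" for x by (simp add: coord_to_model[OF A])
  qed
qed

section \<open>Uniqueness of the family\<close>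

lemma sum_le_initial_segment:
  fixes d :: "nat \<Rightarrow> 'a :: {ordered_comm_monoid_add, canonically_ordered_monoid_add}"
  assumes "antimono d" "finite D" "card D \<le> n"
  shows "sum d D \<le> sum d {..<n}"
  using assms(2,3)
proof (induction n arbitrary: D)
  case (Suc n)
  show ?case
  proof (cases "D \<subseteq> {..<n}")
    case True
    then show ?thesis by (intro sum_mono2) auto
  next
    case False
    then obtain M where M: "M \<in> D" "n \<le> M" by (auto simp: subset_iff not_less)
    have "sum d D = d M + sum d (D - {M})" using Suc.prems M by (simp add: sum.remove)
    also have "\<dots> \<le> d n + sum d {..<n}"
      using Suc.prems M antimonoD[OF assms(1) M(2)] by (intro add_mono Suc.IH) (auto simp: card_Diff_singleton)
    finally show ?thesis by (simp add: add.commute)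
  qed
qed simp

lemma admissible_sets:
  assumes "admissible (\<nu>, \<kappa>)"
  shows "\<And>j. sets (\<nu> j) = sets pos_reals" "sets \<kappa> = sets pos_reals"
    "\<And>j X. X \<in> sets pos_reals \<Longrightarrow> emeasure (\<nu> (Suc j)) X \<le> emeasure (\<nu> j) X"
  using assms by auto

lemma sets_total_measure: "sets (total_measure F) = sets pos_reals" "space (total_measure F) = {0<..}"
proof -
  obtain \<nu> \<kappa> where F: "F = (\<nu>, \<kappa>)" by (cases F)
  show "sets (total_measure F) = sets pos_reals" unfolding F total_measure.simps
    using sets.sigma_sets_eq[of pos_reals] sets.sets_into_space[of _ pos_reals]
    by (subst sets_measure_of) (auto simp: space_restrict_space)
  from sets_eq_imp_space_eq[OF this] show "space (total_measure F) = {0<..}" by (simp add: space_restrict_space)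
qed

lemma admissible_prob: "admissible F \<Longrightarrow> prob_space (total_measure F)"
  by (cases F) (auto intro!: prob_spaceI simp del: total_measure.simps)

lemma admissible_finite:
  assumes A: "admissible (\<nu>, \<kappa>)" and X: "X \<in> sets pos_reals"
  shows "(\<Sum>j. emeasure (\<nu> j) X) < \<infinity>" "emeasure (\<nu> j) X < \<infinity>"
    "emeasure (\<nu> j) X \<le> emeasure (total_measure (\<nu>, \<kappa>)) X"
proof -
  interpret prob_space "total_measure (\<nu>, \<kappa>)" by (rule admissible_prob[OF A])
  have e: "emeasure (total_measure (\<nu>, \<kappa>)) X = (\<Sum>j. emeasure (\<nu> j) X) + emeasure \<kappa> X"
    by (rule emeasure_total_measure[OF admissible_sets(1,2)[OF A] X])
  have fin: "emeasure (total_measure (\<nu>, \<kappa>)) X < \<infinity>"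
    by (simp add: less_top[symmetric] del: total_measure.simps)
  show s: "(\<Sum>j. emeasure (\<nu> j) X) < \<infinity>" using fin e by (simp add: ennreal_add_eq_top[symmetric] less_top)
  have le: "emeasure (\<nu> j) X \<le> (\<Sum>j. emeasure (\<nu> j) X)"
    using sum_le_suminf[of "\<lambda>j. emeasure (\<nu> j) X" "{j}"] by simp
  show "emeasure (\<nu> j) X < \<infinity>" using le s by (rule le_less_trans)
  show "emeasure (\<nu> j) X \<le> emeasure (total_measure (\<nu>, \<kappa>)) X" unfolding e using le by (simp add: add_increasing2)
qed

text \<open>A set on which the coordinate is injective meets each fibre at most once. It is therefore null in the
  strip, and over a point \<open>t\<close> the sets \<open>S i\<close> together contain the points of at most \<open>n\<close> copies.
  With respect to the distribution of the coordinate, \<open>\<nu> j\<close> has a density \<open>d j\<close> that decreases in \<open>j\<close>, so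
  the mass of these points is at most that of the first \<open>n\<close> copies.\<close>

lemma emeasure_sections_le:
  assumes A: "admissible (\<nu>, \<kappa>)" and X: "X \<in> sets pos_reals"
    and S: "\<And>i. i < n \<Longrightarrow> S i \<in> L_sets" "\<And>i. i < n \<Longrightarrow> inj_on coord (S i)" "\<And>i. i < n \<Longrightarrow> coord ` S i \<subseteq> X"
    and disj: "disjoint_family_on S {..<n}"
  shows "(\<Sum>i<n. emeasure (L_base (\<nu>, \<kappa>)) (S i)) \<le> (\<Sum>i<n. emeasure (\<nu> i) X)"
proof -
  note s = admissible_sets[OF A]
  let ?\<tau> = "total_measure (\<nu>, \<kappa>)"
  interpret \<tau>: prob_space ?\<tau> by (rule admissible_prob[OF A])
  interpret U: prob_space unit_interval by (rule prob_space_unit_interval)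
  note [simp del] = total_measure.simps
  define d where "d j = RN_deriv ?\<tau> (\<nu> j)" for j
  have dm[measurable]: "d j \<in> borel_measurable ?\<tau>" for j unfolding d_def by simp
  have "absolutely_continuous ?\<tau> (\<nu> j)" for j
    unfolding absolutely_continuous_def
  proof
    fix Y assume "Y \<in> null_sets ?\<tau>"
    then show "Y \<in> null_sets (\<nu> j)"
      using admissible_finite(3)[OF A, of Y j] by (auto simp: null_sets_def sets_total_measure s)
  qed
  then have d: "density ?\<tau> (d j) = \<nu> j" for j
    unfolding d_def by (intro \<tau>.density_RN_deriv) (auto simp: sets_total_measure s)
  have dint: "emeasure (\<nu> j) Y = (\<integral>\<^sup>+t. d j t * indicator Y t \<partial>?\<tau>)" if "Y \<in> sets pos_reals" for j Y
    using that emeasure_density[OF dm[of j], of Y] by (simp add: d sets_total_measure)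
  have "AE t in ?\<tau>. d (Suc j) t \<le> d j t" for j
    by (rule \<tau>.AE_le_if_nn_integral_le) (use s(3) in \<open>auto simp: sets_total_measure dint[symmetric]\<close>)
  then have "AE t in ?\<tau>. \<forall>j. d (Suc j) t \<le> d j t" by (simp add: AE_all_countable)
  then have anti: "AE t in ?\<tau>. antimono (\<lambda>j. d j t)"
    by eventually_elim (simp add: antimono_iff_le_Suc)
  define T where "T i j = {t. Copy j t \<in> S i}" for i j
  have T: "T i j \<in> sets pos_reals" if "i < n" for i j using S(1)[OF that] by (simp add: L_sets_def T_def)
  have strip0: "emeasure (\<kappa> \<Otimes>\<^sub>M unit_interval) {(t, x). Strip t x \<in> S i} = 0" if i: "i < n" for i
  proof -
    have m: "{(t, x). Strip t x \<in> S i} \<in> sets (\<kappa> \<Otimes>\<^sub>M unit_interval)"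
      using S(1)[OF i] sets_pair_measure_cong[OF s(2) refl, of unit_interval] by (simp add: L_sets_def)
    have "emeasure unit_interval (Pair t -` {(t, x). Strip t x \<in> S i}) = 0" for t
    proof -
      have "x = y" if "Strip t x \<in> S i" "Strip t y \<in> S i" for x y
        using inj_onD[OF S(2)[OF i] _ that] by simp
      then obtain x where x: "Pair t -` {(t, x). Strip t x \<in> S i} \<subseteq> {x}"
        by (cases "\<exists>x. Strip t x \<in> S i") blast+
      have "Pair t -` {(t, x). Strip t x \<in> S i} \<subseteq> {0..1}" using S(1)[OF i] by (auto simp: L_sets_def L_set_def)
      then have "emeasure unit_interval (Pair t -` {(t, x). Strip t x \<in> S i}) = emeasure lborel (Pair t -` {(t, x). Strip t x \<in> S i})"
        by (intro emeasure_restrict_space) auto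
      also have "\<dots> \<le> emeasure lborel {x}" using x by (intro emeasure_mono) auto
      finally show ?thesis by simp
    qed
    then show ?thesis unfolding U.emeasure_pair_measure_alt[OF m] by simp
  qed
  have "(\<Sum>i<n. emeasure (L_base (\<nu>, \<kappa>)) (S i)) = (\<Sum>i<n. \<Sum>j. emeasure (\<nu> j) (T i j))"
    by (intro sum.cong) (simp_all add: emeasure_L_base[OF s(1,2) S(1)] strip0 T_def)
  also have "\<dots> = (\<Sum>i<n. \<Sum>j. \<integral>\<^sup>+t. d j t * indicator (T i j) t \<partial>?\<tau>)"
    by (intro sum.cong suminf_cong) (auto simp: dint T)
  also have "\<dots> = (\<integral>\<^sup>+t. (\<Sum>i<n. \<Sum>j. d j t * indicator (T i j) t) \<partial>?\<tau>)"
  proof -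
    have m: "(\<lambda>t. d j t * indicator (T i j) t) \<in> borel_measurable ?\<tau>" if "i < n" for i j
    proof -
      have [measurable]: "T i j \<in> sets ?\<tau>" using T[OF that] by (simp add: sets_total_measure)
      show ?thesis by measurable
    qed
    then have "(\<integral>\<^sup>+t. (\<Sum>i<n. \<Sum>j. d j t * indicator (T i j) t) \<partial>?\<tau>) = (\<Sum>i<n. \<integral>\<^sup>+t. (\<Sum>j. d j t * indicator (T i j) t) \<partial>?\<tau>)"
      by (intro nn_integral_sum borel_measurable_suminf) auto
    also have "\<dots> = (\<Sum>i<n. \<Sum>j. \<integral>\<^sup>+t. d j t * indicator (T i j) t \<partial>?\<tau>)"
      using m by (intro sum.cong nn_integral_suminf) auto
    finally show ?thesis ..
  qed
  also have "\<dots> \<le> (\<integral>\<^sup>+t. (\<Sum>i<n. d i t * indicator X t) \<partial>?\<tau>)"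
  proof (rule nn_integral_mono_AE)
    show "AE t in ?\<tau>. (\<Sum>i<n. \<Sum>j. d j t * indicator (T i j) t) \<le> (\<Sum>i<n. d i t * indicator X t)"
      using anti
    proof eventually_elim
      case (elim t)
      \<comment> \<open>\<open>S i\<close> meets the fibre over \<open>t\<close> in the copy \<open>c i\<close>, for \<open>i \<in> I\<close>\<close>
      define I where "I = {i. i < n \<and> (\<exists>j. t \<in> T i j)}"
      define c where "c i = (SOME j. t \<in> T i j)" for i
      have c: "t \<in> T i (c i)" if "i \<in> I" for i using that unfolding I_def c_def by (auto intro: someI)
      have cu: "j = c i" if "i \<in> I" "t \<in> T i j" for i j
        using inj_onD[OF S(2), of i "Copy j t" "Copy (c i) t"] c[OF that(1)] that by (auto simp: I_def T_def)
      have inj: "inj_on c I"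
      proof (rule inj_onI, rule ccontr)
        fix i k assume ik: "i \<in> I" "k \<in> I" "c i = c k" "i \<noteq> k"
        then have "Copy (c i) t \<in> S i \<inter> S k" using c[OF ik(1)] c[OF ik(2)] by (simp add: T_def)
        then show False using disj ik unfolding disjoint_family_on_def I_def by blast
      qed
      show ?case
      proof (cases "t \<in> X")
        case True
        have "(\<Sum>j. d j t * indicator (T i j) t) = (if i \<in> I then d (c i) t else 0)" if "i < n" for i
        proof (cases "i \<in> I")
          case i: True
          have "(\<Sum>j. d j t * indicator (T i j) t) = (\<Sum>j\<in>{c i}. d j t * indicator (T i j) t)"
            by (rule suminf_finite) (use cu[OF i] in \<open>auto simp: indicator_def\<close>)
          then show ?thesis using i c by simp
        next
          case False
          then have "(\<lambda>j. d j t * indicator (T i j) t) = (\<lambda>j. 0)" using that by (auto simp: I_def)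
          then show ?thesis using False by (simp only: suminf_zero if_False)
        qed
        then have "(\<Sum>i<n. \<Sum>j. d j t * indicator (T i j) t) = (\<Sum>i<n. if i \<in> I then d (c i) t else 0)"
          by (intro sum.cong) auto
        also have "\<dots> = (\<Sum>i\<in>I. d (c i) t)"
          by (subst sum.inter_filter[symmetric]) (auto simp: I_def intro!: sum.cong)
        also have "\<dots> = sum (\<lambda>j. d j t) (c ` I)" using inj by (simp add: sum.reindex)
        also have "\<dots> \<le> sum (\<lambda>j. d j t) {..<n}"
        proof (rule sum_le_initial_segment[OF elim])
          have "card (c ` I) \<le> card I" by (rule card_image_le) (simp add: I_def)
          also have "\<dots> \<le> card {..<n}" by (rule card_mono) (auto simp: I_def)
          finally show "card (c ` I) \<le> n" by simp
        qed (simp add: I_def)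
        finally show ?thesis using True by simp
      next
        case False
        then have "t \<notin> T i j" if "i < n" for i j using S(3)[OF that] by (force simp: T_def)
        then show ?thesis by simp
      qed
    qed
  qed
  also have "\<dots> = (\<Sum>i<n. \<integral>\<^sup>+t. d i t * indicator X t \<partial>?\<tau>)"
  proof (rule nn_integral_sum)
    have [measurable]: "X \<in> sets ?\<tau>" using X by (simp add: sets_total_measure)
    show "(\<lambda>t. d i t * indicator X t) \<in> borel_measurable ?\<tau>" for i by measurable
  qed
  also have "\<dots> = (\<Sum>i<n. emeasure (\<nu> i) X)" using X by (simp add: dint)
  finally show ?thesis .
qed

lemma Copy_image_L_sets: assumes X: "X \<in> sets pos_reals" shows "Copy i ` X \<in> L_sets"
proof -
  have 1: "{t. Copy j t \<in> Copy i ` X} = (if i = j then X else {})" for j by auto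
  have 2: "{(t, x). Strip t x \<in> Copy i ` X} = {}" by auto
  show ?thesis unfolding L_sets_def mem_Collect_eq 1 2
    using X sets.sets_into_space[OF X] by (auto simp: L_set_def space_restrict_space)
qed

lemma emeasure_Copy_image:
  assumes s: "\<And>j. sets (\<nu> j) = sets pos_reals" "sets \<kappa> = sets pos_reals" and X: "X \<in> sets pos_reals"
  shows "emeasure (L_base (\<nu>, \<kappa>)) (Copy i ` X) = emeasure (\<nu> i) X"
proof -
  have 1: "{t. Copy j t \<in> Copy i ` X} = (if j = i then X else {})" for j by auto
  have 2: "{(t, x). Strip t x \<in> Copy i ` X} = {}" by auto
  have "(\<Sum>j. emeasure (\<nu> j) (if j = i then X else {})) = (\<Sum>j\<in>{i}. emeasure (\<nu> j) (if j = i then X else {}))"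
    by (rule suminf_finite) auto
  then show ?thesis unfolding emeasure_L_base[OF s Copy_image_L_sets[OF X]] 1 2 by simp
qed

text \<open>The images of the first \<open>n\<close> copies over \<open>X\<close> are disjoint, lie over \<open>X\<close>, and the coordinate is injective on each of
  them, off a null set. So the bound for sections applies in the target.\<close>

lemma sum_marginals_le:
  assumes A: "admissible (\<nu>, \<kappa>)" and A': "admissible (\<nu>', \<kappa>')"
    and iso: "null_iso (L_space (\<nu>, \<kappa>)) (L_space (\<nu>', \<kappa>')) \<phi> \<phi>'"
    and mp: "distr (L_space (\<nu>, \<kappa>)) (L_space (\<nu>', \<kappa>')) \<phi> = L_space (\<nu>', \<kappa>')"
    and fibre: "AE z in L_space (\<nu>, \<kappa>). coord (\<phi> z) = coord z"
    and X: "X \<in> sets pos_reals"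
  shows "(\<Sum>i<n. emeasure (\<nu> i) X) \<le> (\<Sum>i<n. emeasure (\<nu>' i) X)"
proof -
  let ?B' = "L_base (\<nu>', \<kappa>')" and ?L = "L_space (\<nu>, \<kappa>)" and ?L' = "L_space (\<nu>', \<kappa>')"
  note [simp del] = L_space.simps
  have L': "?L' = completion ?B'" by (rule L_space_completion)
  have mp': "distr ?L' ?L \<phi>' = ?L" by (rule null_iso_distr_inverse[OF iso mp])
  have \<phi>': "\<phi>' \<in> measurable ?L' ?L" using iso by (simp add: null_iso_def)
  have "AE z in ?L'. coord (\<phi> (\<phi>' z)) = coord (\<phi>' z)"
    by (rule null_iso_AE[OF null_iso_sym[OF iso] fibre])
  moreover have "AE z in ?L'. \<phi> (\<phi>' z) = z" using iso by (simp add: null_iso_def)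
  ultimately have Z: "AE z in ?L'. coord (\<phi>' z) = coord z \<and> \<phi> (\<phi>' z) = z" by eventually_elim simp
  define Z where "Z = {z\<in>space ?L'. coord (\<phi>' z) = coord z \<and> \<phi> (\<phi>' z) = z}"
  have sZ: "Z \<in> sets ?L'" using completion.AE_imp_sets[OF Z[unfolded L']] unfolding Z_def L' .
  have CX: "Copy i ` X \<in> sets ?L" for i
    using Copy_image_L_sets[OF X] by (simp add: L_space_completion)
  define S where "S i = Z \<inter> (\<phi>' -` (Copy i ` X) \<inter> space ?L')" for i
  have S: "S i \<in> sets ?L'" for i unfolding S_def using sZ measurable_sets[OF \<phi>' CX] by (rule sets.Int)
  have eS: "emeasure ?L' (S i) = emeasure (\<nu> i) X" for i
  proof -
    have "emeasure ?L' (S i) = emeasure ?L' (\<phi>' -` (Copy i ` X) \<inter> space ?L')"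
    proof (rule emeasure_eq_AE[OF _ S measurable_sets[OF \<phi>' CX]])
      show "AE z in ?L'. z \<in> S i \<longleftrightarrow> z \<in> \<phi>' -` (Copy i ` X) \<inter> space ?L'"
        using Z by eventually_elim (auto simp: S_def Z_def)
    qed
    also have "\<dots> = emeasure (distr ?L' ?L \<phi>') (Copy i ` X)" by (rule emeasure_distr[OF \<phi>' CX, symmetric])
    also have "\<dots> = emeasure (L_base (\<nu>, \<kappa>)) (Copy i ` X)"
      unfolding mp' unfolding L_space_completion by (simp add: Copy_image_L_sets[OF X])
    also have "\<dots> = emeasure (\<nu> i) X" by (rule emeasure_Copy_image[OF admissible_sets(1,2)[OF A] X])
    finally show ?thesis .
  qed
  \<comment> \<open>the images are measurable only up to null sets; their Borel parts are used instead\<close>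
  define R where "R i = main_part ?B' (S i)" for i
  have R: "R i \<in> L_sets" "R i \<subseteq> S i" "emeasure ?B' (R i) = emeasure (\<nu> i) X" for i
  proof -
    have Si: "S i \<in> sets (completion ?B')" using S[of i] unfolding L' .
    show "R i \<in> L_sets" using main_part_sets[OF Si] by (simp add: R_def)
    show "R i \<subseteq> S i" using main_part_null_part_Un[OF Si] unfolding R_def by blast
    show "emeasure ?B' (R i) = emeasure (\<nu> i) X"
      using eS[of i] emeasure_completion[OF Si] unfolding R_def L' by simp
  qed
  have "(\<Sum>i<n. emeasure ?B' (R i)) \<le> (\<Sum>i<n. emeasure (\<nu>' i) X)"
  proof (rule emeasure_sections_le[OF A' X R(1)])
    show "inj_on coord (R i)" for i
    proof (rule inj_onI)
      fix z y assume zy: "z \<in> R i" "y \<in> R i" and eq: "coord z = coord y"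
      then have "z \<in> S i" "y \<in> S i" using R(2) by auto
      then obtain t s where "\<phi>' z = Copy i t" "\<phi>' y = Copy i s" "coord (\<phi>' z) = coord z" "coord (\<phi>' y) = coord y"
        "\<phi> (\<phi>' z) = z" "\<phi> (\<phi>' y) = y" by (auto simp: S_def Z_def)
      then show "z = y" using eq by (metis coord.simps(1))
    qed
    show "coord ` R i \<subseteq> X" for i
    proof
      fix t assume "t \<in> coord ` R i"
      then obtain z where z: "z \<in> S i" "t = coord z" using R(2) by auto
      then obtain s where "\<phi>' z = Copy i s" "s \<in> X" "coord (\<phi>' z) = coord z" by (auto simp: S_def Z_def)
      then show "t \<in> X" using z by simp
    qed
    show "disjoint_family_on R {..<n}"
      unfolding disjoint_family_on_def
    proof (intro ballI impI)
      fix i k :: nat assume "i \<noteq> k"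
      then have "S i \<inter> S k = {}" by (auto simp: S_def)
      then show "R i \<inter> R k = {}" using R(2)[of i] R(2)[of k] by blast
    qed
  qed
  then show ?thesis by (simp add: R(3))
qed

lemma distr_L_space_coord:
  assumes "\<And>j. sets (\<nu> j) = sets pos_reals" "sets \<kappa> = sets pos_reals"
  shows "distr (L_space (\<nu>, \<kappa>)) pos_reals coord = total_measure (\<nu>, \<kappa>)"
  using distr_L_base_coord[OF assms] distr_completion[OF measurable_coord_base] by (simp add: L_space_completion)

lemma measurable_coord_L_space: "coord \<in> measurable (L_space F) pos_reals"
  unfolding L_space_completion by (rule measurable_completion[OF measurable_coord_base])

text \<open>The inverse isomorphism gives the opposite inequality between the partial sums of the \<open>\<nu>\<^sub>i\<close>, so the \<open>\<nu>\<^sub>i\<close> agree.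
  All measures are finite, so \<open>\<nu>\<^sub>\<infinity>\<close> is obtained by subtracting them from the distribution of
  the coordinate, which the two families share.\<close>

theorem family_unique:
  assumes A: "admissible F" and A': "admissible F'"
    and iso: "null_iso (L_space F) (L_space F') \<phi> \<phi>'"
    and mp: "distr (L_space F) (L_space F') \<phi> = L_space F'"
    and fibre: "AE z in L_space F. coord (\<phi> z) = coord z"
  shows "F = F'"
proof -
  obtain \<nu> \<kappa> \<nu>' \<kappa>' where F: "F = (\<nu>, \<kappa>)" "F' = (\<nu>', \<kappa>')" by (cases F, cases F')
  note B = A[unfolded F] A'[unfolded F]
  note iso1 = iso[unfolded F] mp[unfolded F] fibre[unfolded F]
  note s = admissible_sets[OF B(1)] and s' = admissible_sets[OF B(2)]
  note [simp del] = L_space.simps total_measure.simps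
  have inv: "AE z in L_space F'. coord (\<phi> (\<phi>' z)) = coord (\<phi>' z)"
    by (rule null_iso_AE[OF null_iso_sym[OF iso] fibre])
  moreover have "AE z in L_space F'. \<phi> (\<phi>' z) = z" using iso by (simp add: null_iso_def)
  ultimately have fibre': "AE z in L_space F'. coord (\<phi>' z) = coord z" by eventually_elim simp
  note iso2 = null_iso_sym[OF iso1(1)] null_iso_distr_inverse[OF iso1(1,2)] fibre'[unfolded F]
  have sums: "(\<Sum>i<n. emeasure (\<nu> i) X) = (\<Sum>i<n. emeasure (\<nu>' i) X)" if X: "X \<in> sets pos_reals" for n X
    using sum_marginals_le[OF B iso1 X, of n] sum_marginals_le[OF B(2,1) iso2 X, of n] by (rule antisym)
  have eq: "emeasure (\<nu> i) X = emeasure (\<nu>' i) X" if X: "X \<in> sets pos_reals" for i X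
  proof -
    have "(\<Sum>k<i. emeasure (\<nu> k) X) + emeasure (\<nu> i) X = (\<Sum>k<i. emeasure (\<nu> k) X) + emeasure (\<nu>' i) X"
      using sums[OF X, of "Suc i"] sums[OF X, of i] by simp
    moreover have "(\<Sum>k<i. emeasure (\<nu> k) X) \<noteq> top"
      using admissible_finite(2)[OF B(1) X] by (simp add: less_top)
    ultimately show ?thesis by (simp add: ennreal_add_left_cancel)
  qed
  have \<nu>: "\<nu> = \<nu>'"
    by (rule ext, rule measure_eqI) (auto simp: s s' eq)
  have "total_measure F' = distr (distr (L_space F) (L_space F') \<phi>) pos_reals coord"
    unfolding mp unfolding F by (rule distr_L_space_coord[OF s'(1,2), symmetric])
  also have "\<dots> = distr (L_space F) pos_reals (coord \<circ> \<phi>)"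
    using iso by (intro distr_distr measurable_coord_L_space) (simp add: null_iso_def)
  also have "\<dots> = distr (L_space F) pos_reals coord"
    using iso fibre measurable_coord_L_space[of F] measurable_coord_L_space[of F']
    by (intro distr_cong_AE) (auto simp: null_iso_def intro: measurable_comp)
  also have "\<dots> = total_measure F" unfolding F by (rule distr_L_space_coord[OF s(1,2)])
  finally have tot: "total_measure F' = total_measure F" .
  have "emeasure \<kappa> X = emeasure \<kappa>' X" if X: "X \<in> sets pos_reals" for X
  proof -
    have "(\<Sum>j. emeasure (\<nu> j) X) + emeasure \<kappa> X = (\<Sum>j. emeasure (\<nu> j) X) + emeasure \<kappa>' X"
      using emeasure_total_measure[of \<nu> \<kappa>, OF s(1,2) X] emeasure_total_measure[of \<nu>' \<kappa>', OF s'(1,2) X] tot \<nu> F by simp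
    moreover have "(\<Sum>j. emeasure (\<nu> j) X) \<noteq> top" using admissible_finite(1)[OF B(1) X] by (simp add: less_top)
    ultimately show ?thesis by (simp add: ennreal_add_left_cancel)
  qed
  then have "\<kappa> = \<kappa>'" by (intro measure_eqI) (auto simp: s s')
  then show ?thesis by (simp add: F \<nu>)
qed

section \<open>Derivatives and representations\<close>

lemma measure_iso_null_iso:
  assumes "complete_measure M" "complete_measure N" "prob_space M" "prob_space N" "g \<in> measure_iso M N"
  obtains u u' where "null_iso M N u u'" "AE x in M. g x = u x" "distr M N u = N"
  using measure_iso_iff[of M N g] assms prob_space.not_empty by metis

lemma complete_L_space: "complete_measure (L_space F)"
  unfolding L_space_completion by (rule completion.complete_measure_axioms)

lemma AE_coord_pos: "AE z in L_base F. 0 < ennreal (coord z)"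
  by (rule AE_I2) (auto simp: L_set_def)

lemma coord_borel: "(\<lambda>z. ennreal (coord z)) \<in> borel_measurable (L_base F)"
proof -
  have "coord \<in> borel_measurable (L_base F)"
    using measurable_coord_base[of F] by (simp add: measurable_restrict_space2_iff)
  then show ?thesis by measurable
qed

lemma L_star_completion: "L_star F = completion (density (L_base F) (\<lambda>z. ennreal (coord z)))"
  unfolding L_star_def L_space_completion
  by (rule completion_density_eq[symmetric]) (use AE_coord_pos coord_borel in auto)

lemma complete_L_star: "complete_measure (L_star F)"
  unfolding L_star_completion by (rule completion.complete_measure_axioms)

lemma sets_L_star: "sets (L_star F) = sets (L_space F)" "space (L_star F) = space (L_space F)"
  by (auto simp: L_star_def)

lemma coord_borel_L_space: "(\<lambda>z. ennreal (coord z)) \<in> borel_measurable (L_space F)"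
  unfolding L_space_completion by (rule measurable_completion[OF coord_borel])

text \<open>The coordinate is positive, so \<open>\<L>\<close> and \<open>\<L>\<^sub>*\<close> have the same null sets, and differ
  only in which maps preserve their measure.\<close>

lemma null_sets_L_star: "null_sets (L_star F) = null_sets (L_space F)"
proof -
  have "AE z in L_space F. 0 < ennreal (coord z)"
    unfolding L_space_completion by (rule AE_completion[OF AE_coord_pos])
  then have "X \<in> null_sets (L_star F) \<longleftrightarrow> X \<in> null_sets (L_space F)" if X: "X \<in> sets (L_space F)" for X
    unfolding L_star_def null_sets_density_iff[OF coord_borel_L_space]
    using X by (auto simp: AE_iff_null_sets elim: eventually_elim2)
  moreover have "X \<in> sets (L_space F)" if "X \<in> null_sets (L_star F)" for X using that by (auto simp: null_sets_def sets_L_star)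
  moreover have "X \<in> sets (L_space F)" if "X \<in> null_sets (L_space F)" for X using that by (auto simp: null_sets_def)
  ultimately show ?thesis by blast
qed

lemma AE_L_star_iff: "(AE z in L_star F. Q z) \<longleftrightarrow> (AE z in L_space F. Q z)"
  by (simp add: eventually_ae_filter null_sets_L_star sets_L_star)

lemma null_iso_L_star: "null_iso M (L_star F) u u' \<longleftrightarrow> null_iso M (L_space F) u u'"
proof -
  have 1: "measurable M (L_star F) = measurable M (L_space F)" by (rule measurable_cong_sets[OF refl sets_L_star(1)])
  have 2: "measurable (L_star F) M = measurable (L_space F) M" by (rule measurable_cong_sets[OF sets_L_star(1) refl])
  show ?thesis unfolding null_iso_def 1 2 AE_L_star_iff null_sets_L_star sets_L_star(2) by simp
qed

lemma admissible_prob_L_space: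
  assumes "admissible F" shows "prob_space (L_space F)"
proof -
  obtain \<nu> \<kappa> where F: "F = (\<nu>, \<kappa>)" by (cases F)
  note s = admissible_sets[OF assms[unfolded F]]
  interpret T: prob_space "total_measure F" by (rule admissible_prob[OF assms])
  have "emeasure (L_space F) (space (L_space F)) = emeasure (distr (L_space F) pos_reals coord) (space pos_reals)"
    using measurable_space[OF measurable_coord_L_space[of F]]
    by (subst emeasure_distr[OF measurable_coord_L_space sets.top]) (auto intro!: arg_cong2[where f=emeasure])
  also have "\<dots> = 1" using T.emeasure_space_1 distr_L_space_coord[of \<nu> \<kappa>, OF s(1,2)]
    by (simp add: F sets_total_measure space_restrict_space del: total_measure.simps L_space.simps)
  finally show ?thesis by (rule prob_spaceI)
qed

lemma nn_integral_coord:
  assumes s: "\<And>j. sets (\<nu> j) = sets pos_reals" "sets \<kappa> = sets pos_reals"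
  shows "(\<integral>\<^sup>+z. ennreal (coord z) \<partial>L_space (\<nu>, \<kappa>)) = (\<integral>\<^sup>+t. ennreal t \<partial>total_measure (\<nu>, \<kappa>))"
  unfolding distr_L_space_coord[of \<nu> \<kappa>, OF s, symmetric]
  by (subst nn_integral_distr[OF measurable_coord_L_space]) (auto intro!: measurable_restrict_space1)

lemma admissible_prob_L_star:
  assumes "admissible F" shows "prob_space (L_star F)"
proof -
  obtain \<nu> \<kappa> where F: "F = (\<nu>, \<kappa>)" by (cases F)
  note s = admissible_sets[OF assms[unfolded F]]
  have "emeasure (L_star F) (space (L_star F)) = (\<integral>\<^sup>+z. ennreal (coord z) \<partial>L_space F)"
    unfolding L_star_def by (subst emeasure_density[OF coord_borel_L_space]) (auto intro!: nn_integral_cong)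
  also have "\<dots> = (\<integral>\<^sup>+t. ennreal t \<partial>total_measure (\<nu>, \<kappa>))" unfolding F by (rule nn_integral_coord[OF s(1,2)])
  also have "\<dots> = 1" using assms[unfolded F] by (simp del: total_measure.simps)
  finally show ?thesis by (rule prob_spaceI)
qed

text \<open>The measure \<open>R\<close> pulled back along \<open>g\<close> has the same null sets as \<open>P\<close>, so its density is positive and finite almost
  everywhere; changing it on a null set makes it a positive real function.\<close>

lemma null_iso_derivative:
  assumes P: "prob_space P" and R: "prob_space R" and g: "null_iso P R g g'"
  obtains f where "f \<in> borel_measurable P" "\<And>x. 0 < f x" "density P (\<lambda>x. ennreal (f x)) = distr R P g'"
proof -
  interpret P: prob_space P by fact
  interpret R: prob_space R by fact
  have g': "g' \<in> measurable R P" and g1: "g \<in> measurable P R" using g by (auto simp: null_iso_def)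
  let ?D = "distr R P g'"
  interpret D: prob_space ?D by (rule R.prob_space_distr[OF g'])
  have null: "X \<in> null_sets ?D \<longleftrightarrow> X \<in> null_sets P" if X: "X \<in> sets P" for X
  proof
    assume "X \<in> null_sets P" then show "X \<in> null_sets ?D"
      using g X unfolding null_sets_distr_iff[OF g'] null_iso_def by blast
  next
    assume "X \<in> null_sets ?D"
    then have "AE y in R. g' y \<notin> X" using g' X
      by (intro AE_I'[of "g' -` X \<inter> space R"]) (auto simp: null_sets_distr_iff)
    then have "AE x in P. g' (g x) \<notin> X" by (rule null_iso_AE[OF g])
    moreover have "AE x in P. g' (g x) = x" using g by (simp add: null_iso_def)
    ultimately have "AE x in P. x \<notin> X" by eventually_elim simp
    then show "X \<in> null_sets P" using X by (simp add: AE_iff_null_sets)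
  qed
  have ac: "absolutely_continuous P ?D" unfolding absolutely_continuous_def
    using null by (auto simp: null_sets_def)
  define h where "h = RN_deriv P ?D"
  have hm[measurable]: "h \<in> borel_measurable P" by (simp add: h_def)
  have h: "density P h = ?D" unfolding h_def by (rule P.density_RN_deriv[OF ac]) simp
  have fin: "AE x in P. h x \<noteq> \<infinity>" unfolding h_def
    by (rule P.RN_deriv_finite) (use ac D.sigma_finite_measure_axioms in auto)
  have pos: "AE x in P. h x \<noteq> 0"
  proof -
    let ?Z = "{x\<in>space P. h x = 0}"
    have Z: "?Z \<in> sets P" by measurable
    have "emeasure ?D ?Z = 0"
      unfolding h[symmetric] by (subst emeasure_density[OF hm Z]) (auto simp: nn_integral_0_iff_AE indicator_def)
    then have "?Z \<in> null_sets P" using null[OF Z] Z by (simp add: null_sets_def)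
    then show ?thesis by (intro AE_I'[of ?Z]) auto
  qed
  define f where "f x = (if h x = 0 \<or> h x = \<infinity> then 1 else enn2real (h x))" for x
  show ?thesis
  proof
    show "f \<in> borel_measurable P" unfolding f_def by measurable
    show "0 < f x" for x by (auto simp: f_def enn2real_positive_iff less_top zero_less_iff_neq_zero)
    have "AE x in P. ennreal (f x) = h x" using fin pos by eventually_elim (simp add: f_def less_top)
    moreover have "(\<lambda>x. ennreal (f x)) \<in> borel_measurable P" unfolding f_def by measurable
    ultimately have "density P (\<lambda>x. ennreal (f x)) = density P h" by (intro density_cong) auto
    then show "density P (\<lambda>x. ennreal (f x)) = ?D" by (simp add: h)
  qed
qed

text \<open>The equation \<open>g = b\<inverse> \<circ> id \<circ> a\<close> is used in the form \<open>b \<circ> g = a\<close>, which is free of inverses.\<close>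

lemma represented_byI:
  assumes P: "complete_measure P" "prob_space P" and R: "complete_measure R" "prob_space R" and F: "admissible F"
    and a: "null_iso P (L_space F) a a'" "distr P (L_space F) a = L_space F"
    and b: "null_iso R (L_star F) b b'" "distr R (L_star F) b = L_star F"
    and eq: "AE x in P. b (g x) = a x" and g: "AE x in P. g x = u x" "null_iso P R u u'"
  shows "represented_by P R g F"
proof -
  have ne: "space P \<noteq> {}" "space R \<noteq> {}" "space (L_space F) \<noteq> {}" "space (L_star F) \<noteq> {}"
    using P R admissible_prob_L_space[OF F] admissible_prob_L_star[OF F] by (auto dest: prob_space.not_empty)
  have "a \<in> measure_iso P (L_space F)" using a by (subst measure_iso_iff[OF P(1) complete_L_space ne(1,3)]) auto
  moreover have "b \<in> measure_iso R (L_star F)" using b by (subst measure_iso_iff[OF R(1) complete_L_star ne(2,4)]) auto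
  moreover have "inverse_mod0 R (L_star F) b b'" using b by (simp add: null_iso_def inverse_mod0_def)
  moreover have "AE x in P. g x = (b' \<circ> id \<circ> a) x"
  proof -
    have "AE x in P. b' (b (u x)) = u x"
      using b(1) by (intro null_iso_AE[OF g(2)]) (simp add: null_iso_def)
    then show ?thesis using eq g(1) by eventually_elim simp
  qed
  ultimately show ?thesis unfolding represented_by_def by blast
qed

lemma represented_byE:
  assumes P: "complete_measure P" "prob_space P" and R: "complete_measure R" "prob_space R" and F: "admissible F"
    and r: "represented_by P R g F"
  obtains a a' b b' where "null_iso P (L_space F) a a'" "distr P (L_space F) a = L_space F"
    "null_iso R (L_star F) b b'" "distr R (L_star F) b = L_star F"
    "\<And>u u'. null_iso P R u u' \<Longrightarrow> AE x in P. g x = u x \<Longrightarrow> AE x in P. b (u x) = a x"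
proof -
  obtain a0 b0 c where a0: "a0 \<in> measure_iso P (L_space F)" and b0: "b0 \<in> measure_iso R (L_star F)"
    and c: "inverse_mod0 R (L_star F) b0 c" and gc: "AE x in P. g x = (c \<circ> id \<circ> a0) x"
    using r unfolding represented_by_def by blast
  obtain a a' where a: "null_iso P (L_space F) a a'" "AE x in P. a0 x = a x" "distr P (L_space F) a = L_space F"
    using measure_iso_null_iso[OF P(1) complete_L_space P(2) admissible_prob_L_space[OF F] a0] by metis
  obtain b b' where b: "null_iso R (L_star F) b b'" "AE x in R. b0 x = b x" "distr R (L_star F) b = L_star F"
    using measure_iso_null_iso[OF R(1) complete_L_star R(2) admissible_prob_L_star[OF F] b0] by metis
  have "AE x in P. b (u x) = a x" if u: "null_iso P R u u'" and gu: "AE x in P. g x = u x" for u u'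
  proof -
    have "AE z in L_space F. b0 (c z) = z" using c by (simp add: inverse_mod0_def AE_L_star_iff)
    then have "AE x in P. b0 (c (a x)) = a x" by (rule null_iso_AE[OF a(1)])
    moreover have "AE x in P. b0 (u x) = b (u x)" by (rule null_iso_AE[OF u b(2)])
    ultimately show ?thesis using a(2) gc gu by eventually_elim simp
  qed
  then show ?thesis using a b that by blast
qed

lemma distr_density_AE_cong:
  assumes "f \<in> borel_measurable P" "u \<in> measurable P N" "v \<in> measurable P N" "AE x in P. u x = v x"
  shows "distr (density P f) N u = distr (density P f) N v"
  using assms by (intro distr_cong_AE) (auto simp: AE_density elim: eventually_mono)

text \<open>Since \<open>b \<circ> g = a\<close> and \<open>g\<close> carries \<open>f P\<close> to \<open>R\<close>, the map \<open>a\<close> carries \<open>f P\<close> to \<open>\<L>\<^sub>*\<close>. It also carries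
  \<open>(t \<circ> a) P\<close> to \<open>\<L>\<^sub>*\<close>, because it carries \<open>P\<close> to \<open>\<L>\<close>. As \<open>a\<close> is invertible, the
  two densities coincide.\<close>

lemma coord_eq_derivative:
  assumes P: "prob_space P" and g: "null_iso P R g g'"
    and f: "f \<in> borel_measurable P" "\<And>x. 0 < f x" "density P (\<lambda>x. ennreal (f x)) = distr R P g'"
    and a: "null_iso P (L_space F) a a'" "distr P (L_space F) a = L_space F"
    and b: "b \<in> measurable R (L_space F)" "distr R (L_star F) b = L_star F"
    and eq: "AE x in P. b (g x) = a x"
  shows "AE x in P. coord (a x) = f x"
proof -
  interpret P: prob_space P by fact
  let ?L = "L_space F"
  have m: "g \<in> measurable P R" "g' \<in> measurable R P" "a \<in> measurable P ?L" "a' \<in> measurable ?L P"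
    using g a by (auto simp: null_iso_def)
  have aa: "AE x in P. a' (a x) = x" using a by (simp add: null_iso_def)
  have fe: "(\<lambda>x. ennreal (f x)) \<in> borel_measurable P" using f(1) by measurable
  have ce: "(\<lambda>x. ennreal (coord (a x))) \<in> borel_measurable P" by (rule measurable_compose[OF m(3) coord_borel_L_space])
  have pull_back: "distr (distr (density P k) ?L a) P a' = density P k" if k: "k \<in> borel_measurable P" for k
  proof -
    have "distr (distr (density P k) ?L a) P a' = distr (density P k) P (a' \<circ> a)"
      using m by (intro distr_distr) auto
    also have "\<dots> = distr (density P k) P (\<lambda>x. x)"
      using k m aa by (intro distr_density_AE_cong) auto
    also have "\<dots> = density P k" by (rule distr_id2) simp
    finally show ?thesis .
  qed
  have "distr (density P (\<lambda>x. ennreal (f x))) ?L a = distr (density P (\<lambda>x. ennreal (f x))) ?L (b \<circ> g)"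
    using eq fe m b(1) by (intro distr_density_AE_cong) (auto elim: eventually_mono)
  also have "\<dots> = distr (distr R P g') ?L (b \<circ> g)" by (simp only: f(3))
  also have "\<dots> = distr R ?L ((b \<circ> g) \<circ> g')" using m b by (intro distr_distr) auto
  also have "\<dots> = distr R ?L b"
  proof (rule distr_cong_AE)
    have "AE y in R. g (g' y) = y" using g by (simp add: null_iso_def)
    then show "AE y in R. ((b \<circ> g) \<circ> g') y = b y" by eventually_elim simp
  qed (use m b in auto)
  also have "\<dots> = distr R (L_star F) b" by (rule distr_cong) (auto simp: sets_L_star)
  also have "\<dots> = density (distr P ?L a) (\<lambda>z. ennreal (coord z))"     unfolding b(2) a(2) unfolding L_star_def ..
  also have "\<dots> = distr (density P (\<lambda>x. ennreal (coord (a x)))) ?L a"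
    by (rule density_distr[OF coord_borel_L_space m(3)])
  finally have "distr (density P (\<lambda>x. ennreal (f x))) ?L a = distr (density P (\<lambda>x. ennreal (coord (a x)))) ?L a" .
  then have "density P (\<lambda>x. ennreal (f x)) = density P (\<lambda>x. ennreal (coord (a x)))"
    by (metis pull_back[OF fe] pull_back[OF ce])
  then have 1: "AE x in P. ennreal (f x) = ennreal (coord (a x))" by (simp add: P.density_unique_iff[OF fe ce])
  have 2: "AE x in P. coord (a x) > 0"
    by (rule AE_I2) (use measurable_space[OF m(3)] in \<open>force simp: L_space_completion L_set_def\<close>)
  from 1 2 show ?thesis
  proof eventually_elim
    case (elim x) then show ?case using f(2)[of x] by (simp add: ennreal_inj less_imp_le)
  qed
qed

text \<open>The converse: a coordinate that agrees with the derivative provides the second isomorphism \<open>a \<circ> g\<inverse>\<close>.\<close>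

lemma derivative_L_star_iso:
  assumes P: "prob_space P" and g: "null_iso P R g g'"
    and f: "f \<in> borel_measurable P" "density P (\<lambda>x. ennreal (f x)) = distr R P g'"
    and a: "null_iso P (L_space F) a a'" "distr P (L_space F) a = L_space F"
    and c: "AE x in P. coord (a x) = f x"
  shows "null_iso R (L_star F) (a \<circ> g') (g \<circ> a')" "distr R (L_star F) (a \<circ> g') = L_star F"
    "AE x in P. (a \<circ> g') (g x) = a x"
proof -
  let ?L = "L_space F"
  have m: "g \<in> measurable P R" "g' \<in> measurable R P" "a \<in> measurable P ?L" "a' \<in> measurable ?L P"
    using g a by (auto simp: null_iso_def)
  have ce: "(\<lambda>x. ennreal (coord (a x))) \<in> borel_measurable P" by (rule measurable_compose[OF m(3) coord_borel_L_space])
  show "null_iso R (L_star F) (a \<circ> g') (g \<circ> a')"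
    unfolding null_iso_L_star by (rule null_iso_trans[OF null_iso_sym[OF g] a(1)])
  have "distr R (L_star F) (a \<circ> g') = distr R ?L (a \<circ> g')" by (rule distr_cong) (auto simp: sets_L_star)
  also have "\<dots> = distr (distr R P g') ?L a" using m by (intro distr_distr[symmetric]) auto
  also have "\<dots> = distr (density P (\<lambda>x. ennreal (f x))) ?L a" by (simp only: f(2))
  also have "density P (\<lambda>x. ennreal (f x)) = density P (\<lambda>x. ennreal (coord (a x)))"
    using c f(1) ce by (intro density_cong) (auto elim: eventually_mono)
  also have "distr (density P (\<lambda>x. ennreal (coord (a x)))) ?L a = density (distr P ?L a) (\<lambda>z. ennreal (coord z))"
    by (rule density_distr[OF coord_borel_L_space m(3), symmetric])
  also have "\<dots> = L_star F" unfolding a(2) L_star_def ..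
  finally show "distr R (L_star F) (a \<circ> g') = L_star F" .
  have "AE x in P. g' (g x) = x" using g by (simp add: null_iso_def)
  then show "AE x in P. (a \<circ> g') (g x) = a x" by eventually_elim simp
qed

text \<open>The interval with atoms enters only as the completion of some Borel probability measure on the line.\<close>

lemma Lebesgue_space_null_iso:
  assumes P: "Lebesgue_space P" "prob_space P"
  obtains U :: "real measure" and \<phi> \<phi>' where "prob_space U" "sets U = sets borel"
    "null_iso P (completion U) \<phi> \<phi>'" "distr P (completion U) \<phi> = completion U"
proof -
  obtain c w \<phi>0 where cP: "complete_measure P" and \<phi>0: "\<phi>0 \<in> measure_iso P (interval_with_atoms c w)"
    using P(1) unfolding Lebesgue_space_def by blast
  define U where "U = measure_of UNIV (sets borel)
     (\<lambda>X. emeasure lborel (X \<inter> {0..c}) + (\<Sum>n. ennreal (w n) * indicator X (- 1 - real n)))"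
  have iU: "interval_with_atoms c w = completion U" unfolding interval_with_atoms_def U_def ..
  have sU: "sets U = sets borel" unfolding U_def
    using sets.sigma_sets_eq[of "borel :: real measure"] by (subst sets_measure_of) auto
  then have "space U = UNIV" using sets_eq_imp_space_eq by fastforce
  then have ne: "space P \<noteq> {}" "space (completion U) \<noteq> {}" using P(2) by (auto dest: prob_space.not_empty)
  obtain \<phi> \<phi>' where \<phi>: "null_iso P (completion U) \<phi> \<phi>'" "distr P (completion U) \<phi> = completion U"
    using \<phi>0 measure_iso_iff[OF cP completion.complete_measure_axioms ne] unfolding iU by blast
  have "prob_space (distr P (completion U) \<phi>)"
    using \<phi>(1) P(2) by (intro prob_space.prob_space_distr) (auto simp: null_iso_def)
  then have "prob_space (completion U)" by (simp only: \<phi>(2))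
  then have "emeasure (completion U) (space (completion U)) = 1" by (rule prob_space.emeasure_space_1)
  then have "emeasure U (space U) = 1" by simp
  then have "prob_space U" by (rule prob_spaceI)
  then show ?thesis using that sU \<phi> by blast
qed

text \<open>The hypotheses on \<open>P\<close> and \<open>f\<close> enter the conditions for admissibility as follows: a point of a copy has the mass of
  at most one point of \<open>P\<close>, which is \<open>0\<close>; the total mass of the family is that of \<open>P\<close>, and the integral
  of the coordinate is the integral of \<open>f\<close>.\<close>

lemma exists_family:
  fixes P :: "'p measure"
  assumes P: "Lebesgue_space P" "prob_space P" "continuous_measure P"
    and f: "f \<in> borel_measurable P" "\<And>x. 0 < f x" "(\<integral>\<^sup>+x. ennreal (f x) \<partial>P) = 1"
  obtains F a a' where "admissible F" "null_iso P (L_space F) a a'" "distr P (L_space F) a = L_space F"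
    "AE x in P. coord (a x) = f x"
proof -
  interpret P: prob_space P by fact
  obtain U :: "real measure" and \<phi> \<phi>' where U: "prob_space U" "sets U = sets borel"
    and \<phi>: "null_iso P (completion U) \<phi> \<phi>'" "distr P (completion U) \<phi> = completion U"
    by (rule Lebesgue_space_null_iso[OF P(1,2)])
  have "(\<lambda>x. f (\<phi>' x)) \<in> borel_measurable (completion U)"
    by (rule measurable_compose[OF _ f(1)]) (use \<phi>(1) in \<open>simp add: null_iso_def\<close>)
  then obtain f1 where f1: "f1 \<in> borel_measurable U" "AE x in U. f (\<phi>' x) = f1 x"
    using completion_ex_borel_measurable_real by blast
  define f0 where "f0 x = (if 0 < f1 x then f1 x else 1)" for x
  have f0: "f0 \<in> measurable U pos_reals" unfolding f0_def
    using f1(1) by (auto simp: measurable_restrict_space2_iff)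
  have "AE x in U. f (\<phi>' x) = f0 x" using f1(2)
  proof eventually_elim
    case (elim x) then show ?case using f(2)[of "\<phi>' x"] by (simp add: f0_def)
  qed
  then have "AE x in completion U. f (\<phi>' x) = f0 x" by (rule AE_completion)
  then have "AE x in P. f (\<phi>' (\<phi> x)) = f0 (\<phi> x)" by (rule null_iso_AE[OF \<phi>(1)])
  moreover have "AE x in P. \<phi>' (\<phi> x) = x" using \<phi>(1) by (simp add: null_iso_def)
  ultimately have ff: "AE x in P. f0 (\<phi> x) = f x" by eventually_elim simp
  obtain \<nu> \<kappa> a0 a0' where s: "\<And>j. sets (\<nu> j) = sets pos_reals" "sets \<kappa> = sets pos_reals"
    and mono: "\<And>j X. X \<in> sets pos_reals \<Longrightarrow> emeasure (\<nu> (Suc j)) X \<le> emeasure (\<nu> j) X"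
    and a0: "null_iso (completion U) (L_space (\<nu>, \<kappa>)) a0 a0'"
      "distr (completion U) (L_space (\<nu>, \<kappa>)) a0 = L_space (\<nu>, \<kappa>)"
    and c: "\<And>x. coord (a0 x) = f0 x"
    by (rule positive_function_model[OF U f0]) blast
  let ?L = "L_space (\<nu>, \<kappa>)"
  note [simp del] = L_space.simps total_measure.simps
  have a: "null_iso P ?L (a0 \<circ> \<phi>) (\<phi>' \<circ> a0')" by (rule null_iso_trans[OF \<phi>(1) a0(1)])
  have da: "distr P ?L (a0 \<circ> \<phi>) = ?L" by (rule null_iso_distr_trans[OF \<phi>(1) a0(1) \<phi>(2) a0(2)])
  have am: "a0 \<circ> \<phi> \<in> measurable P ?L" using a by (simp add: null_iso_def)
  have ca: "AE x in P. coord ((a0 \<circ> \<phi>) x) = f x" using ff by (simp add: c)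
  have "continuous_measure (\<nu> j)" for j
    unfolding continuous_measure_def
  proof
    fix t assume t: "t \<in> space (\<nu> j)"
    then have t0: "0 < t" using sets_eq_imp_space_eq[OF s(1)[of j]] by (simp add: space_restrict_space)
    then have tX: "{t} \<in> sets pos_reals" by (auto simp: sets_restrict_space image_iff intro!: bexI[of _ "{t}"])
    have Cm: "Copy j ` {t} \<in> sets ?L" using Copy_image_L_sets[OF tX] by (simp add: L_space_completion)
    have "emeasure (\<nu> j) {t} = emeasure (L_base (\<nu>, \<kappa>)) (Copy j ` {t})" by (rule emeasure_Copy_image[OF s tX, symmetric])
    also have "\<dots> = emeasure ?L (Copy j ` {t})" using Copy_image_L_sets[OF tX] by (simp add: L_space_completion)
    also have "\<dots> = emeasure (distr P ?L (a0 \<circ> \<phi>)) (Copy j ` {t})" by (simp only: da)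
    also have "\<dots> = emeasure P ((a0 \<circ> \<phi>) -` (Copy j ` {t}) \<inter> space P)" by (rule emeasure_distr[OF am Cm])
    also have "\<dots> = 0"
    proof -
      let ?S = "(a0 \<circ> \<phi>) -` (Copy j ` {t}) \<inter> space P"
      have S: "?S \<in> sets P" by (rule measurable_sets[OF am Cm])
      define x0 where "x0 = (\<phi>' \<circ> a0') (Copy j t)"
      have "Copy j t \<in> space ?L" using t0 by (simp add: L_space_completion L_set_def)
      then have "x0 \<in> space P" unfolding x0_def
        using a by (intro measurable_space[of "\<phi>' \<circ> a0'" ?L]) (simp_all add: null_iso_def)
      then have "{x0} \<in> null_sets P" using P(3) by (simp add: continuous_measure_def)
      then have "AE x in P. x \<noteq> x0" by (intro AE_I'[of "{x0}"]) auto
      moreover have "AE x in P. (\<phi>' \<circ> a0') ((a0 \<circ> \<phi>) x) = x" using a by (simp add: null_iso_def)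
      ultimately have "AE x in P. x \<notin> ?S" by eventually_elim (auto simp: x0_def)
      then have "?S \<in> null_sets P" by (simp only: AE_iff_null_sets[OF S])
      then show ?thesis by (simp add: null_sets_def)
    qed
    finally show "{t} \<in> null_sets (\<nu> j)" using tX s(1) by (simp add: null_sets_def)
  qed
  moreover have "(\<integral>\<^sup>+t. 1 \<partial>total_measure (\<nu>, \<kappa>)) = 1"
  proof -
    have "prob_space (distr (distr P ?L (a0 \<circ> \<phi>)) pos_reals coord)"
      by (intro prob_space.prob_space_distr P.prob_space_distr am) (auto simp: measurable_coord_L_space)
    then have "prob_space (total_measure (\<nu>, \<kappa>))" unfolding da distr_L_space_coord[OF s] .
    from prob_space.emeasure_space_1[OF this] show ?thesis by simp
  qed
  moreover have "(\<integral>\<^sup>+t. ennreal t \<partial>total_measure (\<nu>, \<kappa>)) = 1"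
  proof -
    have "(\<integral>\<^sup>+t. ennreal t \<partial>total_measure (\<nu>, \<kappa>)) = (\<integral>\<^sup>+z. ennreal (coord z) \<partial>distr P ?L (a0 \<circ> \<phi>))"
      unfolding da by (rule nn_integral_coord[OF s, symmetric])
    also have "\<dots> = (\<integral>\<^sup>+x. ennreal (coord ((a0 \<circ> \<phi>) x)) \<partial>P)"
      by (rule nn_integral_distr[OF am]) (simp add: coord_borel_L_space)
    also have "\<dots> = (\<integral>\<^sup>+x. ennreal (f x) \<partial>P)" using ca by (intro nn_integral_cong_AE) (auto elim: eventually_mono)
    finally show ?thesis using f(3) by simp
  qed
  ultimately have "admissible (\<nu>, \<kappa>)" using s mono by simp
  then show ?thesis using a da ca that by blast
qed


lemma exists_representation:
  assumes P: "Lebesgue_space P" "prob_space P" "continuous_measure P"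
    and R: "complete_measure R" "prob_space R" and g: "g \<in> Gms P R"
  shows "\<exists>F. admissible F \<and> represented_by P R g F"
proof -
  have cP: "complete_measure P" using P(1) by (simp add: Lebesgue_space_def)
  interpret R: prob_space R by fact
  obtain u u' where u: "null_iso P R u u'" "AE x in P. g x = u x"
    by (rule Gms_null_iso[OF g prob_space.not_empty[OF P(2)] R.not_empty])
  obtain f where f: "f \<in> borel_measurable P" "\<And>x. 0 < f x" "density P (\<lambda>x. ennreal (f x)) = distr R P u'"
    by (rule null_iso_derivative[OF P(2) R(2) u(1)]) blast
  have fe: "(\<lambda>x. ennreal (f x)) \<in> borel_measurable P" using f(1) by measurable
  have "prob_space (distr R P u')" using u(1) by (intro R.prob_space_distr) (simp add: null_iso_def)
  then have "emeasure (density P (\<lambda>x. ennreal (f x))) (space P) = 1"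
    unfolding f(3) using prob_space.emeasure_space_1 by fastforce
  then have int: "(\<integral>\<^sup>+x. ennreal (f x) \<partial>P) = 1"
    by (subst (asm) emeasure_density[OF fe sets.top]) (simp cong: nn_integral_cong)
  obtain F a a' where F: "admissible F" and a: "null_iso P (L_space F) a a'" "distr P (L_space F) a = L_space F"
    and c: "AE x in P. coord (a x) = f x"
    by (rule exists_family[OF P f(1,2) int])
  note b = derivative_L_star_iso[OF P(2) u(1) f(1,3) a c]
  have "AE x in P. (a \<circ> u') (g x) = a x" using b(3) u(2) by eventually_elim simp
  then have "represented_by P R g F"
    using represented_byI[OF cP P(2) R F a b(1,2) _ u(2,1)] by blast
  then show ?thesis using F by blast
qed

text \<open>Two representations give isomorphisms \<open>a\<close> and \<open>e\<close> of \<open>P\<close> with two models, under both of which the coordinate becomes the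
  derivative \<open>f\<close> of \<open>g\<close>. Then \<open>e \<circ> a\<inverse>\<close> preserves the coordinate.\<close>

lemma representation_unique:
  assumes P: "complete_measure P" "prob_space P" and R: "complete_measure R" "prob_space R" and g: "g \<in> Gms P R"
    and F: "admissible F" "represented_by P R g F" and F': "admissible F'" "represented_by P R g F'"
  shows "F = F'"
proof -
  obtain u u' where u: "null_iso P R u u'" "AE x in P. g x = u x"
    by (rule Gms_null_iso[OF g prob_space.not_empty[OF P(2)] prob_space.not_empty[OF R(2)]])
  obtain f where f: "f \<in> borel_measurable P" "\<And>x. 0 < f x" "density P (\<lambda>x. ennreal (f x)) = distr R P u'"
    by (rule null_iso_derivative[OF P(2) R(2) u(1)]) blast
  have *: "\<exists>a a'. null_iso P (L_space F) a a' \<and> distr P (L_space F) a = L_space F \<and> (AE x in P. coord (a x) = f x)"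
    if rep: "admissible F" "represented_by P R g F" for F
  proof -
    obtain a a' b b' where a: "null_iso P (L_space F) a a'" "distr P (L_space F) a = L_space F"
      and b: "null_iso R (L_star F) b b'" "distr R (L_star F) b = L_star F"
      and eq: "\<And>u u'. null_iso P R u u' \<Longrightarrow> AE x in P. g x = u x \<Longrightarrow> AE x in P. b (u x) = a x"
      by (rule represented_byE[OF P R rep]) blast
    have "b \<in> measurable R (L_space F)" using b(1)[unfolded null_iso_L_star] by (simp add: null_iso_def)
    from coord_eq_derivative[OF P(2) u(1) f a this b(2) eq[OF u]] a show ?thesis by blast
  qed
  obtain a a' where a: "null_iso P (L_space F) a a'" "distr P (L_space F) a = L_space F" "AE x in P. coord (a x) = f x"
    using *[OF F] by blast
  obtain e e' where e: "null_iso P (L_space F') e e'" "distr P (L_space F') e = L_space F'" "AE x in P. coord (e x) = f x"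
    using *[OF F'] by blast
  have ia: "null_iso (L_space F) P a' a" by (rule null_iso_sym[OF a(1)])
  have da: "distr (L_space F) P a' = P" by (rule null_iso_distr_inverse[OF a(1,2)])
  show ?thesis
  proof (rule family_unique[OF F(1) F'(1)])
    show "null_iso (L_space F) (L_space F') (e \<circ> a') (a \<circ> e')" by (rule null_iso_trans[OF ia e(1)])
    show "distr (L_space F) (L_space F') (e \<circ> a') = L_space F'" by (rule null_iso_distr_trans[OF ia e(1) da e(2)])
    have "AE x in P. coord (e x) = coord (a x)" using a(3) e(3) by eventually_elim simp
    then have "AE z in L_space F. coord (e (a' z)) = coord (a (a' z))" by (rule null_iso_AE[OF ia])
    moreover have "AE z in L_space F. a (a' z) = z" using a(1) by (simp add: null_iso_def)
    ultimately show "AE z in L_space F. coord ((e \<circ> a') z) = coord z" by eventually_elim simp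
  qed
qed

text \<open>If \<open>b \<circ> g = a\<close> and \<open>h = u \<circ> g \<circ> v\<close>, then \<open>(b \<circ> u\<inverse>) \<circ> h = a \<circ> v\<close>.\<close>

lemma represented_by_equiv:
  assumes P: "complete_measure P" "prob_space P" and R: "complete_measure R" "prob_space R"
    and g: "g \<in> Gms P R" and h: "h \<in> Gms P R" and eqv: "Gms_equiv P R g h"
    and F: "admissible F" "represented_by P R g F"
  shows "represented_by P R h F"
proof -
  have neP: "space P \<noteq> {}" and neR: "space R \<noteq> {}" using P R by (auto dest: prob_space.not_empty)
  obtain v u where vu: "v \<in> Ams P" "u \<in> Ams R" and hx: "AE x in P. h x = (u \<circ> g \<circ> v) x"
    using eqv unfolding Gms_equiv_def by blast
  obtain v1 v1' where v: "null_iso P P v1 v1'" "AE x in P. v x = v1 x" "distr P P v1 = P"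
    using measure_iso_null_iso[OF P(1) P(1) P(2) P(2) vu(1)[unfolded Ams_def]] by metis
  obtain u1 u1' where u: "null_iso R R u1 u1'" "AE x in R. u x = u1 x" "distr R R u1 = R"
    using measure_iso_null_iso[OF R(1) R(1) R(2) R(2) vu(2)[unfolded Ams_def]] by metis
  obtain g1 g1' where g1: "null_iso P R g1 g1'" "AE x in P. g x = g1 x" by (rule Gms_null_iso[OF g neP neR])
  obtain h1 h1' where h1: "null_iso P R h1 h1'" "AE x in P. h x = h1 x" by (rule Gms_null_iso[OF h neP neR])
  obtain a a' b b' where a: "null_iso P (L_space F) a a'" "distr P (L_space F) a = L_space F"
    and b: "null_iso R (L_star F) b b'" "distr R (L_star F) b = L_star F"
    and eq: "\<And>u u'. null_iso P R u u' \<Longrightarrow> AE x in P. g x = u x \<Longrightarrow> AE x in P. b (u x) = a x"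
    by (rule represented_byE[OF P R F]) blast
  have "AE x in P. b (g1 (v1 x)) = a (v1 x)" by (rule null_iso_AE[OF v(1) eq[OF g1]])
  moreover have "AE x in P. g (v1 x) = g1 (v1 x)" by (rule null_iso_AE[OF v(1) g1(2)])
  moreover have "AE x in P. u (g1 (v1 x)) = u1 (g1 (v1 x))"
    by (rule null_iso_AE[OF v(1)], rule null_iso_AE[OF g1(1) u(2)])
  moreover have "AE x in P. u1' (u1 (g1 (v1 x))) = g1 (v1 x)"
    by (rule null_iso_AE[OF v(1)], rule null_iso_AE[OF g1(1)]) (use u(1) in \<open>simp add: null_iso_def\<close>)
  ultimately have "AE x in P. (b \<circ> u1') (h x) = (a \<circ> v1) x"
    using hx v(2) by eventually_elim simp
  then show ?thesis
    using represented_byI[OF P R F(1) null_iso_trans[OF v(1) a(1)] null_iso_distr_trans[OF v(1) a(1) v(3) a(2)]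
      null_iso_trans[OF null_iso_sym[OF u(1)] b(1)]
      null_iso_distr_trans[OF null_iso_sym[OF u(1)] b(1) null_iso_distr_inverse[OF u(1,3)] b(2)] _ h1(2,1)] by blast
qed

text \<open>If \<open>b \<circ> g = a\<close> and \<open>d \<circ> h = c\<close>, then \<open>h = (d\<inverse> \<circ> b) \<circ> g \<circ> (a\<inverse> \<circ> c)\<close>.\<close>

lemma equiv_if_same_family:
  assumes P: "complete_measure P" "prob_space P" and R: "complete_measure R" "prob_space R"
    and g: "g \<in> Gms P R" and h: "h \<in> Gms P R"
    and F: "admissible F" "represented_by P R g F" "represented_by P R h F"
  shows "Gms_equiv P R g h"
proof -
  have neP: "space P \<noteq> {}" and neR: "space R \<noteq> {}" using P R by (auto dest: prob_space.not_empty)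
  obtain g1 g1' where g1: "null_iso P R g1 g1'" "AE x in P. g x = g1 x" by (rule Gms_null_iso[OF g neP neR])
  obtain h1 h1' where h1: "null_iso P R h1 h1'" "AE x in P. h x = h1 x" by (rule Gms_null_iso[OF h neP neR])
  obtain a a' b b' where a: "null_iso P (L_space F) a a'" "distr P (L_space F) a = L_space F"
    and b: "null_iso R (L_star F) b b'" "distr R (L_star F) b = L_star F"
    and eq: "\<And>u u'. null_iso P R u u' \<Longrightarrow> AE x in P. g x = u x \<Longrightarrow> AE x in P. b (u x) = a x"
    by (rule represented_byE[OF P R F(1,2)]) blast
  obtain c c' d d' where c: "null_iso P (L_space F) c c'" "distr P (L_space F) c = L_space F"
    and d: "null_iso R (L_star F) d d'" "distr R (L_star F) d = L_star F"
    and eq': "\<And>u u'. null_iso P R u u' \<Longrightarrow> AE x in P. h x = u x \<Longrightarrow> AE x in P. d (u x) = c x"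
    by (rule represented_byE[OF P R F(1,3)]) blast
  have v: "null_iso P P (a' \<circ> c) (c' \<circ> a)" "distr P P (a' \<circ> c) = P"
    using null_iso_trans[OF c(1) null_iso_sym[OF a(1)]]
      null_iso_distr_trans[OF c(1) null_iso_sym[OF a(1)] c(2) null_iso_distr_inverse[OF a]] by auto
  have u: "null_iso R R (d' \<circ> b) (b' \<circ> d)" "distr R R (d' \<circ> b) = R"
    using null_iso_trans[OF b(1) null_iso_sym[OF d(1)]]
      null_iso_distr_trans[OF b(1) null_iso_sym[OF d(1)] b(2) null_iso_distr_inverse[OF d]] by auto
  have "a' \<circ> c \<in> Ams P" unfolding Ams_def measure_iso_iff[OF P(1) P(1) neP neP] using v by auto
  moreover have "d' \<circ> b \<in> Ams R" unfolding Ams_def measure_iso_iff[OF R(1) R(1) neR neR] using u by auto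
  moreover have "AE x in P. h x = ((d' \<circ> b) \<circ> g \<circ> (a' \<circ> c)) x"
  proof -
    have "AE x in P. b (g1 ((a' \<circ> c) x)) = a ((a' \<circ> c) x)" by (rule null_iso_AE[OF v(1) eq[OF g1]])
    moreover have "AE x in P. g ((a' \<circ> c) x) = g1 ((a' \<circ> c) x)" by (rule null_iso_AE[OF v(1) g1(2)])
    moreover have "AE x in P. a (a' (c x)) = c x"
      by (rule null_iso_AE[OF c(1)]) (use a(1) in \<open>simp add: null_iso_def\<close>)
    moreover have "AE x in P. d (h1 x) = c x" by (rule eq'[OF h1])
    moreover have "AE x in P. d' (d (h1 x)) = h1 x"
      by (rule null_iso_AE[OF h1(1)]) (use d(1) in \<open>simp add: null_iso_def\<close>)
    ultimately show ?thesis using h1(2)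
    proof eventually_elim
      case (elim x)
      have "((d' \<circ> b) \<circ> g \<circ> (a' \<circ> c)) x = d' (b (g1 ((a' \<circ> c) x)))" using elim(2) by simp
      also have "\<dots> = d' (c x)" using elim(1,3) by simp
      also have "\<dots> = h x" using elim(4,5,6) by simp
      finally show ?case ..
    qed
  qed
  ultimately show ?thesis unfolding Gms_equiv_def by blast
qed

theorem proposition1p4:
  fixes P :: "'p measure" and R :: "'r measure"
  assumes "Lebesgue_space P" and "prob_space P" and "continuous_measure P"
    and "Lebesgue_space R" and "prob_space R" and "continuous_measure R"
  shows "(\<forall>g\<in>Gms P R. \<exists>!F. admissible F \<and> represented_by P R g F) \<and>
    (\<forall>g\<in>Gms P R. \<forall>h\<in>Gms P R.
       Gms_equiv P R g h \<longleftrightarrow>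
       (\<exists>F. admissible F \<and> represented_by P R g F \<and> represented_by P R h F))"
proof -
  have P: "complete_measure P" "prob_space P" and R: "complete_measure R" "prob_space R"
    using assms by (auto simp: Lebesgue_space_def)
  have ex: "\<exists>F. admissible F \<and> represented_by P R g F" if "g \<in> Gms P R" for g
    by (rule exists_representation[OF assms(1-3) R that])
  show ?thesis
  proof (intro conjI ballI)
    fix g assume g: "g \<in> Gms P R"
    then show "\<exists>!F. admissible F \<and> represented_by P R g F"
      using ex[OF g] representation_unique[OF P R g] by blast
    fix h assume h: "h \<in> Gms P R"
    show "Gms_equiv P R g h \<longleftrightarrow> (\<exists>F. admissible F \<and> represented_by P R g F \<and> represented_by P R h F)"
      using ex[OF g] represented_by_equiv[OF P R g h] equiv_if_same_family[OF P R g h] by blast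
  qed
qed

end
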